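(* Let $\alpha>-1/2$ and $\beta>0$ be fixed. Let $t,x,z>0$. Then $$K_t^{\alpha,\beta}(x,z)\simeq\frac{(xz)^{-\alpha-1/2}}{t^{2\alpha+2\beta}}\big[t^2-(x-z)^2\big]^{\alpha+\beta-1/2}\begin{cases}\Big(\frac{(x+z)^2-t^2}{xz}\Big)^{\alpha+\beta-1/2},&\alpha+\beta<1/2,\\ 1+\log\Big(\frac{4xz}{(x+z)^2-t^2}\Big),&\alpha+\beta=1/2,\\ 1,&\alpha+\beta>1/2,\end{cases}$$ uniformly in $|x-z|<t<x+z$, and $$K_t^{\alpha,\beta}(x,z)\simeq\frac{1}{t^{2\alpha+2\beta}}\big[t^2-(x-z)^2\big]^{\beta-1}\begin{cases}\Big(\frac{t^2-(x+z)^2}{t^2-(x-z)^2}\Big)^{\alpha+\beta-1/2},&\alpha+\beta<1/2,\\ 1+\log\Big(\frac{t^2-(x-z)^2}{t^2-(x+z)^2}\Big),&\alpha+\beta=1/2,\\ 1,&\alpha+\beta>1/2,\end{cases}$$ uniformly in $t>x+z$.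
   Context: $J_\nu$ is the Bessel function of the first kind of order $\nu$, and $d\mu_\alpha(y)=y^{2\alpha+1}dy$ on $(0,\infty)$. For $\alpha>-1$, $\alpha+\beta>-1/2$, $t,x,z>0$ with $t\ne|x-z|$, $t\neq x+z$, $$K_t^{\alpha,\beta}(x,z)=2^{\alpha+\beta}\Gamma(\alpha+\beta+1)\int_0^\infty \frac{J_{\alpha+\beta}(ty)}{(ty)^{\alpha+\beta}}\frac{J_\alpha(xy)}{(xy)^\alpha}\frac{J_\alpha(zy)}{(zy)^\alpha}\,d\mu_\alpha(y),$$ the integral converging absolutely if $\alpha+\beta>1/2$ and otherwise, at $\infty$, being understood as an improper Riemann integral. $X\simeq Y$ means $C^{-1}Y\le X\le CY$ with a constant $C>0$ depending only on $\alpha,\beta$ (not on $t,x,z$ in the indicated region). *)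

theory Defs
  imports "HOL-Analysis.Analysis"
begin

text \<open>
  Bessel function of the first kind of real order \<open>\<nu>\<close>, for arguments \<open>x > 0\<close>.  The library function
  \<open>rGamma\<close> is the reciprocal Gamma function, extended by \<open>0\<close> at the poles of \<open>Gamma\<close>.
\<close>
definition bessel_J :: "real \<Rightarrow> real \<Rightarrow> real" where
  "bessel_J \<nu> x =
     (\<Sum>k. (-1) ^ k * rGamma (\<nu> + real k + 1) / fact k * (x / 2) powr (2 * real k + \<nu>))"

text \<open>
  The last factor is the density of \<open>d\<mu>\<^sub>\<alpha>(y) = y\<^bsup>2\<alpha>+1\<^esup> dy\<close>.
\<close>
definition K_integrand :: "real \<Rightarrow> real \<Rightarrow> real \<Rightarrow> real \<Rightarrow> real \<Rightarrow> real \<Rightarrow> real" where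
  "K_integrand \<alpha> \<beta> t x z y =
     bessel_J (\<alpha> + \<beta>) (t * y) / (t * y) powr (\<alpha> + \<beta>)
     * (bessel_J \<alpha> (x * y) / (x * y) powr \<alpha>)
     * (bessel_J \<alpha> (z * y) / (z * y) powr \<alpha>)
     * y powr (2 * \<alpha> + 1)"

text \<open>
  The Lebesgue integral over \<open>(0,\<infinity>)\<close> is used when \<open>\<alpha> + \<beta> > 1/2\<close>, the range of absolute convergence;
  otherwise the integral is improper at \<open>\<infinity>\<close>.  The kernel is meaningful for \<open>\<alpha> > -1\<close>,
  \<open>\<alpha> + \<beta> > -1/2\<close> and \<open>t, x, z > 0\<close> with \<open>t \<noteq> \<bar>x - z\<bar>\<close>, \<open>t \<noteq> x + z\<close>.
\<close>
definition K :: "real \<Rightarrow> real \<Rightarrow> real \<Rightarrow> real \<Rightarrow> real \<Rightarrow> real" where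
  "K \<alpha> \<beta> t x z =
     2 powr (\<alpha> + \<beta>) * Gamma (\<alpha> + \<beta> + 1) *
     (if \<alpha> + \<beta> > 1/2
      then (LBINT y:{0<..}. K_integrand \<alpha> \<beta> t x z y)
      else Lim at_top (\<lambda>R. LBINT y:{0<..R}. K_integrand \<alpha> \<beta> t x z y))"

text \<open>
  \<open>X \<simeq> Y\<close> uniformly in the triples \<open>(t,x,z)\<close> satisfying \<open>D\<close>: a single constant serves all of them.
\<close>
definition simeq_on ::
  "(real \<Rightarrow> real \<Rightarrow> real \<Rightarrow> bool) \<Rightarrow> (real \<Rightarrow> real \<Rightarrow> real \<Rightarrow> real) \<Rightarrow> (real \<Rightarrow> real \<Rightarrow> real \<Rightarrow> real) \<Rightarrow> bool" where
  "simeq_on D X Y \<longleftrightarrow>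
     (\<exists>C>0. \<forall>t x z. D t x z \<longrightarrow> inverse C * Y t x z \<le> X t x z \<and> X t x z \<le> C * Y t x z)"

end

theory Submission
  imports Defs
begin

text \<open>
  Write \<open>\<nu> = \<alpha> + \<beta>\<close>, \<open>T = t\<^sup>2\<close>, \<open>w(u) = (x - z)\<^sup>2 + 4 x z u\<close> and \<open>p = \<alpha> + 1/2\<close>. Up to a factor \<open>T\<^bsup>-\<nu>\<^esup>\<close>
  and a positive constant the kernel is
  \<open>F\<^sub>\<beta>(T) = \<integral> (T - w(u))\<^sub>+\<^bsup>\<beta> - 1\<^esup> (u (1 - u))\<^bsup>p - 1\<^esup> du\<close> over \<open>0 < u < 1\<close>.

  This is first shown for \<open>\<beta> + 1\<close> in place of \<open>\<beta>\<close>, where the defining integral converges absolutely: both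
  sides have the same Laplace transform in \<open>T\<close>, by Weber's exponential integrals and Poisson's integral for
  the modified Bessel function. Differentiating \<open>T\<^bsup>\<nu>\<^esup>\<close> times the integral in \<open>T\<close> lowers \<open>\<beta>\<close> by one on both sides; on the Bessel
  side this needs the improper integral to converge locally uniformly in \<open>T\<close> away from \<open>(x - z)\<^sup>2\<close> and
  \<open>(x + z)\<^sup>2\<close>, which follows from the asymptotics of the Bessel function.

  In both regions \<open>F\<^sub>\<beta>\<close> becomes, after scaling \<open>u\<close>, an Euler integral
  \<open>\<integral> u\<^bsup>p - 1\<^esup> (1 - u)\<^bsup>q - 1\<^esup> (1 - b u)\<^bsup>-r\<^esup> du\<close> with \<open>q - r = \<alpha> + \<beta> - 1/2\<close>, which as \<open>b\<close> tends to \<open>1\<close> is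
  bounded, logarithmic, or of order \<open>(1 - b)\<^bsup>q - r\<^esup>\<close> according to the sign of \<open>q - r\<close>.
\<close>

section \<open>Bessel-Clifford functions\<close>

text \<open>The detour through order \<nu> + 1 is forced: for \<nu> <= 1/2 the defining integral
  does not converge absolutely, so Fubini's theorem cannot produce its Laplace transform, whereas
  \<nu> > -1/2 always gives \<nu> + 1 > 1/2. The factor T^\<nu> is chosen so that the T-derivative
  of T^(\<nu>+1) bc_(\<nu>+1)(-Tq) is T^\<nu> bc_\<nu>(-Tq), in step with that of (T - w)_+^\<beta>,
  which is \<beta> (T - w)_+^(\<beta>-1). The function w comes from the transform: Weber's integral
  yields exp(-s(x^2 + z^2)) times a modified Bessel function of 2sxz, Poisson's integral spreads the
  latter over exponentials exp(2sxz(1 - 2u)), and the total exponent is -s w(u). So w runs from (x -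
  z)^2 to (x + z)^2. The same two values of T are those where one of the frequencies t +- x +- z of
  the Bessel product vanishes, so limits and derivatives at order \<nu> are taken only away from
  them. In the Euler integrals (q, r) is (\<beta>, 1 - p) for t < x + z and (p, 1 - \<beta>) for t >
  x + z, while b is (T - (x - z)^2)/(4xz) or its reciprocal.\<close>

text \<open>The Bessel-Clifford function \<open>bc \<nu>\<close> is entire, and \<open>J\<^sub>\<nu>(x) = (x/2)\<^bsup>\<nu>\<^esup> bc \<nu> (- x\<^sup>2/4)\<close>.\<close>
definition bc_coeff :: "real \<Rightarrow> nat \<Rightarrow> real" where
  "bc_coeff \<nu> k = rGamma (\<nu> + real k + 1) / fact k"

definition bc :: "real \<Rightarrow> real \<Rightarrow> real" where
  "bc \<nu> z = (\<Sum>k. bc_coeff \<nu> k * z ^ k)"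

lemma bc_coeff_Suc': "real (Suc k) * bc_coeff \<nu> (Suc k) = bc_coeff (\<nu> + 1) k"
  by (simp add: bc_coeff_def add_ac)

text \<open>\<open>rGamma_plus1\<close> holds also at the poles of \<open>Gamma\<close>, so the
  coefficient relations, and the derivative and recurrence formulas built on them, are valid for
  every real \<nu>.\<close>

lemma bc_coeff_plus1: "(\<nu> + real k + 1) * bc_coeff (\<nu> + 1) k = bc_coeff \<nu> k"
proof -
  have "(\<nu> + real k + 1) * rGamma (\<nu> + real k + 1 + 1) = rGamma (\<nu> + real k + 1)"
    by (rule rGamma_plus1)
  moreover have "\<nu> + 1 + real k + 1 = \<nu> + real k + 1 + 1"
    by simp
  ultimately show ?thesis
    by (simp only: bc_coeff_def times_divide_eq_right)
qed

lemma bc_coeff_Suc: "real (Suc k) * (real (Suc k) + \<nu>) * bc_coeff \<nu> (Suc k) = bc_coeff \<nu> k"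
proof -
  have "real (Suc k) * (real (Suc k) + \<nu>) * bc_coeff \<nu> (Suc k) = (\<nu> + real k + 1) * (real (Suc k) * bc_coeff \<nu> (Suc k))"
    by (simp add: add_ac)
  then show ?thesis
    by (simp only: bc_coeff_Suc' bc_coeff_plus1)
qed

lemma bc_coeff_pos: "\<nu> > -1 \<Longrightarrow> bc_coeff \<nu> k > 0"
  by (simp add: bc_coeff_def rGamma_inverse_Gamma Gamma_real_pos)

lemma summable_bc_abs: "summable (\<lambda>k. \<bar>bc_coeff \<nu> k * z ^ k\<bar>)"
proof (rule summable_ratio_test)
  \<comment> \<open>From this index on (k + 1)(k + 1 + \<nu>) is at least 2|z|, so by
    \<open>bc_coeff_Suc\<close> consecutive terms shrink by a factor 1/2.\<close>
  let ?N = "nat \<lceil>2 * \<bar>z\<bar> + \<bar>\<nu>\<bar> + 2\<rceil>"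
  fix k assume k: "k \<ge> ?N"
  have k1: "real (Suc k) \<ge> 2 * \<bar>z\<bar> + \<bar>\<nu>\<bar> + 2"
    using k by linarith
  have "real (Suc k) * (real (Suc k) + \<nu>) \<ge> (2 * \<bar>z\<bar>) * 1"
    by (rule mult_mono) (use k1 in linarith)+
  then have "2 * \<bar>z\<bar> \<le> \<bar>real (Suc k) * (real (Suc k) + \<nu>)\<bar>"
    by linarith
  then have "\<bar>bc_coeff \<nu> (Suc k)\<bar> * (2 * \<bar>z\<bar>) \<le> \<bar>bc_coeff \<nu> (Suc k)\<bar> * \<bar>real (Suc k) * (real (Suc k) + \<nu>)\<bar>"
    by (rule mult_left_mono) simp
  also have "\<dots> = \<bar>bc_coeff \<nu> k\<bar>"
    by (subst bc_coeff_Suc[of k \<nu>, symmetric]) (simp only: abs_mult[symmetric] mult.commute)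
  finally have *: "\<bar>bc_coeff \<nu> (Suc k)\<bar> * (2 * \<bar>z\<bar>) \<le> \<bar>bc_coeff \<nu> k\<bar>" .
  have "\<bar>bc_coeff \<nu> (Suc k)\<bar> * \<bar>z\<bar> \<le> 1/2 * \<bar>bc_coeff \<nu> k\<bar>"
    using * by linarith
  then have "\<bar>bc_coeff \<nu> (Suc k)\<bar> * \<bar>z\<bar> * \<bar>z\<bar> ^ k \<le> (1/2 * \<bar>bc_coeff \<nu> k\<bar>) * \<bar>z\<bar> ^ k"
    by (rule mult_right_mono) simp
  then show "norm \<bar>bc_coeff \<nu> (Suc k) * z ^ Suc k\<bar> \<le> 1/2 * norm \<bar>bc_coeff \<nu> k * z ^ k\<bar>"
    by (simp only: abs_mult power_abs power_Suc real_norm_def abs_idempotent mult.assoc)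
qed simp

lemma summable_bc: "summable (\<lambda>k. bc_coeff \<nu> k * z ^ k)"
  by (rule summable_rabs_cancel[OF summable_bc_abs])

lemma bc_sums: "(\<lambda>k. bc_coeff \<nu> k * z ^ k) sums bc \<nu> z"
  unfolding bc_def by (rule summable_sums[OF summable_bc])

lemma diffs_bc_coeff: "diffs (bc_coeff \<nu>) = bc_coeff (\<nu> + 1)"
  by (rule ext) (simp add: diffs_def bc_coeff_Suc' del: of_nat_Suc)

lemma has_real_derivative_bc: "(bc \<nu> has_real_derivative bc (\<nu> + 1) z) (at z)"
proof -
  have "((\<lambda>z. \<Sum>k. bc_coeff \<nu> k * z ^ k) has_real_derivative (\<Sum>k. diffs (bc_coeff \<nu>) k * z ^ k)) (at z)"
    by (rule termdiffs_strong_converges_everywhere) (rule summable_bc)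
  then show ?thesis by (simp add: diffs_bc_coeff bc_def[abs_def])
qed

text \<open>The three-term recurrence of Bessel functions; since differentiation raises the order by
  one, it is also the differential equation. In \<open>bc_coeff_plus1\<close> the summand with
  factor k gives the shifted series of order \<nu> + 2, the rest the series of order \<nu> +
  1.\<close>

lemma bc_recurrence: "z * bc (\<nu> + 2) z + (\<nu> + 1) * bc (\<nu> + 1) z = bc \<nu> z"
proof -
  have eq: "(\<lambda>k. bc_coeff \<nu> k * z ^ k) =
     (\<lambda>k. (case k of 0 \<Rightarrow> 0 | Suc n \<Rightarrow> z * (bc_coeff (\<nu> + 2) n * z ^ n)) + (\<nu> + 1) * (bc_coeff (\<nu> + 1) k * z ^ k))"
  proof (rule ext)
    fix k show "bc_coeff \<nu> k * z ^ k = (case k of 0 \<Rightarrow> 0 | Suc n \<Rightarrow> z * (bc_coeff (\<nu> + 2) n * z ^ n)) + (\<nu> + 1) * (bc_coeff (\<nu> + 1) k * z ^ k)"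
    proof (cases k)
      case 0
      show ?thesis using bc_coeff_plus1[of \<nu> 0] 0 by simp
    next
      case (Suc n)
      have "bc_coeff \<nu> (Suc n) = (\<nu> + real (Suc n) + 1) * bc_coeff (\<nu> + 1) (Suc n)"
        by (rule bc_coeff_plus1[symmetric])
      also have "\<dots> = real (Suc n) * bc_coeff (\<nu> + 1) (Suc n) + (\<nu> + 1) * bc_coeff (\<nu> + 1) (Suc n)"
        by (simp add: algebra_simps)
      also have "real (Suc n) * bc_coeff (\<nu> + 1) (Suc n) = bc_coeff (\<nu> + 2) n"
        by (simp only: bc_coeff_Suc') (simp add: add_ac)
      finally show ?thesis using Suc by (simp add: algebra_simps)
    qed
  qed
  have "(\<lambda>k. case k of 0 \<Rightarrow> 0 | Suc n \<Rightarrow> z * (bc_coeff (\<nu> + 2) n * z ^ n)) sums (z * bc (\<nu> + 2) z)"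
    using sums_Suc_iff[of "\<lambda>k. case k of 0 \<Rightarrow> 0 | Suc n \<Rightarrow> z * (bc_coeff (\<nu> + 2) n * z ^ n)" "z * bc (\<nu> + 2) z"]
    by (simp add: sums_mult bc_sums)
  moreover have "(\<lambda>k. (\<nu> + 1) * (bc_coeff (\<nu> + 1) k * z ^ k)) sums ((\<nu> + 1) * bc (\<nu> + 1) z)"
    by (intro sums_mult bc_sums)
  ultimately have "(\<lambda>k. bc_coeff \<nu> k * z ^ k) sums (z * bc (\<nu> + 2) z + (\<nu> + 1) * bc (\<nu> + 1) z)"
    unfolding eq by (rule sums_add)
  with bc_sums show ?thesis by (rule sums_unique2[symmetric])
qed

lemma DERIV_bc:
  assumes "(g has_real_derivative g') (at x within S)"
  shows "((\<lambda>x. bc \<nu> (g x)) has_real_derivative bc (\<nu> + 1) (g x) * g') (at x within S)"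
  by (rule DERIV_chain2[OF has_real_derivative_bc assms])

lemma continuous_on_bc:
  assumes "continuous_on S g"
  shows "continuous_on S (\<lambda>x. bc \<nu> (g x))"
proof -
  have "continuous_on UNIV (bc \<nu>)"
    by (rule continuous_at_imp_continuous_on) (blast intro: DERIV_isCont[OF has_real_derivative_bc])
  from continuous_on_compose2[OF this assms] show ?thesis by simp
qed

lemma borel_measurable_bc [measurable]: "bc \<nu> \<in> borel_measurable borel"
  using continuous_on_bc[OF continuous_on_id, of UNIV] by (rule borel_measurable_continuous_onI)

text \<open>The product rule leaves orders \<nu> + 1 and \<nu> + 2, which the recurrence merges into
  order \<nu>. This is the step by which the order of the kernel is lowered.\<close>

lemma DERIV_powr_bc:
  assumes "T > 0"
  shows "((\<lambda>T. T powr (\<nu> + 1) * bc (\<nu> + 1) (- T * q)) has_real_derivative T powr \<nu> * bc \<nu> (- T * q)) (at T within S)"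
proof -
  have 1: "((\<lambda>T. T powr (\<nu> + 1)) has_real_derivative (\<nu> + 1) * T powr \<nu>) (at T within S)"
    using has_real_derivative_powr[OF assms, of "\<nu> + 1"] by (auto intro: DERIV_subset)
  have 2: "((\<lambda>T. bc (\<nu> + 1) (- T * q)) has_real_derivative bc (\<nu> + 1 + 1) (- T * q) * (- q)) (at T within S)"
    by (rule DERIV_bc) (auto intro!: derivative_eq_intros)
  have "((\<lambda>T. T powr (\<nu> + 1) * bc (\<nu> + 1) (- T * q)) has_real_derivative
      (\<nu> + 1) * T powr \<nu> * bc (\<nu> + 1) (- T * q) + bc (\<nu> + 2) (- T * q) * (- q) * T powr (\<nu> + 1)) (at T within S)"
    using DERIV_mult[OF 1 2] by (simp add: add_ac)
  also have "(\<nu> + 1) * T powr \<nu> * bc (\<nu> + 1) (- T * q) + bc (\<nu> + 2) (- T * q) * (- q) * T powr (\<nu> + 1)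
     = T powr \<nu> * ((- T * q) * bc (\<nu> + 2) (- T * q) + (\<nu> + 1) * bc (\<nu> + 1) (- T * q))"
    using assms by (simp add: powr_add algebra_simps)
  finally show ?thesis by (simp only: bc_recurrence)
qed

section \<open>Asymptotics of Bessel functions\<close>

text \<open>The bound makes f - M/x increasing and f + M/x decreasing, so every lower value is below
  every upper value, and the supremum L of the lower curve lies between the two.\<close>

lemma limit_of_derivative_bound:
  fixes f :: "real \<Rightarrow> real"
  assumes der: "\<And>x. x \<ge> 1 \<Longrightarrow> (f has_real_derivative f' x) (at x)"
    and bnd: "\<And>x. x \<ge> 1 \<Longrightarrow> \<bar>f' x\<bar> \<le> M / x\<^sup>2"
  shows "\<exists>L. \<forall>x\<ge>1. \<bar>f x - L\<bar> \<le> M / x"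
proof -
  have up: "f x - M / x \<le> f y - M / y" if "1 \<le> x" "x \<le> y" for x y
  proof (rule DERIV_nonneg_imp_nondecreasing[OF \<open>x \<le> y\<close>])
    fix u assume u: "x \<le> u" "u \<le> y"
    have "((\<lambda>x. f x - M / x) has_real_derivative f' u + M / u\<^sup>2) (at u)"
      using u that by (auto intro!: derivative_eq_intros der simp: power2_eq_square)
    moreover have "0 \<le> f' u + M / u\<^sup>2"
      using bnd[of u] u that by linarith
    ultimately show "\<exists>y. ((\<lambda>x. f x - M / x) has_real_derivative y) (at u) \<and> 0 \<le> y"
      by blast
  qed
  have dn: "f y + M / y \<le> f x + M / x" if "1 \<le> x" "x \<le> y" for x y
  proof (rule DERIV_nonpos_imp_nonincreasing[OF \<open>x \<le> y\<close>])
    fix u assume u: "x \<le> u" "u \<le> y"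
    have "((\<lambda>x. f x + M / x) has_real_derivative f' u - M / u\<^sup>2) (at u)"
      using u that by (auto intro!: derivative_eq_intros der simp: power2_eq_square)
    moreover have "f' u - M / u\<^sup>2 \<le> 0"
      using bnd[of u] u that by linarith
    ultimately show "\<exists>y. ((\<lambda>x. f x + M / x) has_real_derivative y) (at u) \<and> y \<le> 0"
      by blast
  qed
  have "\<bar>f' 1\<bar> \<le> M" using bnd[of 1] by simp
  then have M: "M \<ge> 0" by linarith
  have cross: "f x - M / x \<le> f y + M / y" if "1 \<le> x" "1 \<le> y" for x y
  proof -
    have "f x - M / x \<le> f (max x y) - M / max x y" using that by (intro up) auto
    also have "\<dots> \<le> f (max x y) + M / max x y" using that M by simp
    also have "\<dots> \<le> f y + M / y" using that by (intro dn) auto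
    finally show ?thesis .
  qed
  define L where "L = (SUP x\<in>{1..}. f x - M / x)"
  have bdd: "bdd_above ((\<lambda>x. f x - M / x) ` {1..})"
    by (rule bdd_aboveI2[of _ _ "f 1 + M / 1"]) (use cross[of _ 1] in simp)
  have "\<bar>f x - L\<bar> \<le> M / x" if x: "x \<ge> 1" for x
  proof -
    have "f x - M / x \<le> L"
      unfolding L_def by (rule cSUP_upper[OF _ bdd]) (use x in simp)
    moreover have "L \<le> f x + M / x"
      unfolding L_def by (rule cSUP_least) (use x cross in auto)
    ultimately show ?thesis by linarith
  qed
  then show ?thesis by blast
qed

text \<open>Variation of constants in the perturbed oscillator: \<open>a = u cos x - u' sin x\<close> and
  \<open>b = u sin x + u' cos x\<close> have derivatives of order \<open>1/x\<^sup>2\<close>, once \<open>u\<^sup>2 + u'\<^sup>2\<close> is known to be bounded.\<close>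
lemma perturbed_oscillator_asymptotics:
  fixes u v :: "real \<Rightarrow> real"
  assumes u: "\<And>x. x > 0 \<Longrightarrow> (u has_real_derivative v x) (at x)"
    and v: "\<And>x. x > 0 \<Longrightarrow> (v has_real_derivative (c / x\<^sup>2 - 1) * u x) (at x)"
  shows "\<exists>A \<phi> C. \<forall>x\<ge>1. \<bar>u x - A * cos (x + \<phi>)\<bar> \<le> C / x"
proof -
  define E where "E = (\<lambda>x. (u x)\<^sup>2 + (v x)\<^sup>2)"
  \<comment> \<open>A Gronwall factor: |E'| is at most |c| E / x^2, and differentiating exp(|c|/x)
    contributes - |c| E / x^2. Hence F decreases and bounds the energy E on [1, oo).\<close>
  define F where "F = (\<lambda>x. E x * exp (\<bar>c\<bar> / x))"
  have F': "(F has_real_derivative (2 * c / x\<^sup>2 * (u x * v x) - E x * (\<bar>c\<bar> / x\<^sup>2)) * exp (\<bar>c\<bar> / x)) (at x)"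
    if "x > 0" for x
    unfolding F_def E_def using that u[OF that] v[OF that]
    by (auto intro!: derivative_eq_intros simp: power2_eq_square algebra_simps)
  have "F x \<le> F 1" if "x \<ge> 1" for x
  proof (rule DERIV_nonpos_imp_nonincreasing[OF that])
    fix y assume y: "1 \<le> y" "y \<le> x"
    have "2 * (c * (u y * v y)) \<le> \<bar>c\<bar> * (2 * \<bar>u y * v y\<bar>)"
      using abs_ge_self[of "c * (u y * v y)"] by (simp add: abs_mult)
    also have "\<dots> \<le> \<bar>c\<bar> * E y"
    proof (rule mult_left_mono)
      show "2 * \<bar>u y * v y\<bar> \<le> E y"
        using sum_squares_bound[of "\<bar>u y\<bar>" "\<bar>v y\<bar>"] by (simp add: E_def abs_mult)
    qed simp
    finally have "2 * (c * (u y * v y)) - \<bar>c\<bar> * E y \<le> 0" by simp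
    then have "(2 * (c * (u y * v y)) - \<bar>c\<bar> * E y) / y\<^sup>2 * exp (\<bar>c\<bar> / y) \<le> 0"
      by (intro mult_nonpos_nonneg divide_nonpos_nonneg) auto
    then have "(2 * c / y\<^sup>2 * (u y * v y) - E y * (\<bar>c\<bar> / y\<^sup>2)) * exp (\<bar>c\<bar> / y) \<le> 0"
      by (simp add: diff_divide_distrib mult_ac)
    then show "\<exists>z. (F has_real_derivative z) (at y) \<and> z \<le> 0"
      using F'[of y] y by (intro exI conjI) auto
  qed
  moreover have "E x \<le> F x" if "x \<ge> 1" for x
  proof -
    have "E x * 1 \<le> E x * exp (\<bar>c\<bar> / x)"
      using that by (intro mult_left_mono) (auto simp: E_def)
    then show ?thesis by (simp add: F_def)
  qed
  ultimately have E: "E x \<le> F 1" if "x \<ge> 1" for x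
    using that order_trans by blast
  define M where "M = sqrt (F 1)"
  have M: "\<bar>u x\<bar> \<le> M" if "x \<ge> 1" for x
  proof -
    have "(u x)\<^sup>2 \<le> F 1" using E[OF that] zero_le_power2[of "v x"] unfolding E_def by linarith
    then have "sqrt ((u x)\<^sup>2) \<le> M" unfolding M_def by (rule real_sqrt_le_mono)
    then show ?thesis by simp
  qed
  have bound: "\<bar>c / x\<^sup>2 * u x * s\<bar> \<le> \<bar>c\<bar> * M / x\<^sup>2" if "x \<ge> 1" "\<bar>s\<bar> \<le> 1" for x s
  proof -
    have "\<bar>u x\<bar> * \<bar>s\<bar> \<le> M * 1" using that M[OF that(1)] by (intro mult_mono) auto
    then have "\<bar>c\<bar> / x\<^sup>2 * (\<bar>u x\<bar> * \<bar>s\<bar>) \<le> \<bar>c\<bar> / x\<^sup>2 * (M * 1)"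
      by (intro mult_left_mono) auto
    then show ?thesis by (simp add: abs_mult mult_ac)
  qed
  have "\<exists>L. \<forall>x\<ge>1. \<bar>(u x * cos x - v x * sin x) - L\<bar> \<le> \<bar>c\<bar> * M / x"
  proof (rule limit_of_derivative_bound)
    fix x :: real assume x: "x \<ge> 1"
    show "((\<lambda>x. u x * cos x - v x * sin x) has_real_derivative - (c / x\<^sup>2 * u x * sin x)) (at x)"
      using x by (auto intro!: derivative_eq_intros u v simp: algebra_simps)
    show "\<bar>- (c / x\<^sup>2 * u x * sin x)\<bar> \<le> \<bar>c\<bar> * M / x\<^sup>2"
      unfolding abs_minus_cancel by (rule bound[OF x]) simp
  qed
  then obtain a where a: "\<And>x. x \<ge> 1 \<Longrightarrow> \<bar>(u x * cos x - v x * sin x) - a\<bar> \<le> \<bar>c\<bar> * M / x" by blast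
  have "\<exists>L. \<forall>x\<ge>1. \<bar>(u x * sin x + v x * cos x) - L\<bar> \<le> \<bar>c\<bar> * M / x"
  proof (rule limit_of_derivative_bound)
    fix x :: real assume x: "x \<ge> 1"
    show "((\<lambda>x. u x * sin x + v x * cos x) has_real_derivative (c / x\<^sup>2 * u x * cos x)) (at x)"
      using x by (auto intro!: derivative_eq_intros u v simp: algebra_simps)
    show "\<bar>c / x\<^sup>2 * u x * cos x\<bar> \<le> \<bar>c\<bar> * M / x\<^sup>2"
      by (rule bound[OF x]) simp
  qed
  then obtain b where b: "\<And>x. x \<ge> 1 \<Longrightarrow> \<bar>(u x * sin x + v x * cos x) - b\<bar> \<le> \<bar>c\<bar> * M / x" by blast
  \<comment> \<open>Polar coordinates of (a, -b) turn a cos x + b sin x into r cos(x +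
    \<phi>).\<close>
  obtain r \<phi> where r: "Complex a (-b) = rcis r \<phi>"
    using rcis_Ex by blast
  have ab: "a = r * cos \<phi>" "- b = r * sin \<phi>"
    using arg_cong[OF r, of Re] arg_cong[OF r, of Im] by (auto simp: rcis_def)
  have "\<bar>u x - r * cos (x + \<phi>)\<bar> \<le> (2 * \<bar>c\<bar> * M) / x" if x: "x \<ge> 1" for x
  proof -
    define d1 where "d1 = (u x * cos x - v x * sin x) - a"
    define d2 where "d2 = (u x * sin x + v x * cos x) - b"
    have "(u x * cos x - v x * sin x) = d1 + r * cos \<phi>" "(u x * sin x + v x * cos x) = d2 - r * sin \<phi>"
      using ab by (simp_all add: d1_def d2_def)
    moreover have "(sin x)\<^sup>2 + (cos x)\<^sup>2 = 1" by simp
    ultimately have "u x - r * cos (x + \<phi>) = d1 * cos x + d2 * sin x"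
      unfolding cos_add by algebra
    moreover have "\<bar>d1 * cos x\<bar> \<le> (\<bar>c\<bar> * M / x) * 1"
      unfolding abs_mult d1_def using a[OF x] by (intro mult_mono) auto
    moreover have "\<bar>d2 * sin x\<bar> \<le> (\<bar>c\<bar> * M / x) * 1"
      unfolding abs_mult d2_def using b[OF x] by (intro mult_mono) auto
    ultimately show ?thesis by simp
  qed
  then show ?thesis by blast
qed

text \<open>The function here is 2^\<mu> sqrt x J_\<mu>(x). Removing the first-order term of
  Bessel's equation in this way leaves u'' = (a(a - 1)/x^2 - 1) u with a = \<mu> + 1/2, a perturbed
  oscillator.\<close>

lemma bc_asymptotics:
  "\<exists>A \<phi> C. \<forall>x\<ge>1. \<bar>x powr (\<mu> + 1/2) * bc \<mu> (- (x\<^sup>2) / 4) - A * cos (x + \<phi>)\<bar> \<le> C / x"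
proof -
  define a where "a = \<mu> + 1/2"
  define f where "f = (\<lambda>n x. bc (\<mu> + n) (- (x\<^sup>2) / 4))"
  define v where "v = (\<lambda>x. a * x powr (a - 1) * f 0 x - x powr (a + 1) / 2 * f 1 x)"
  have f: "(f n has_real_derivative f (n + 1) x * (- (x / 2))) (at x)" for n x
    unfolding f_def
    by (rule DERIV_cong[OF DERIV_bc[where g' = "- (x / 2)"]]) (auto intro!: derivative_eq_intros simp: add_ac)
  have rec: "- (x\<^sup>2) / 4 * f 2 x + (\<mu> + 1) * f 1 x = f 0 x" for x
    using bc_recurrence[of "- (x\<^sup>2) / 4" \<mu>] by (simp add: f_def)
  have pw: "((\<lambda>x. x powr r) has_real_derivative r * x powr (r - 1)) (at x)" if "x > 0" for r x
    using that by (rule has_real_derivative_powr)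
  have "\<exists>A \<phi> C. \<forall>x\<ge>1. \<bar>x powr a * f 0 x - A * cos (x + \<phi>)\<bar> \<le> C / x"
  proof (rule perturbed_oscillator_asymptotics)
    fix x :: real assume x: "x > 0"
    have p1: "x powr (a + 1) = x powr a * x" "x powr a = x powr (a - 1) * x"
      "x powr (a - 1) = x powr (a - 2) * x"
      using x by (simp_all add: powr_mult_base mult.commute powr_diff)  (simp_all add: powr_add power2_eq_square field_simps)
    have m: "\<mu> + 1 = a + 1/2" by (simp add: a_def)
    show "((\<lambda>x. x powr a * f 0 x) has_real_derivative v x) (at x)"
      by (rule DERIV_cong[OF DERIV_mult[OF pw[OF x] f]]) (simp add: v_def p1)
    have "(v has_real_derivative
        (a * ((a - 1) * x powr (a - 1 - 1))) * f 0 x + f (0 + 1) x * (- (x / 2)) * (a * x powr (a - 1))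
        - (((a + 1) * x powr (a + 1 - 1)) / 2 * f 1 x + f (1 + 1) x * (- (x / 2)) * (x powr (a + 1) / 2))) (at x)"
      unfolding v_def by (intro DERIV_diff DERIV_mult DERIV_cmult DERIV_cdivide pw x f)
    also have "(a * ((a - 1) * x powr (a - 1 - 1))) * f 0 x + f (0 + 1) x * (- (x / 2)) * (a * x powr (a - 1))
        - (((a + 1) * x powr (a + 1 - 1)) / 2 * f 1 x + f (1 + 1) x * (- (x / 2)) * (x powr (a + 1) / 2))
       = (a * (a - 1) / x\<^sup>2) * (x powr a * f 0 x) - x powr a * (- (x\<^sup>2) / 4 * f 2 x + (\<mu> + 1) * f 1 x)"
      unfolding m using x by (simp add: p1 p1(1)[unfolded add.commute[of a]] power2_eq_square field_simps)
    also have "\<dots> = (a * (a - 1) / x\<^sup>2 - 1) * (x powr a * f 0 x)"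
      unfolding rec by (simp add: algebra_simps)
    finally show "(v has_real_derivative (a * (a - 1) / x\<^sup>2 - 1) * (x powr a * f 0 x)) (at x)" .
  qed
  then show ?thesis by (simp add: a_def f_def)
qed

text \<open>The asymptotics give the decay for x >= 1 and compactness gives a bound on [0, 1]. As
  the exponent - \<mu> - 1/2 is negative, the power is at most 1 in the first range and at least 1
  in the second, so one constant serves both estimates.\<close>

lemma bc_bounds:
  assumes "\<mu> > -1/2"
  shows "\<exists>C>0. \<forall>x>0. \<bar>bc \<mu> (- (x\<^sup>2) / 4)\<bar> \<le> C \<and> \<bar>bc \<mu> (- (x\<^sup>2) / 4)\<bar> \<le> C * x powr (- \<mu> - 1/2)"
proof -
  define f where "f = (\<lambda>x. bc \<mu> (- (x\<^sup>2) / 4))"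
  obtain A \<phi> C where C: "\<And>x. x \<ge> 1 \<Longrightarrow> \<bar>x powr (\<mu> + 1/2) * f x - A * cos (x + \<phi>)\<bar> \<le> C / x"
    using bc_asymptotics unfolding f_def by blast
  have C0: "C \<ge> 0" using C[of 1] by simp
  have big: "\<bar>f x\<bar> \<le> (\<bar>A\<bar> + C) * x powr (- \<mu> - 1/2)" if x: "x \<ge> 1" for x
  proof -
    have "C / x \<le> C" using C0 x by (simp add: divide_le_eq mult_le_cancel_left1)
    moreover have "\<bar>A * cos (x + \<phi>)\<bar> \<le> \<bar>A\<bar> * 1"
      unfolding abs_mult by (intro mult_left_mono) auto
    ultimately have "\<bar>x powr (\<mu> + 1/2) * f x\<bar> \<le> \<bar>A\<bar> + C"
      using C[OF x] by linarith
    then have "x powr (- (\<mu> + 1/2)) * \<bar>x powr (\<mu> + 1/2) * f x\<bar> \<le> x powr (- (\<mu> + 1/2)) * (\<bar>A\<bar> + C)"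
      by (intro mult_left_mono) auto
    moreover have "x powr (- (\<mu> + 1/2)) * x powr (\<mu> + 1/2) = 1"
      using x by (simp flip: powr_add)
    ultimately have "\<bar>f x\<bar> \<le> x powr (- (\<mu> + 1/2)) * (\<bar>A\<bar> + C)"
      by (simp add: abs_mult flip: mult.assoc)
    then show ?thesis by (simp add: mult.commute)
  qed
  have "continuous_on {0..1} f"
    unfolding f_def by (intro continuous_on_bc continuous_intros) simp
  then have "bounded (f ` {0..1})"
    by (intro compact_imp_bounded compact_continuous_image) auto
  then obtain B where "\<forall>y\<in>f ` {0..1}. norm y \<le> B"
    unfolding bounded_iff by blast
  then have B: "\<bar>f x\<bar> \<le> B" if "0 \<le> x" "x \<le> 1" for x
    using that by auto
  define D where "D = \<bar>A\<bar> + C + B + 1"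
  have B0: "B \<ge> 0" using B[of 0] by simp
  have "\<bar>f x\<bar> \<le> D \<and> \<bar>f x\<bar> \<le> D * x powr (- \<mu> - 1/2)" if x: "x > 0" for x
  proof (cases "x \<ge> 1")
    case True
    have p: "x powr (- \<mu> - 1/2) \<le> 1"
      using powr_mono[of "- \<mu> - 1/2" 0 x] True assms by simp
    have le: "\<bar>f x\<bar> \<le> D * x powr (- \<mu> - 1/2)"
      by (rule order_trans[OF big[OF True] mult_right_mono]) (use B0 in \<open>auto simp: D_def\<close>)
    moreover have "D * x powr (- \<mu> - 1/2) \<le> D * 1"
      using C0 B0 by (intro mult_left_mono p) (auto simp: D_def)
    ultimately show ?thesis by simp
  next
    case False
    have p: "x powr (- \<mu> - 1/2) \<ge> 1"
      using powr_mono'[of "- \<mu> - 1/2" 0 x] False x assms by simp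
    have le: "\<bar>f x\<bar> \<le> D"
      using B[of x] False x C0 by (simp add: D_def)
    moreover have "D * 1 \<le> D * x powr (- \<mu> - 1/2)"
      using C0 B0 by (intro mult_left_mono p) (auto simp: D_def)
    ultimately show ?thesis by simp
  qed
  moreover have "D > 0" using C0 B0 by (simp add: D_def)
  ultimately show ?thesis unfolding f_def by blast
qed

section \<open>The improper integral\<close>

text \<open>Integration by parts: the boundary terms and the remaining integral of p y^(-p-1) /
  |\<omega>| are each of order R^(-p) / |\<omega>|. The bound is uniform in the upper limit and in
  the phase.\<close>

lemma powr_cos_integral_bound:
  fixes p \<omega> :: real
  assumes p: "p > 0" and \<omega>: "\<omega> \<noteq> 0" and R: "0 < R" "R \<le> R'"
  shows "\<bar>integral {R..R'} (\<lambda>y. y powr (-p) * cos (\<omega> * y + \<phi>))\<bar> \<le> 3 * R powr (-p) / \<bar>\<omega>\<bar>"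
proof -
  define g where "g = (\<lambda>y. y powr (-p) * sin (\<omega> * y + \<phi>) / \<omega>)"
  define h where "h = (\<lambda>y. y powr (-p) * cos (\<omega> * y + \<phi>))"
  define g' where "g' = (\<lambda>y. h y - p * y powr (-p-1) * sin (\<omega> * y + \<phi>) / \<omega>)"
  have pw: "((\<lambda>x. x powr (-p)) has_real_derivative (-p) * x powr (-p - 1)) (at x)" if "x > 0" for x
    using that by (rule has_real_derivative_powr)
  have g': "(g has_real_derivative g' y) (at y)" if "y > 0" for y
    unfolding g_def g'_def h_def using \<omega> that
    by (auto intro!: derivative_eq_intros pw simp: field_simps)
  have ig: "(g' has_integral (g R' - g R)) {R..R'}"
    using R by (intro fundamental_theorem_of_calculus)
       (auto intro!: DERIV_subset[OF g'] simp flip: has_real_derivative_iff_has_vector_derivative)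
  have ih: "h integrable_on {R..R'}"
    unfolding h_def using R by (intro integrable_continuous_real continuous_intros) auto
  have kd: "((\<lambda>y. - (y powr (-p) / \<bar>\<omega>\<bar>)) has_real_derivative p * y powr (-p-1) / \<bar>\<omega>\<bar>) (at y)" if "y > 0" for y
    by (rule DERIV_cong[OF DERIV_minus[OF DERIV_cdivide[OF pw[OF that]]]]) simp
  have ik: "((\<lambda>y. p * y powr (-p-1) / \<bar>\<omega>\<bar>) has_integral (- (R' powr (-p) / \<bar>\<omega>\<bar>) - - (R powr (-p) / \<bar>\<omega>\<bar>))) {R..R'}"
    using R
    by (intro fundamental_theorem_of_calculus)
       (auto intro!: DERIV_subset[OF kd] simp flip: has_real_derivative_iff_has_vector_derivative)
  have "norm (integral {R..R'} (\<lambda>y. h y - g' y)) \<le> integral {R..R'} (\<lambda>y. p * y powr (-p-1) / \<bar>\<omega>\<bar>)"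
  proof (rule integral_norm_bound_integral)
    show "(\<lambda>y. h y - g' y) integrable_on {R..R'}"
      using ih ig by (intro integrable_diff) auto
    show "(\<lambda>y. p * y powr (-p-1) / \<bar>\<omega>\<bar>) integrable_on {R..R'}" using ik by auto
    fix y
    have "\<bar>p * y powr (-p-1) * sin (\<omega> * y + \<phi>)\<bar> \<le> p * y powr (-p-1) * 1"
      unfolding abs_mult using p by (intro mult_mono) auto
    then show "norm (h y - g' y) \<le> p * y powr (-p-1) / \<bar>\<omega>\<bar>"
      by (auto simp: g'_def intro: divide_right_mono)
  qed
  also have "\<dots> = (R powr (-p) - R' powr (-p)) / \<bar>\<omega>\<bar>"
    using integral_unique[OF ik] by (simp add: diff_divide_distrib)
  finally have "\<bar>integral {R..R'} h - (g R' - g R)\<bar> \<le> (R powr (-p) - R' powr (-p)) / \<bar>\<omega>\<bar>"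
    using ih ig by (subst (asm) Henstock_Kurzweil_Integration.integral_diff) (auto simp: integral_unique)
  moreover have "\<bar>g y\<bar> \<le> y powr (-p) / \<bar>\<omega>\<bar>" for y
  proof -
    have "\<bar>y powr (-p) * sin (\<omega> * y + \<phi>)\<bar> \<le> y powr (-p) * 1"
      unfolding abs_mult by (intro mult_mono) auto
    then show ?thesis by (simp add: g_def divide_right_mono)
  qed
  from this[of R] this[of R'] have "\<bar>g R\<bar> \<le> R powr (-p) / \<bar>\<omega>\<bar>" "\<bar>g R'\<bar> \<le> R' powr (-p) / \<bar>\<omega>\<bar>" .
  moreover have "R' powr (-p) / \<bar>\<omega>\<bar> \<le> R powr (-p) / \<bar>\<omega>\<bar>"
    using R p by (intro divide_right_mono powr_mono2') auto
  ultimately show ?thesis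
    unfolding h_def[symmetric] diff_divide_distrib by linarith
qed

lemma cos_cos_cos:
  fixes a b c :: real
  shows "cos a * cos b * cos c = (cos (a + b + c) + cos (a + b - c) + cos (a - b + c) + cos (a - b - c)) / 4"
  by (simp add: cos_add cos_diff sin_add sin_diff algebra_simps)

text \<open>The product splits into four cosines of frequencies a +- b +- c. For a = t, b = x, c =
  z, all positive, one of these vanishes exactly when t = |x - z| or t = x + z; \<delta> measures
  the distance from such resonance.\<close>

lemma powr_cos3_integral_bound:
  fixes p \<delta> :: real
  assumes p: "p > 0" and \<delta>: "\<delta> > 0" and R: "0 < R" "R \<le> R'"
    and \<omega>: "\<delta> \<le> \<bar>a + b + c\<bar>" "\<delta> \<le> \<bar>a + b - c\<bar>" "\<delta> \<le> \<bar>a - b + c\<bar>" "\<delta> \<le> \<bar>a - b - c\<bar>"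
  shows "\<bar>integral {R..R'} (\<lambda>y. y powr (-p) * (cos (a * y + \<phi>) * cos (b * y + \<psi>) * cos (c * y + \<zeta>)))\<bar>
     \<le> 3 * R powr (-p) / \<delta>"
proof -
  have one: "\<bar>integral {R..R'} (\<lambda>y. y powr (-p) * cos (\<omega> * y + \<theta>))\<bar> \<le> 3 * R powr (-p) / \<delta>"
    if "\<delta> \<le> \<bar>\<omega>\<bar>" for \<omega> \<theta>
  proof -
    have "3 * R powr (-p) / \<bar>\<omega>\<bar> \<le> 3 * R powr (-p) / \<delta>"
      using that \<delta> by (intro divide_left_mono mult_pos_pos) auto
    with powr_cos_integral_bound[OF p _ R, of \<omega> \<theta>] that \<delta> show ?thesis by force
  qed
  have int: "((\<lambda>y. y powr (-p) * cos (\<omega> * y + \<theta>)) has_integral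
       integral {R..R'} (\<lambda>y. y powr (-p) * cos (\<omega> * y + \<theta>))) {R..R'}" for \<omega> \<theta>
    using R by (intro integrable_integral integrable_continuous_real continuous_intros) auto
  define J where "J = (\<lambda>\<omega> \<theta>. integral {R..R'} (\<lambda>y. y powr (-p) * cos (\<omega> * y + \<theta>)))"
  have "((\<lambda>y. (y powr (-p) * cos ((a + b + c) * y + (\<phi> + \<psi> + \<zeta>)) + y powr (-p) * cos ((a + b - c) * y + (\<phi> + \<psi> - \<zeta>))
     + y powr (-p) * cos ((a - b + c) * y + (\<phi> - \<psi> + \<zeta>)) + y powr (-p) * cos ((a - b - c) * y + (\<phi> - \<psi> - \<zeta>))) / 4)
     has_integral (J (a + b + c) (\<phi> + \<psi> + \<zeta>) + J (a + b - c) (\<phi> + \<psi> - \<zeta>) + J (a - b + c) (\<phi> - \<psi> + \<zeta>) + J (a - b - c) (\<phi> - \<psi> - \<zeta>)) / 4) {R..R'}"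
    unfolding J_def by (intro has_integral_divide has_integral_add int)
  moreover have "(\<lambda>y. (y powr (-p) * cos ((a + b + c) * y + (\<phi> + \<psi> + \<zeta>)) + y powr (-p) * cos ((a + b - c) * y + (\<phi> + \<psi> - \<zeta>))
     + y powr (-p) * cos ((a - b + c) * y + (\<phi> - \<psi> + \<zeta>)) + y powr (-p) * cos ((a - b - c) * y + (\<phi> - \<psi> - \<zeta>))) / 4)
     = (\<lambda>y. y powr (-p) * (cos (a * y + \<phi>) * cos (b * y + \<psi>) * cos (c * y + \<zeta>)))"
    unfolding cos_cos_cos by (simp add: algebra_simps)
  ultimately have "integral {R..R'} (\<lambda>y. y powr (-p) * (cos (a * y + \<phi>) * cos (b * y + \<psi>) * cos (c * y + \<zeta>)))
     = (J (a + b + c) (\<phi> + \<psi> + \<zeta>) + J (a + b - c) (\<phi> + \<psi> - \<zeta>) + J (a - b + c) (\<phi> - \<psi> + \<zeta>) + J (a - b - c) (\<phi> - \<psi> - \<zeta>)) / 4"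
    by (simp add: integral_unique)
  moreover have "\<bar>J (a + b + c) (\<phi> + \<psi> + \<zeta>)\<bar> \<le> 3 * R powr (-p) / \<delta>"
    "\<bar>J (a + b - c) (\<phi> + \<psi> - \<zeta>)\<bar> \<le> 3 * R powr (-p) / \<delta>"
    "\<bar>J (a - b + c) (\<phi> - \<psi> + \<zeta>)\<bar> \<le> 3 * R powr (-p) / \<delta>"
    "\<bar>J (a - b - c) (\<phi> - \<psi> - \<zeta>)\<bar> \<le> 3 * R powr (-p) / \<delta>"
    unfolding J_def using \<omega> by (auto intro!: one)
  moreover have "\<bar>(j1 + j2 + j3 + j4) / 4\<bar> \<le> M"
    if "\<bar>j1\<bar> \<le> M" "\<bar>j2\<bar> \<le> M" "\<bar>j3\<bar> \<le> M" "\<bar>j4\<bar> \<le> M" for j1 j2 j3 j4 M :: real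
  proof -
    have "\<bar>j1 + j2 + j3 + j4\<bar> \<le> 4 * M"
      using that unfolding abs_le_iff by auto
    then show ?thesis by simp
  qed
  ultimately show ?thesis by simp
qed

lemma prod3_diff_bound:
  fixes u1 u2 u3 m1 m2 m3 :: real
  assumes "\<bar>u1 - m1\<bar> \<le> E" "\<bar>u2 - m2\<bar> \<le> E" "\<bar>u3 - m3\<bar> \<le> E"
    "\<bar>u2\<bar> \<le> B" "\<bar>u3\<bar> \<le> B" "\<bar>m1\<bar> \<le> B" "\<bar>m2\<bar> \<le> B"
  shows "\<bar>u1 * u2 * u3 - m1 * m2 * m3\<bar> \<le> 3 * E * B\<^sup>2"
proof -
  have "u1 * u2 * u3 - m1 * m2 * m3 = (u1 - m1) * (u2 * u3) + (u2 - m2) * (m1 * u3) + (u3 - m3) * (m1 * m2)"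
    by (simp add: algebra_simps)
  moreover have "\<bar>(u1 - m1) * (u2 * u3)\<bar> \<le> E * (B * B)" "\<bar>(u2 - m2) * (m1 * u3)\<bar> \<le> E * (B * B)"
    "\<bar>(u3 - m3) * (m1 * m2)\<bar> \<le> E * (B * B)"
    unfolding abs_mult using assms by (auto intro!: mult_mono)
  ultimately show ?thesis by (simp add: power2_eq_square)
qed

text \<open>The integrand of the kernel without its constant factor, as a function of \<open>T = t\<^sup>2\<close> and multiplied by
  \<open>T\<^bsup>\<nu>\<^esup>\<close>, so that its \<open>T\<close>-derivative is the integrand of order \<open>\<nu> - 1\<close>.\<close>
definition Kint :: "real \<Rightarrow> real \<Rightarrow> real \<Rightarrow> real \<Rightarrow> real \<Rightarrow> real \<Rightarrow> real" where
  "Kint \<nu> \<alpha> x z T y = T powr \<nu> * bc \<nu> (- T * (y\<^sup>2 / 4)) * bc \<alpha> (- ((x * y)\<^sup>2) / 4)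
     * bc \<alpha> (- ((z * y)\<^sup>2) / 4) * y powr (2 * \<alpha> + 1)"

text \<open>The condition on \<alpha> makes the exponent 2\<alpha> + 1 positive, hence the integrand
  continuous up to y = 0.\<close>

lemma continuous_on_Kint:
  assumes "\<alpha> > -1/2" "S \<subseteq> {0<..}"
  shows "continuous_on (S \<times> {0..R}) (\<lambda>(T, y). Kint \<nu> \<alpha> x z T y)"
  unfolding Kint_def case_prod_unfold
  by (intro continuous_on_mult continuous_on_bc continuous_on_powr' continuous_on_minus continuous_on_divide
      continuous_on_power continuous_on_fst continuous_on_snd continuous_on_id continuous_on_const)
     (use assms in auto)

lemma continuous_on_Kint':
  assumes "\<alpha> > -1/2"
  shows "continuous_on {0..R} (Kint \<nu> \<alpha> x z T)"
  unfolding Kint_def[abs_def]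
  by (intro continuous_on_mult continuous_on_bc continuous_on_powr' continuous_on_minus continuous_on_divide
      continuous_on_power continuous_on_id continuous_on_const)
     (use assms in auto)

text \<open>Each Bessel factor is replaced by its cosine. The product of the cosines is non-resonant
  and is integrated by parts; every error term gains a factor 1/y and is absolutely integrable
  against y^(-p), p = \<nu> + 1/2. \<open>D\<close> and \<open>R0\<close> depend on t only through
  the interval [t1, t2], which yields uniform convergence later.\<close>

lemma Kint_tail_bound:
  fixes \<nu> \<alpha> x z \<delta> :: real
  assumes \<nu>: "\<nu> > -1/2" and \<alpha>: "\<alpha> > -1/2" and xz: "x > 0" "z > 0" and t1: "0 < t1" and \<delta>: "\<delta> > 0"
    and sep: "\<And>t. t1 \<le> t \<Longrightarrow> t \<le> t2 \<Longrightarrow> \<delta> \<le> \<bar>t - \<bar>x - z\<bar>\<bar> \<and> \<delta> \<le> \<bar>t - (x + z)\<bar>"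
  shows "\<exists>D R0. 0 < R0 \<and> (\<forall>t R R'. t1 \<le> t \<longrightarrow> t \<le> t2 \<longrightarrow> R0 \<le> R \<longrightarrow> R \<le> R' \<longrightarrow>
     \<bar>integral {R..R'} (Kint \<nu> \<alpha> x z (t\<^sup>2))\<bar> \<le> D * R powr (- (\<nu> + 1/2)))"
proof -
  define p where "p = \<nu> + 1/2"
  have p: "p > 0" using \<nu> by (simp add: p_def)
  define U where "U = (\<lambda>\<mu> s. s powr (\<mu> + 1/2) * bc \<mu> (- (s\<^sup>2) / 4))"
  obtain A1 \<phi>1 C1 where C1: "\<And>s. s \<ge> 1 \<Longrightarrow> \<bar>U \<nu> s - A1 * cos (s + \<phi>1)\<bar> \<le> C1 / s"
    using bc_asymptotics unfolding U_def by blast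
  obtain A2 \<phi>2 C2 where C2: "\<And>s. s \<ge> 1 \<Longrightarrow> \<bar>U \<alpha> s - A2 * cos (s + \<phi>2)\<bar> \<le> C2 / s"
    using bc_asymptotics unfolding U_def by blast
  have C0: "C1 \<ge> 0" "C2 \<ge> 0" using C1[of 1] C2[of 1] by auto
  define C where "C = C1 + C2"
  define B where "B = \<bar>A1\<bar> + \<bar>A2\<bar> + C"
  \<comment> \<open>With l the least of the three scales, y >= 1/l puts t y, x y and z y all into
    the range [1, oo) of the asymptotics.\<close>
  define l where "l = Min {t1, x, z}"
  have l: "l > 0" "l \<le> t1" "l \<le> x" "l \<le> z" using t1 xz by (auto simp: l_def)
  define D1 where "D1 = 3 * (C / l) * B\<^sup>2"
  define e where "e = \<nu> - 1/2"
  \<comment> \<open>Of T^\<nu> = t^(2\<nu>) the factor t^p is absorbed into \<open>U\<close>,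
    leaving t^e. As e may have either sign, t^e is bounded by the sum of its values at both ends of
    [t1, t2].\<close>
  define \<kappa> where "\<kappa> = (t1 powr e + t2 powr e) * (x powr (- \<alpha> - 1/2) * z powr (- \<alpha> - 1/2))"
  define D where "D = \<kappa> * (\<bar>A1 * A2 * A2\<bar> * 3 / \<delta> + D1 / p)"
  define R0 where "R0 = 1 / l"
  have bnd: "\<bar>integral {R..R'} (Kint \<nu> \<alpha> x z (t\<^sup>2))\<bar> \<le> D * R powr (-p)"
    if t: "t1 \<le> t" "t \<le> t2" and R: "R0 \<le> R" "R \<le> R'" for t R R'
  proof -
    have t0: "t > 0" "l \<le> t" using t t1 l by auto
    have R00: "R > 0" using R l by (auto simp: R0_def intro: less_le_trans[of 0 "1/l"])
    define u where "u = (\<lambda>y. U \<nu> (t * y) * U \<alpha> (x * y) * U \<alpha> (z * y))"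
    define m where "m = (\<lambda>y. (A1 * cos (t * y + \<phi>1)) * (A2 * cos (x * y + \<phi>2)) * (A2 * cos (z * y + \<phi>2)))"
    have big: "1 \<le> r * y" "C' / (r * y) \<le> C / l / y" if "l \<le> r" "R \<le> y" "0 \<le> C'" "C' \<le> C" for r y C'
    proof -
      have y: "1 / l \<le> y" using that R by (simp add: R0_def)
      have "1 = l * (1 / l)" using l by simp
      also have "\<dots> \<le> r * y" using l that y by (intro mult_mono) auto
      finally show "1 \<le> r * y" .
      have "C' / (r * y) \<le> C / (l * y)"
        using that l R00 by (intro frac_le mult_right_mono) auto
      then show "C' / (r * y) \<le> C / l / y" by simp
    qed
    have Uabs: "\<bar>U \<mu> s\<bar> \<le> B" if "\<bar>U \<mu> s - A * cos (s + \<phi>)\<bar> \<le> C' / s" "1 \<le> s" "0 \<le> C'" "C' + \<bar>A\<bar> \<le> B" for \<mu> s A C' \<phi>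
    proof -
      have "\<bar>A * cos (s + \<phi>)\<bar> \<le> \<bar>A\<bar> * 1" unfolding abs_mult by (intro mult_left_mono) auto
      moreover have "C' / s \<le> C'" using that by (simp add: divide_le_eq mult_le_cancel_left1)
      ultimately show ?thesis using that by linarith
    qed
    have mabs: "\<bar>A * cos s\<bar> \<le> B" if "\<bar>A\<bar> \<le> B" for A s
    proof -
      have "\<bar>A * cos s\<bar> \<le> \<bar>A\<bar> * 1" unfolding abs_mult by (intro mult_left_mono) auto
      then show ?thesis using that by linarith
    qed
    have CC: "C1 \<le> C" "C2 \<le> C" "C1 + \<bar>A1\<bar> \<le> B" "C2 + \<bar>A2\<bar> \<le> B" "\<bar>A1\<bar> \<le> B" "\<bar>A2\<bar> \<le> B"
      using C0 by (auto simp: C_def B_def)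
    have um: "\<bar>u y - m y\<bar> \<le> D1 / y" if y: "R \<le> y" for y
    proof -
      have "\<bar>u y - m y\<bar> \<le> 3 * (C / l / y) * B\<^sup>2"
        unfolding u_def m_def
      proof (rule prod3_diff_bound)
        show "\<bar>U \<nu> (t * y) - A1 * cos (t * y + \<phi>1)\<bar> \<le> C / l / y"
          using C1[OF big(1)] big(2)[of t y C1] t0 y C0 CC by (meson order_trans)
        show "\<bar>U \<alpha> (x * y) - A2 * cos (x * y + \<phi>2)\<bar> \<le> C / l / y"
          using C2[OF big(1)] big(2)[of x y C2] l y C0 CC by (meson order_trans)
        show "\<bar>U \<alpha> (z * y) - A2 * cos (z * y + \<phi>2)\<bar> \<le> C / l / y"
          using C2[OF big(1)] big(2)[of z y C2] l y C0 CC by (meson order_trans)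
        have "1 \<le> x * y" "1 \<le> z * y" using big(1) l y C0 CC by blast+
        then show "\<bar>U \<alpha> (x * y)\<bar> \<le> B" "\<bar>U \<alpha> (z * y)\<bar> \<le> B"
          using Uabs[OF C2] C0 CC by blast+
        show "\<bar>A1 * cos (t * y + \<phi>1)\<bar> \<le> B" "\<bar>A2 * cos (x * y + \<phi>2)\<bar> \<le> B"
          using mabs CC by blast+
      qed
      then show ?thesis by (simp add: D1_def)
    qed
    define k where "k = t powr e * (x powr (- \<alpha> - 1/2) * z powr (- \<alpha> - 1/2))"
    have Keq: "Kint \<nu> \<alpha> x z (t\<^sup>2) y = k * (y powr (-p) * u y)" if "y > 0" for y
    proof -
      have "k * (y powr (-p) * u y) =
        (t powr e * t powr p) * (x powr (- \<alpha> - 1/2) * x powr (\<alpha> + 1/2)) * (z powr (- \<alpha> - 1/2) * z powr (\<alpha> + 1/2))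
         * (y powr (-p) * y powr p * y powr (\<alpha> + 1/2) * y powr (\<alpha> + 1/2))
         * (bc \<nu> (- ((t * y)\<^sup>2) / 4) * bc \<alpha> (- ((x * y)\<^sup>2) / 4) * bc \<alpha> (- ((z * y)\<^sup>2) / 4))"
        using that t0 xz by (simp add: k_def u_def U_def powr_mult p_def)
      also have "t powr e * t powr p = t\<^sup>2 powr \<nu>"
        using t0 by (simp add: e_def p_def powr_add[symmetric] powr_powr[symmetric] flip: powr_numeral)
      also have "x powr (- \<alpha> - 1/2) * x powr (\<alpha> + 1/2) = 1"
        using xz by (simp flip: powr_add)
      also have "z powr (- \<alpha> - 1/2) * z powr (\<alpha> + 1/2) = 1"
        using xz by (simp flip: powr_add)
      also have "y powr (-p) * y powr p * y powr (\<alpha> + 1/2) * y powr (\<alpha> + 1/2) = y powr (2 * \<alpha> + 1)"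
        using that by (simp flip: powr_add)
      finally show ?thesis
        by (simp add: Kint_def power_mult_distrib mult_ac)
    qed
    have k: "0 \<le> k" "k \<le> \<kappa>"
    proof -
      have "t powr e \<le> t1 powr e + t2 powr e"
      proof (cases "e \<ge> 0")
        case True
        then have "t powr e \<le> t2 powr e" using t t0 by (intro powr_mono2) auto
        then show ?thesis using powr_ge_zero[of t1 e] by linarith
      next
        case False
        then have "t powr e \<le> t1 powr e" using t t1 by (intro powr_mono2') auto
        then show ?thesis using powr_ge_zero[of t2 e] by linarith
      qed
      then show "k \<le> \<kappa>" unfolding k_def \<kappa>_def by (intro mult_right_mono) auto
    qed (simp add: k_def)
    have cu: "continuous_on {R..R'} u"
      unfolding u_def U_def
      by (intro continuous_on_mult continuous_on_bc continuous_on_powr' continuous_on_minus continuous_on_divide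
         continuous_on_power continuous_on_id continuous_on_const) (use R00 t0 xz in auto)
    have cm: "continuous_on {R..R'} m"
      unfolding m_def by (intro continuous_intros)
    have cp: "continuous_on {R..R'} (\<lambda>y. y powr (-p))"
      using R00 by (intro continuous_intros) auto
    have ium: "(\<lambda>y. y powr (-p) * (u y - m y)) integrable_on {R..R'}"
      by (intro integrable_continuous_real continuous_on_mult[OF cp continuous_on_diff[OF cu cm]])
    have im: "(\<lambda>y. y powr (-p) * m y) integrable_on {R..R'}"
      by (intro integrable_continuous_real continuous_on_mult[OF cp cm])
    have kd: "((\<lambda>y. - (D1 * y powr (-p) / p)) has_real_derivative D1 * y powr (-p-1)) (at y)" if "y > 0" for y
      by (rule DERIV_cong[OF DERIV_minus[OF DERIV_cdivide[OF DERIV_cmult[OF has_real_derivative_powr[OF that]]]]]) (use p in simp)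
    have ik: "((\<lambda>y. D1 * y powr (-p-1)) has_integral (- (D1 * R' powr (-p) / p) - - (D1 * R powr (-p) / p))) {R..R'}"
      using R00 R p
      by (intro fundamental_theorem_of_calculus)
         (auto intro!: DERIV_subset[OF kd] simp flip: has_real_derivative_iff_has_vector_derivative)
    have D1: "D1 \<ge> 0" using C0 l by (simp add: D1_def C_def)
    have "norm (integral {R..R'} (\<lambda>y. y powr (-p) * (u y - m y))) \<le> integral {R..R'} (\<lambda>y. D1 * y powr (-p-1))"
    proof (rule integral_norm_bound_integral[OF ium])
      show "(\<lambda>y. D1 * y powr (-p-1)) integrable_on {R..R'}" using ik by auto
      fix y assume y: "y \<in> {R..R'}"
      then have "\<bar>y powr (-p) * (u y - m y)\<bar> \<le> y powr (-p) * (D1 / y)"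
        unfolding abs_mult using um by (intro mult_mono) auto
      also have "\<dots> = D1 * y powr (-p-1)"
        using y R00 by (simp add: powr_diff)
      finally show "norm (y powr (-p) * (u y - m y)) \<le> D1 * y powr (-p-1)" by simp
    qed
    also have "\<dots> \<le> D1 / p * R powr (-p)"
      using integral_unique[OF ik] D1 p by simp
    finally have 1: "\<bar>integral {R..R'} (\<lambda>y. y powr (-p) * (u y - m y))\<bar> \<le> D1 / p * R powr (-p)" by simp
    have "integral {R..R'} (\<lambda>y. y powr (-p) * m y) = A1 * A2 * A2 *
       integral {R..R'} (\<lambda>y. y powr (-p) * (cos (t * y + \<phi>1) * cos (x * y + \<phi>2) * cos (z * y + \<phi>2)))"
      unfolding m_def by (subst integral_mult_right[symmetric]) (simp add: mult_ac)
    moreover have "\<bar>integral {R..R'} (\<lambda>y. y powr (-p) * (cos (t * y + \<phi>1) * cos (x * y + \<phi>2) * cos (z * y + \<phi>2)))\<bar> \<le> 3 * R powr (-p) / \<delta>"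
      using sep[OF t] t0 xz by (intro powr_cos3_integral_bound[OF p \<delta> R00 R(2)]) auto
    ultimately have 2: "\<bar>integral {R..R'} (\<lambda>y. y powr (-p) * m y)\<bar> \<le> \<bar>A1 * A2 * A2\<bar> * (3 * R powr (-p) / \<delta>)"
      by (simp only: abs_mult[of "A1 * A2 * A2"] mult_left_mono abs_ge_zero)
    have "integral {R..R'} (Kint \<nu> \<alpha> x z (t\<^sup>2)) = integral {R..R'} (\<lambda>y. k * (y powr (-p) * (u y - m y) + y powr (-p) * m y))"
      using R00 by (intro integral_cong) (simp add: Keq algebra_simps)
    also have "\<dots> = k * (integral {R..R'} (\<lambda>y. y powr (-p) * (u y - m y)) + integral {R..R'} (\<lambda>y. y powr (-p) * m y))"
      using ium im by (simp add: Henstock_Kurzweil_Integration.integral_add)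
    also have "\<bar>\<dots>\<bar> \<le> k * (\<bar>A1 * A2 * A2\<bar> * (3 * R powr (-p) / \<delta>) + D1 / p * R powr (-p))"
      unfolding abs_mult[of k] abs_of_nonneg[OF k(1)]
      by (rule mult_left_mono[OF _ k(1)]) (use 1 2 in linarith)
    also have "\<dots> \<le> \<kappa> * (\<bar>A1 * A2 * A2\<bar> * (3 * R powr (-p) / \<delta>) + D1 / p * R powr (-p))"
      using k D1 p \<delta> by (intro mult_right_mono) auto
    also have "\<dots> = D * R powr (-p)"
      by (simp add: D_def algebra_simps)
    finally show ?thesis .
  qed
  show ?thesis
    unfolding p_def[symmetric] using bnd l by (intro exI[of _ D] exI[of _ R0]) (auto simp: R0_def)
qed

section \<open>Uniform convergence of the improper integral and its derivative in T\<close>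

lemma improper_limit:
  fixes g h :: "real \<Rightarrow> real"
  assumes g: "\<And>R R'. R0 \<le> R \<Longrightarrow> R \<le> R' \<Longrightarrow> \<bar>g R' - g R\<bar> \<le> h R"
    and h: "(h \<longlongrightarrow> 0) at_top"
  shows "\<exists>L. (g \<longlongrightarrow> L) at_top \<and> (\<forall>R\<ge>R0. \<bar>g R - L\<bar> \<le> h R)"
proof -
  have "Cauchy (\<lambda>n. g (real n))"
  proof (rule CauchyI)
    fix e :: real assume e: "e > 0"
    have "eventually (\<lambda>R. h R < e \<and> R \<ge> R0) at_top"
      using order_tendstoD(2)[OF h e] eventually_ge_at_top[of R0] by eventually_elim simp
    then obtain R1 where R1: "\<And>R. R \<ge> R1 \<Longrightarrow> h R < e \<and> R \<ge> R0"
      by (auto simp: eventually_at_top_linorder)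
    define N where "N = nat \<lceil>R1\<rceil>"
    have N: "real n \<ge> R1" if "n \<ge> N" for n using that by (simp add: N_def)
    show "\<exists>M. \<forall>m\<ge>M. \<forall>n\<ge>M. norm (g (real m) - g (real n)) < e"
    proof (intro exI allI impI)
      fix m n assume mn: "m \<ge> N" "n \<ge> N"
      show "norm (g (real m) - g (real n)) < e"
      proof (cases "n \<le> m")
        case True
        then show ?thesis using g[of "real n" "real m"] R1[OF N[OF mn(2)]] by simp
      next
        case False
        then show ?thesis using g[of "real m" "real n"] R1[OF N[OF mn(1)]] by (simp add: abs_minus_commute)
      qed
    qed
  qed
  then obtain L where L: "(\<lambda>n. g (real n)) \<longlonglongrightarrow> L"
    using Cauchy_convergent_iff convergent_def by blast
  have b: "\<bar>g R - L\<bar> \<le> h R" if R: "R \<ge> R0" for R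
  proof (rule tendsto_upperbound)
    show "(\<lambda>n. \<bar>g R - g (real n)\<bar>) \<longlonglongrightarrow> \<bar>g R - L\<bar>"
      by (intro tendsto_intros L)
    have "eventually (\<lambda>n. n \<ge> nat \<lceil>R\<rceil>) sequentially" by (rule eventually_ge_at_top)
    then show "eventually (\<lambda>n. \<bar>g R - g (real n)\<bar> \<le> h R) sequentially"
    proof eventually_elim
      case (elim n)
      then have "R \<le> real n" by linarith
      from g[OF R this] show ?case by simp
    qed
  qed simp
  have "((\<lambda>R. g R - L) \<longlongrightarrow> 0) at_top"
  proof (rule Lim_null_comparison[OF _ h])
    show "eventually (\<lambda>R. norm (g R - L) \<le> h R) at_top"
      using eventually_ge_at_top[of R0] by eventually_elim (simp add: b)
  qed
  then have "(g \<longlongrightarrow> L) at_top" by (simp add: LIM_zero_iff)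
  with b show ?thesis by blast
qed

text \<open>On a compact y-interval \<open>DERIV_powr_bc\<close> may be applied under the integral
  sign, since the differentiated integrand is jointly continuous.\<close>

lemma integral_Kint_has_derivative:
  assumes \<alpha>: "\<alpha> > -1/2" and T: "T \<in> S" "convex S" "S \<subseteq> {0<..}"
  shows "((\<lambda>T. integral {0..R} (Kint (\<nu> + 1) \<alpha> x z T)) has_real_derivative integral {0..R} (Kint \<nu> \<alpha> x z T)) (at T within S)"
proof -
  have "((\<lambda>T. integral (cbox 0 R) (Kint (\<nu> + 1) \<alpha> x z T)) has_real_derivative integral (cbox 0 R) (Kint \<nu> \<alpha> x z T)) (at T within S)"
  proof (rule leibniz_rule_field_derivative[OF _ _ _ T(1,2)])
    fix T y assume "T \<in> S"
    then have "T > 0" using T by auto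
    from DERIV_powr_bc[OF this, of \<nu> "y\<^sup>2 / 4" S]
    show "((\<lambda>T. Kint (\<nu> + 1) \<alpha> x z T y) has_real_derivative Kint \<nu> \<alpha> x z T y) (at T within S)"
      unfolding Kint_def by (intro DERIV_cmult_right)
  next
    fix T show "Kint (\<nu> + 1) \<alpha> x z T integrable_on cbox 0 R"
      by (rule integrable_continuous) (simp add: continuous_on_Kint'[OF \<alpha>])
  next
    show "continuous_on (S \<times> cbox 0 R) (\<lambda>(T, y). Kint \<nu> \<alpha> x z T y)"
      using continuous_on_Kint[OF \<alpha> T(3)] by simp
  qed
  then show ?thesis by simp
qed

text \<open>The tail bound does not involve T within the window and tends to 0 because \<nu> > -1/2,
  so the Cauchy criterion holds at a common rate.\<close>

lemma Kint_improper_uniform: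
  assumes \<nu>: "\<nu> > -1/2" and \<alpha>: "\<alpha> > -1/2" and xz: "x > 0" "z > 0" and t1: "0 < t1" and t2: "t1 \<le> t2" and \<delta>: "\<delta> > 0"
    and sep: "\<And>t. t1 \<le> t \<Longrightarrow> t \<le> t2 \<Longrightarrow> \<delta> \<le> \<bar>t - \<bar>x - z\<bar>\<bar> \<and> \<delta> \<le> \<bar>t - (x + z)\<bar>"
  shows "\<exists>G. (\<forall>T\<in>{t1\<^sup>2..t2\<^sup>2}. ((\<lambda>R. integral {0..R} (Kint \<nu> \<alpha> x z T)) \<longlongrightarrow> G T) at_top) \<and>
    (\<forall>e>0. \<forall>\<^sub>F R in at_top. \<forall>T\<in>{t1\<^sup>2..t2\<^sup>2}. \<bar>integral {0..R} (Kint \<nu> \<alpha> x z T) - G T\<bar> \<le> e)"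
proof -
  obtain D R0 where R0: "0 < R0" and D: "\<And>t R R'. t1 \<le> t \<Longrightarrow> t \<le> t2 \<Longrightarrow> R0 \<le> R \<Longrightarrow> R \<le> R' \<Longrightarrow>
     \<bar>integral {R..R'} (Kint \<nu> \<alpha> x z (t\<^sup>2))\<bar> \<le> D * R powr (- (\<nu> + 1/2))"
    using Kint_tail_bound[OF \<nu> \<alpha> xz t1 \<delta> sep] by blast
  have lim: "((\<lambda>R. D * R powr (- (\<nu> + 1/2))) \<longlongrightarrow> 0) at_top"
    using \<nu> by (intro tendsto_mult_right_zero tendsto_neg_powr filterlim_ident) auto
  have "\<exists>L. ((\<lambda>R. integral {0..R} (Kint \<nu> \<alpha> x z T)) \<longlongrightarrow> L) at_top \<and>
     (\<forall>R\<ge>R0. \<bar>integral {0..R} (Kint \<nu> \<alpha> x z T) - L\<bar> \<le> D * R powr (- (\<nu> + 1/2)))"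
    if T: "T \<in> {t1\<^sup>2..t2\<^sup>2}" for T
  proof (rule improper_limit[OF _ lim])
    fix R R' :: real assume R: "R0 \<le> R" "R \<le> R'"
    have T0: "T \<ge> 0" using T order_trans[OF zero_le_power2[of t1]] by auto
    have t: "t1 \<le> sqrt T" "sqrt T \<le> t2"
      using T t1 t2 real_le_rsqrt[of t1 T] real_sqrt_le_mono[of T "t2\<^sup>2"] by auto
    have "integral {0..R} (Kint \<nu> \<alpha> x z T) + integral {R..R'} (Kint \<nu> \<alpha> x z T) = integral {0..R'} (Kint \<nu> \<alpha> x z T)"
      using R0 R by (intro Henstock_Kurzweil_Integration.integral_combine integrable_continuous_real continuous_on_Kint'[OF \<alpha>]) auto
    then show "\<bar>integral {0..R'} (Kint \<nu> \<alpha> x z T) - integral {0..R} (Kint \<nu> \<alpha> x z T)\<bar> \<le> D * R powr (- (\<nu> + 1/2))"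
      using D[of "sqrt T" R R'] R T0 t by simp
  qed
  then obtain G where G: "\<And>T. T \<in> {t1\<^sup>2..t2\<^sup>2} \<Longrightarrow> ((\<lambda>R. integral {0..R} (Kint \<nu> \<alpha> x z T)) \<longlongrightarrow> G T) at_top \<and>
     (\<forall>R\<ge>R0. \<bar>integral {0..R} (Kint \<nu> \<alpha> x z T) - G T\<bar> \<le> D * R powr (- (\<nu> + 1/2)))"
    by metis
  have "\<forall>\<^sub>F R in at_top. \<forall>T\<in>{t1\<^sup>2..t2\<^sup>2}. \<bar>integral {0..R} (Kint \<nu> \<alpha> x z T) - G T\<bar> \<le> e" if e: "e > 0" for e
    using order_tendstoD(2)[OF lim e] eventually_ge_at_top[of R0]
  proof eventually_elim
    case (elim R)
    then show ?case using G by (meson less_imp_le order_trans)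
  qed
  with G show ?thesis by blast
qed

text \<open>The truncated integrals converge, and their derivatives, being the truncated integrals
  of order \<nu>, converge uniformly near T0; hence the limit may be differentiated. Uniformity is
  what allows this although the integral of order \<nu> may converge only conditionally.\<close>

lemma improper_Kint_derivative:
  assumes \<nu>: "\<nu> > -1/2" and \<alpha>: "\<alpha> > -1/2" and xz: "x > 0" "z > 0" and T0: "T0 > 0"
    "T0 \<noteq> (x - z)\<^sup>2" "T0 \<noteq> (x + z)\<^sup>2"
  shows "\<exists>S g g'. open S \<and> T0 \<in> S \<and> S \<subseteq> {0<..} \<and> (\<forall>T\<in>S.
     ((\<lambda>R. integral {0..R} (Kint (\<nu> + 1) \<alpha> x z T)) \<longlongrightarrow> g T) at_top \<and>
     ((\<lambda>R. integral {0..R} (Kint \<nu> \<alpha> x z T)) \<longlongrightarrow> g' T) at_top \<and>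
     (g has_real_derivative g' T) (at T))"
proof -
  define t0 where "t0 = sqrt T0"
  have t0: "t0 > 0" "T0 = t0\<^sup>2" using T0 by (auto simp: t0_def)
  have ne: "t0 \<noteq> \<bar>x - z\<bar>" "t0 \<noteq> x + z" using T0 t0 by auto
  \<comment> \<open>Half the distance of t0 from 0 and from both resonances: the window
    [t0 - \<delta>, t0 + \<delta>] stays positive and keeps distance \<delta> from them.\<close>
  define \<delta> where "\<delta> = Min {t0, \<bar>t0 - \<bar>x - z\<bar>\<bar>, \<bar>t0 - (x + z)\<bar>} / 2"
  have \<delta>: "\<delta> > 0" using t0 ne by (simp add: \<delta>_def)
  have \<delta>2: "2 * \<delta> \<le> t0" "2 * \<delta> \<le> \<bar>t0 - \<bar>x - z\<bar>\<bar>" "2 * \<delta> \<le> \<bar>t0 - (x + z)\<bar>"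
    by (auto simp: \<delta>_def)
  define t1 t2 where "t1 = t0 - \<delta>" and "t2 = t0 + \<delta>"
  have t12: "0 < t1" "t1 < t0" "t0 < t2" using \<delta> \<delta>2 t0 by (auto simp: t1_def t2_def)
  then have t12': "t1 \<le> t2" by simp
  have \<nu>1: "\<nu> + 1 > -1/2" using \<nu> by simp
  have sep: "\<delta> \<le> \<bar>t - \<bar>x - z\<bar>\<bar> \<and> \<delta> \<le> \<bar>t - (x + z)\<bar>" if "t1 \<le> t" "t \<le> t2" for t
    using that \<delta>2 unfolding t1_def t2_def by linarith
  define S where "S = {t1\<^sup>2<..<t2\<^sup>2}"
  have S: "S \<subseteq> {0<..}" "convex S" "open S" "S \<subseteq> {t1\<^sup>2..t2\<^sup>2}"
    using t12 by (auto simp: S_def intro: less_trans[of 0 "t1\<^sup>2"])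
  have T0S: "T0 \<in> S" unfolding S_def t0 using t12 by (auto intro!: power_strict_mono)
  note lims = Kint_improper_uniform[OF _ \<alpha> xz t12(1) t12' \<delta>]
  have "\<exists>G. (\<forall>T\<in>{t1\<^sup>2..t2\<^sup>2}. ((\<lambda>R. integral {0..R} (Kint (\<nu> + 1) \<alpha> x z T)) \<longlongrightarrow> G T) at_top) \<and>
    (\<forall>e>0. \<forall>\<^sub>F R in at_top. \<forall>T\<in>{t1\<^sup>2..t2\<^sup>2}. \<bar>integral {0..R} (Kint (\<nu> + 1) \<alpha> x z T) - G T\<bar> \<le> e)"
    by (rule lims[OF \<nu>1]) (rule sep)
  then obtain g where
    g0: "\<forall>T\<in>{t1\<^sup>2..t2\<^sup>2}. ((\<lambda>R. integral {0..R} (Kint (\<nu> + 1) \<alpha> x z T)) \<longlongrightarrow> g T) at_top"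
    by (elim exE conjE) assumption+
  note g = g0[rule_format]
  have "\<exists>G. (\<forall>T\<in>{t1\<^sup>2..t2\<^sup>2}. ((\<lambda>R. integral {0..R} (Kint \<nu> \<alpha> x z T)) \<longlongrightarrow> G T) at_top) \<and>
    (\<forall>e>0. \<forall>\<^sub>F R in at_top. \<forall>T\<in>{t1\<^sup>2..t2\<^sup>2}. \<bar>integral {0..R} (Kint \<nu> \<alpha> x z T) - G T\<bar> \<le> e)"
    by (rule lims[OF \<nu>]) (rule sep)
  then obtain g' where
    g'0: "\<forall>T\<in>{t1\<^sup>2..t2\<^sup>2}. ((\<lambda>R. integral {0..R} (Kint \<nu> \<alpha> x z T)) \<longlongrightarrow> g' T) at_top"
    and u0: "\<forall>e>0. \<forall>\<^sub>F R in at_top. \<forall>T\<in>{t1\<^sup>2..t2\<^sup>2}. \<bar>integral {0..R} (Kint \<nu> \<alpha> x z T) - g' T\<bar> \<le> e"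
    by (elim exE conjE) assumption+
  note g' = g'0[rule_format] and u = u0[rule_format]
  have "\<exists>k. \<forall>T\<in>S. (\<lambda>n. integral {0..real n} (Kint (\<nu> + 1) \<alpha> x z T)) \<longlonglongrightarrow> k T \<and> (k has_derivative (\<lambda>h. g' T * h)) (at T within S)"
  proof (rule has_derivative_sequence[OF S(2)])
    show "((\<lambda>T. integral {0..real n} (Kint (\<nu> + 1) \<alpha> x z T)) has_derivative (\<lambda>h. integral {0..real n} (Kint \<nu> \<alpha> x z T) * h)) (at T within S)"
      if "T \<in> S" for n T
      using integral_Kint_has_derivative[OF \<alpha> that S(2,1)] by (simp add: has_field_derivative_def)
    show "\<forall>\<^sub>F n in sequentially. \<forall>T\<in>S. \<forall>h. norm (integral {0..real n} (Kint \<nu> \<alpha> x z T) * h - g' T * h) \<le> e * norm h"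
      if "e > 0" for e
    proof -
      have "\<forall>\<^sub>F n in sequentially. \<forall>T\<in>{t1\<^sup>2..t2\<^sup>2}. \<bar>integral {0..real n} (Kint \<nu> \<alpha> x z T) - g' T\<bar> \<le> e"
        using filterlim_real_sequentially u[OF that] by (rule eventually_compose_filterlim[rotated])
      then show ?thesis
      proof eventually_elim
        case (elim n)
        show ?case
        proof (intro ballI allI)
          fix T h assume "T \<in> S"
          then have "\<bar>integral {0..real n} (Kint \<nu> \<alpha> x z T) - g' T\<bar> * \<bar>h\<bar> \<le> e * \<bar>h\<bar>"
            using elim S(4) by (intro mult_right_mono) auto
          then show "norm (integral {0..real n} (Kint \<nu> \<alpha> x z T) * h - g' T * h) \<le> e * norm h"
            by (simp add: abs_mult flip: left_diff_distrib)
        qed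
      qed
    qed
    show "T0 \<in> S" by fact
    show "(\<lambda>n. integral {0..real n} (Kint (\<nu> + 1) \<alpha> x z T0)) \<longlonglongrightarrow> g T0"
      using T0S S(4) by (intro filterlim_compose[OF g filterlim_real_sequentially]) auto
  qed
  then obtain k where k: "\<And>T. T \<in> S \<Longrightarrow> (\<lambda>n. integral {0..real n} (Kint (\<nu> + 1) \<alpha> x z T)) \<longlonglongrightarrow> k T"
    and k': "\<And>T. T \<in> S \<Longrightarrow> (k has_derivative (\<lambda>h. g' T * h)) (at T within S)" by blast
  \<comment> \<open>\<open>k\<close> is the limit along integer R only; since the limit over all
    real R exists, the two agree.\<close>
  have "k T = g T" if "T \<in> S" for T
    using that S(4) by (intro LIMSEQ_unique[OF k filterlim_compose[OF g filterlim_real_sequentially]]) auto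
  with g have "\<And>T. T \<in> S \<Longrightarrow> ((\<lambda>R. integral {0..R} (Kint (\<nu> + 1) \<alpha> x z T)) \<longlongrightarrow> k T) at_top"
    using S(4) by auto
  moreover have "(k has_real_derivative g' T) (at T)" if "T \<in> S" for T
    using k'[OF that] at_within_open[OF that S(3)] by (simp add: has_field_derivative_def)
  ultimately show ?thesis
    using S T0S g' by (intro exI[of _ S] exI[of _ k] exI[of _ g']) auto
qed

section \<open>Exponential integrals of Bessel functions\<close>

lemma has_sum_mult_real:
  fixes f :: "'a \<Rightarrow> real" and g :: "'b \<Rightarrow> real"
  assumes f: "(f has_sum a) A" and g: "(g has_sum b) B"
  shows "((\<lambda>(x, y). f x * g y) has_sum (a * b)) (A \<times> B)"
proof -
  have fa: "(\<lambda>x. \<bar>f x\<bar>) summable_on A" and ga: "(\<lambda>x. \<bar>g x\<bar>) summable_on B"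
    using has_sum_imp_summable[OF f] has_sum_imp_summable[OF g]
      summable_on_iff_abs_summable_on_real[of f A] summable_on_iff_abs_summable_on_real[of g B]
    by (simp_all only: real_norm_def)
  have "(\<lambda>(x, y). \<bar>f x\<bar> * \<bar>g y\<bar>) summable_on (A \<times> B)"
  proof (rule summable_on_SigmaI)
    fix x assume "x \<in> A"
    show "((\<lambda>y. case (x, y) of (x, y) \<Rightarrow> \<bar>f x\<bar> * \<bar>g y\<bar>) has_sum (\<bar>f x\<bar> * infsum (\<lambda>y. \<bar>g y\<bar>) B)) B"
      using ga by (auto intro!: has_sum_cmult_right)
  next
    show "(\<lambda>x. \<bar>f x\<bar> * infsum (\<lambda>y. \<bar>g y\<bar>) B) summable_on A"
      using fa by (rule summable_on_cmult_left)
  qed auto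
  then have "(\<lambda>p. norm (case p of (x, y) \<Rightarrow> f x * g y)) summable_on (A \<times> B)"
    by (simp add: case_prod_unfold abs_mult)
  then have "(\<lambda>(x, y). f x * g y) summable_on (A \<times> B)"
    by (rule abs_summable_summable)
  then show ?thesis
    by (rule has_sum_SigmaI[rotated 2]) (auto intro!: has_sum_cmult_right g has_sum_cmult_left f)
qed

text \<open>Vandermonde's convolution with upper entries k and l + \<alpha>, written through
  \<open>Gamma\<close>. It evaluates the coefficient of X^k Z^l in the product of two exponentials
  and a Bessel-Clifford function.\<close>

lemma bc_coeff_Vandermonde:
  assumes "\<alpha> > -1"
  shows "(\<Sum>m\<le>min k l. bc_coeff \<alpha> m / (fact (k - m) * fact (l - m)))
    = bc_coeff \<alpha> k * bc_coeff \<alpha> l * Gamma (\<alpha> + 1 + real k + real l)"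
proof -
  have nn: "x \<notin> \<int>\<^sub>\<le>\<^sub>0" if "x > 0" for x :: real
    using that nonpos_Ints_nonpos by force
  have gt: "((real l + \<alpha>) gchoose (l - m)) = Gamma (real l + \<alpha> + 1) / fact (l - m) * rGamma (\<alpha> + real m + 1)" if "m \<le> l" for m
  proof -
    have "((real l + \<alpha>) gchoose (l - m)) = Gamma (real l + \<alpha> + 1) / (fact (l - m) * Gamma (real l + \<alpha> - real (l - m) + 1))"
      using assms by (intro gbinomial_Gamma nn) auto
    also have "real l + \<alpha> - real (l - m) + 1 = \<alpha> + real m + 1" using that by (simp add: of_nat_diff)
    finally show ?thesis by (simp add: rGamma_inverse_Gamma divide_inverse mult_ac)
  qed
  have ch: "(real k gchoose m) = (if m \<le> k then fact k / (fact m * fact (k - m)) else 0)" for m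
    by (simp add: binomial_gbinomial[symmetric] binomial_fact)
  have "(\<Sum>m\<in>{0..l}. (real k gchoose m) * ((real l + \<alpha>) gchoose (l - m))) = (real k + (real l + \<alpha>)) gchoose l"
    by (rule gbinomial_Vandermonde)
  also have "(\<Sum>m\<in>{0..l}. (real k gchoose m) * ((real l + \<alpha>) gchoose (l - m)))
     = (\<Sum>m\<le>min k l. (real k gchoose m) * ((real l + \<alpha>) gchoose (l - m)))"
    by (rule sum.mono_neutral_right) (auto simp: ch)
  also have "\<dots> = (\<Sum>m\<le>min k l. fact k * Gamma (real l + \<alpha> + 1) * (bc_coeff \<alpha> m / (fact (k - m) * fact (l - m))))"
    by (rule sum.cong) (auto simp: ch gt bc_coeff_def)
  also have "\<dots> = fact k * Gamma (real l + \<alpha> + 1) * (\<Sum>m\<le>min k l. bc_coeff \<alpha> m / (fact (k - m) * fact (l - m)))"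
    by (simp only: sum_distrib_left)
  finally have 1: "fact k * Gamma (real l + \<alpha> + 1) * (\<Sum>m\<le>min k l. bc_coeff \<alpha> m / (fact (k - m) * fact (l - m)))
     = (real k + (real l + \<alpha>)) gchoose l" .
  have "(real k + (real l + \<alpha>)) gchoose l = Gamma (real k + (real l + \<alpha>) + 1) / (fact l * Gamma (real k + (real l + \<alpha>) - real l + 1))"
    using assms by (intro gbinomial_Gamma nn) auto
  also have "\<dots> = Gamma (\<alpha> + 1 + real k + real l) * rGamma (\<alpha> + real k + 1) / fact l"
    by (simp add: rGamma_inverse_Gamma divide_inverse add_ac)
  finally have 2: "(real k + (real l + \<alpha>)) gchoose l = Gamma (\<alpha> + 1 + real k + real l) * rGamma (\<alpha> + real k + 1) / fact l" .
  have G: "Gamma (real l + \<alpha> + 1) > 0" "rGamma (\<alpha> + real l + 1) = 1 / Gamma (real l + \<alpha> + 1)"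
    using assms by (auto simp: Gamma_real_pos rGamma_inverse_Gamma add_ac divide_inverse)
  have "fact k * Gamma (real l + \<alpha> + 1) * (bc_coeff \<alpha> k * bc_coeff \<alpha> l * Gamma (\<alpha> + 1 + real k + real l))
    = Gamma (\<alpha> + 1 + real k + real l) * rGamma (\<alpha> + real k + 1) / fact l"
    using G(1) by (simp add: bc_coeff_def G(2))
  with 1 2 have "fact k * Gamma (real l + \<alpha> + 1) * (\<Sum>m\<le>min k l. bc_coeff \<alpha> m / (fact (k - m) * fact (l - m)))
    = fact k * Gamma (real l + \<alpha> + 1) * (bc_coeff \<alpha> k * bc_coeff \<alpha> l * Gamma (\<alpha> + 1 + real k + real l))"
    by simp
  then show ?thesis using G(1) by simp
qed

lemma has_sum_exp: "((\<lambda>n. x ^ n / fact n) has_sum exp x) UNIV" for x :: real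
proof (rule norm_summable_imp_has_sum)
  show "summable (\<lambda>n. norm (x ^ n / fact n))"
    using summable_norm_exp[of x] by (simp add: field_simps)
  show "(\<lambda>n. x ^ n / fact n) sums exp x"
    using exp_converges[of x] by (simp add: field_simps)
qed

text \<open>Multiply out \<open>e\<^bsup>X\<^esup> e\<^bsup>Z\<^esup> bc \<alpha> (XZ)\<close> and collect the terms with \<open>X\<^bsup>k\<^esup>Z\<^bsup>l\<^esup>\<close>.\<close>
lemma exp_bc_double_series:
  fixes X Z :: real
  assumes "\<alpha> > -1"
  shows "((\<lambda>(k, l). bc_coeff \<alpha> k * bc_coeff \<alpha> l * Gamma (\<alpha> + 1 + real k + real l) * X ^ k * Z ^ l)
    has_sum (exp (X + Z) * bc \<alpha> (X * Z))) UNIV"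
proof -
  have "((\<lambda>m. bc_coeff \<alpha> m * (X * Z) ^ m) has_sum bc \<alpha> (X * Z)) UNIV"
    using summable_bc_abs[of \<alpha> "X * Z"] bc_sums by (intro norm_summable_imp_has_sum) auto
  from has_sum_mult_real[OF this has_sum_mult_real[OF has_sum_exp[of X] has_sum_exp[of Z]]]
  have "((\<lambda>(m, i, j). bc_coeff \<alpha> m * (X * Z) ^ m * (X ^ i / fact i * (Z ^ j / fact j)))
    has_sum (bc \<alpha> (X * Z) * (exp X * exp Z))) UNIV"
    by (simp add: case_prod_unfold)
  then have "((\<lambda>((k, l), m). bc_coeff \<alpha> m / (fact (k - m) * fact (l - m)) * (X ^ k * Z ^ l)) has_sum (exp (X + Z) * bc \<alpha> (X * Z)))
    (Sigma UNIV (\<lambda>(k, l). {..min k l}))"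
  \<comment> \<open>Substitute k = i + m and l = j + m; for fixed (k, l) the index m runs over the
    finite range up to min k l, and that inner sum is the Vandermonde sum.\<close>
  proof (rule has_sum_reindex_bij_witness[of _
         "\<lambda>(m, i, j). ((i + m, j + m), m)" "\<lambda>((k, l), m). (m, k - m, l - m)", THEN iffD2, rotated 6], goal_cases)
    case (5 q)
    obtain k l m where q: "q = ((k, l), m)" by (metis surj_pair)
    then have "m \<le> k" "m \<le> l" using 5 by auto
    then have "X ^ k = X ^ m * X ^ (k - m)" "Z ^ l = Z ^ m * Z ^ (l - m)"
      by (simp_all flip: power_add)
    then show ?case unfolding q by (simp add: power_mult_distrib mult_ac)
  qed (auto simp: exp_add)
  from has_sum_SigmaD[OF this, of "\<lambda>(k, l). \<Sum>m\<le>min k l. bc_coeff \<alpha> m / (fact (k - m) * fact (l - m)) * (X ^ k * Z ^ l)"]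
  have "((\<lambda>(k, l). \<Sum>m\<le>min k l. bc_coeff \<alpha> m / (fact (k - m) * fact (l - m)) * (X ^ k * Z ^ l))
     has_sum (exp (X + Z) * bc \<alpha> (X * Z))) UNIV"
    by (auto simp: case_prod_unfold)
  also have "(\<lambda>(k, l). \<Sum>m\<le>min k l. bc_coeff \<alpha> m / (fact (k - m) * fact (l - m)) * (X ^ k * Z ^ l))
    = (\<lambda>(k, l). bc_coeff \<alpha> k * bc_coeff \<alpha> l * Gamma (\<alpha> + 1 + real k + real l) * X ^ k * Z ^ l)"
    unfolding sum_distrib_right[symmetric] bc_coeff_Vandermonde[OF assms] by (simp add: mult.assoc)
  finally show ?thesis .
qed

text \<open>A double series becomes a single one through the pairing of natural numbers, the shape
  required by termwise integration.\<close>

lemma has_sum_prod_decode: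
  fixes w :: "nat \<times> nat \<Rightarrow> real"
  assumes "(w has_sum S) UNIV"
  shows "(\<lambda>n. w (prod_decode n)) sums S" and "summable (\<lambda>n. \<bar>w (prod_decode n)\<bar>)"
proof -
  have *: "((\<lambda>n. w (prod_decode n)) has_sum S) UNIV"
    using has_sum_reindex_bij_betw[OF bij_prod_decode, of w] assms by simp
  show "(\<lambda>n. w (prod_decode n)) sums S"
    by (rule has_sum_imp_sums[OF *])
  from * have "(\<lambda>n. w (prod_decode n)) summable_on UNIV"
    by (rule has_sum_imp_summable)
  then have "(\<lambda>n. norm (w (prod_decode n))) summable_on UNIV"
    by (rule summable_on_iff_abs_summable_on_real[THEN iffD1])
  then show "summable (\<lambda>n. \<bar>w (prod_decode n)\<bar>)"
    using summable_on_imp_summable by auto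
qed

text \<open>Explicit evaluations are obtained as gauge integrals, while Fubini and termwise
  integration concern the Lebesgue integral; nonnegativity makes the passage automatic.\<close>

lemma has_bochner_integral_of_nonneg:
  fixes f :: "real \<Rightarrow> real"
  assumes [measurable]: "S \<in> sets borel" "f \<in> borel_measurable borel"
    and f: "\<And>x. x \<in> S \<Longrightarrow> 0 \<le> f x" "(f has_integral I) S"
  shows "has_bochner_integral lborel (\<lambda>x. indicator S x * f x) I"
proof (rule has_bochner_integral_nn_integral)
  have "((\<lambda>x. if x \<in> S then f x else 0) has_integral I) UNIV"
    using f(2) by (simp only: has_integral_restrict_UNIV)
  also have "(\<lambda>x. if x \<in> S then f x else 0) = (\<lambda>x. indicator S x * f x)"
    by (auto simp: indicator_def)
  finally show "(\<integral>\<^sup>+x. ennreal (indicator S x * f x) \<partial>lborel) = ennreal I"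
    using f(1) by (intro nn_integral_has_integral_lborel) (auto simp: indicator_def)
  show "0 \<le> I" using f by (intro has_integral_nonneg[OF f(2)])
qed (use f(1) in \<open>auto simp: indicator_def\<close>)

lemma has_integral_change_of_variables_nonneg:
  fixes f g :: "real \<Rightarrow> real"
  assumes "S \<in> sets lebesgue" "\<And>x. x \<in> S \<Longrightarrow> (g has_field_derivative g' x) (at x within S)" "inj_on g S"
    and f: "\<And>y. y \<in> g ` S \<Longrightarrow> 0 \<le> f y" "(f has_integral I) (g ` S)"
  shows "((\<lambda>x. \<bar>g' x\<bar> * f (g x)) has_integral I) S"
proof -
  have "f absolutely_integrable_on (g ` S) \<and> integral (g ` S) f = I"
    using f by (auto intro!: nonnegative_absolutely_integrable_1 simp: integral_unique)
  then have *: "(\<lambda>x. \<bar>g' x\<bar> * f (g x)) absolutely_integrable_on S \<and> integral S (\<lambda>x. \<bar>g' x\<bar> * f (g x)) = I"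
    using has_absolute_integral_change_of_variables_1'[OF assms(1-3), of f I] by blast
  then have "(\<lambda>x. \<bar>g' x\<bar> * f (g x)) integrable_on S"
    by (intro set_lebesgue_integral_eq_integral(1)) simp
  with * show ?thesis by (metis integrable_integral)
qed

section \<open>Gamma and Gaussian moments; the exponential integrals evaluated termwise\<close>

lemma gamma_moment:
  assumes a: "a > 0" and s: "s > (0::real)"
  shows "((\<lambda>t. t powr (a - 1) * exp (- s * t)) has_integral Gamma a / s powr a) {0<..}"
proof -
  have "((\<lambda>t. t powr (a - 1) / exp t) has_integral Gamma a) {0<..}"
    by (rule has_integral_spike_set_eq[THEN iffD1, OF _ _ Gamma_integral_real[OF a]])
       (auto intro: negligible_subset[of "{0}"])
  moreover have im: "(\<lambda>t. s * t) ` {0<..} = {0<..}"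
  proof (intro equalityI subsetI)
    fix y :: real assume "y \<in> {0<..}"
    then show "y \<in> (\<lambda>t. s * t) ` {0<..}" using s by (intro image_eqI[of _ _ "y / s"]) auto
  qed (use s in auto)
  ultimately have "((\<lambda>t. \<bar>s\<bar> * ((s * t) powr (a - 1) / exp (s * t))) has_integral Gamma a) {0<..}"
    using s by (intro has_integral_change_of_variables_nonneg)
      (auto intro!: derivative_eq_intros inj_onI)
  from has_integral_divide[OF this, of "s powr a"]
  show ?thesis
  proof (rule has_integral_eq[rotated])
    fix t :: real assume t: "t \<in> {0<..}"
    have "s powr a = s * s powr (a - 1)" using s by (simp add: powr_mult_base)
    then show "\<bar>s\<bar> * ((s * t) powr (a - 1) / exp (s * t)) / s powr a = t powr (a - 1) * exp (- s * t)"
      using s t by (simp add: powr_mult exp_minus field_simps)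
  qed
qed

lemma gaussian_moment:
  assumes a: "a > 0" and p: "p > (0::real)"
  shows "((\<lambda>y. y powr (2 * a - 1) * exp (- p * y\<^sup>2)) has_integral Gamma a / (2 * p powr a)) {0<..}"
proof -
  have im: "(\<lambda>y::real. y\<^sup>2) ` {0<..} = {0<..}"
  proof (intro equalityI subsetI)
    fix y :: real assume "y \<in> {0<..}"
    then show "y \<in> (\<lambda>t. t\<^sup>2) ` {0<..}" by (intro image_eqI[of _ _ "sqrt y"]) auto
  qed auto
  have inj: "inj_on (\<lambda>y::real. y\<^sup>2) {0<..}"
    by (auto intro!: inj_onI simp: power2_eq_iff)
  have "((\<lambda>y. \<bar>2 * y\<bar> * ((y\<^sup>2) powr (a - 1) * exp (- p * y\<^sup>2))) has_integral (Gamma a / p powr a)) {0<..}"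
    using gamma_moment[OF a p] inj im
    by (intro has_integral_change_of_variables_nonneg) (auto intro!: derivative_eq_intros)
  from has_integral_divide[OF this, of 2]
  have "((\<lambda>y. \<bar>2 * y\<bar> * ((y\<^sup>2) powr (a - 1) * exp (- p * y\<^sup>2)) / 2) has_integral Gamma a / (2 * p powr a)) {0<..}"
    by (simp add: mult.commute)
  then show ?thesis
  proof (rule has_integral_eq[rotated])
    fix y :: real assume y: "y \<in> {0<..}"
    have "y powr (2 * a - 1) = y * y powr (2 * (a - 1))"
      using y by (simp add: powr_mult_base)
    also have "y powr (2 * (a - 1)) = (y powr 2) powr (a - 1)"
      by (simp only: powr_powr)
    finally have "y powr (2 * a - 1) = y * (y powr 2) powr (a - 1)" .
    then show "\<bar>2 * y\<bar> * ((y\<^sup>2) powr (a - 1) * exp (- p * y\<^sup>2)) / 2 = y powr (2 * a - 1) * exp (- p * y\<^sup>2)"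
      using y by simp
  qed
qed

text \<open>Only an upper bound \<open>b\<close> for the L1 norms is asked for; in the applications
  it is the same series with the signs removed, whose sum is already known.\<close>

lemma has_bochner_integral_sums:
  fixes f :: "nat \<Rightarrow> 'a \<Rightarrow> real"
  assumes f: "\<And>i. has_bochner_integral M (f i) (a i)"
    and b: "\<And>i. (\<integral>x. \<bar>f i x\<bar> \<partial>M) \<le> b i" "summable b"
    and F: "\<And>x. summable (\<lambda>i. \<bar>f i x\<bar>)" "\<And>x. (\<lambda>i. f i x) sums F x" and A: "a sums A"
  shows "has_bochner_integral M F A"
proof -
  have fi: "integrable M (f i)" for i using f by (simp add: has_bochner_integral_iff)
  have s: "summable (\<lambda>i. \<integral>x. norm (f i x) \<partial>M)"
    by (rule summable_comparison_test[OF _ b(2)]) (use b(1) in auto)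
  have Feq: "F = (\<lambda>x. \<Sum>i. f i x)" using F(2) by (auto simp: sums_iff)
  have "integrable M F" unfolding Feq
    by (rule integrable_suminf[OF fi _ s]) (use F(1) in auto)
  moreover have "integral\<^sup>L M F = (\<Sum>i. integral\<^sup>L M (f i))" unfolding Feq
    by (rule integral_suminf[OF fi _ s]) (use F(1) in auto)
  moreover have "(\<Sum>i. integral\<^sup>L M (f i)) = A"
    using f A by (simp add: has_bochner_integral_iff sums_iff)
  ultimately show ?thesis by (simp add: has_bochner_integral_iff)
qed

text \<open>Weber's first exponential integral in the variable T. The i-th moment contributes
  Gamma(\<nu> + 1 + i), which cancels the reciprocal Gamma in the coefficient and leaves the
  exponential series. For \<nu> > -1 the coefficients are positive, so |q| in place of -q gives the
  dominating series.\<close>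

lemma laplace_bc:
  assumes \<nu>: "\<nu> > -1" and s: "s > 0"
  shows "has_bochner_integral lborel (\<lambda>T. indicator {0<..} T * (exp (- s * T) * (T powr \<nu> * bc \<nu> (- T * q))))
     (s powr (- \<nu> - 1) * exp (- q / s))"
proof -
  define m where "m = (\<lambda>i T. indicator {0<..} T * (T powr (\<nu> + 1 + real i - 1) * exp (- s * T)))"
  have m: "has_bochner_integral lborel (m i) (Gamma (\<nu> + 1 + real i) / s powr (\<nu> + 1 + real i))" for i
    unfolding m_def using \<nu> s by (intro has_bochner_integral_of_nonneg gamma_moment) auto
  have m0: "m i T \<ge> 0" for i T by (simp add: m_def)
  have coeff: "bc_coeff \<nu> i * z ^ i * (Gamma (\<nu> + 1 + real i) / s powr (\<nu> + 1 + real i)) = s powr (- \<nu> - 1) * ((z / s) ^ i / fact i)" for i z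
  proof -
    have "Gamma (\<nu> + real i + 1) > 0" using \<nu> by (intro Gamma_real_pos) simp
    moreover have "s powr (\<nu> + 1 + real i) = s powr (\<nu> + 1) * s ^ i" using s by (simp add: powr_add powr_realpow)
    moreover have "s powr (- \<nu> - 1) = 1 / s powr (\<nu> + 1)" by (simp add: powr_minus_divide[symmetric])
    ultimately show ?thesis
      by (simp add: bc_coeff_def rGamma_inverse_Gamma power_divide field_simps add_ac)
  qed
  show ?thesis
  proof (rule has_bochner_integral_sums)
    fix i
    from has_bochner_integral_mult_right[OF m, of "bc_coeff \<nu> i * (- q) ^ i" i]
    show "has_bochner_integral lborel (\<lambda>T. bc_coeff \<nu> i * (- q) ^ i * m i T) (s powr (- \<nu> - 1) * ((- q / s) ^ i / fact i))"
      unfolding coeff by simp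
    have "\<bar>bc_coeff \<nu> i * (- q) ^ i * m i T\<bar> = bc_coeff \<nu> i * \<bar>q\<bar> ^ i * m i T" for T
      using bc_coeff_pos[OF \<nu>, of i] m0[of i T] by (simp add: abs_mult power_abs)
    then have "(\<integral>T. \<bar>bc_coeff \<nu> i * (- q) ^ i * m i T\<bar> \<partial>lborel) = bc_coeff \<nu> i * \<bar>q\<bar> ^ i * (Gamma (\<nu> + 1 + real i) / s powr (\<nu> + 1 + real i))"
      using m[of i] by (simp add: has_bochner_integral_iff)
    then show "(\<integral>T. \<bar>bc_coeff \<nu> i * (- q) ^ i * m i T\<bar> \<partial>lborel) \<le> s powr (- \<nu> - 1) * ((\<bar>q\<bar> / s) ^ i / fact i)"
      unfolding coeff by simp
  next
    show "summable (\<lambda>i. s powr (- \<nu> - 1) * ((\<bar>q\<bar> / s) ^ i / fact i))"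
      using summable_norm_exp[of "\<bar>q\<bar> / s"] s by (intro summable_mult) (simp add: power_divide divide_inverse mult_ac)
  next
    have eq: "bc_coeff \<nu> i * (- q) ^ i * m i T = indicator {0<..} T * exp (- s * T) * T powr \<nu> * (bc_coeff \<nu> i * (- T * q) ^ i)" for i T
      by (cases "T > 0") (auto simp: m_def powr_add powr_realpow power_mult_distrib[symmetric] mult_ac)
    fix T
    show "summable (\<lambda>i. \<bar>bc_coeff \<nu> i * (- q) ^ i * m i T\<bar>)"
      unfolding eq abs_mult[of "indicator {0<..} T * exp (- s * T) * T powr \<nu>"]
      by (intro summable_mult summable_bc_abs)
    have "(\<lambda>i. bc_coeff \<nu> i * (- q) ^ i * m i T) sums (indicator {0<..} T * exp (- s * T) * T powr \<nu> * bc \<nu> (- T * q))"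
      unfolding eq by (intro sums_mult bc_sums)
    then show "(\<lambda>i. bc_coeff \<nu> i * (- q) ^ i * m i T) sums (indicator {0<..} T * (exp (- s * T) * (T powr \<nu> * bc \<nu> (- T * q))))"
      by (simp add: mult_ac)
  next
    have "(\<lambda>i. (- q / s) ^ i / fact i) sums exp (- q / s)"
      using exp_converges[of "- q / s"] by (simp add: divide_inverse mult_ac)
    then show "(\<lambda>i. s powr (- \<nu> - 1) * ((- q / s) ^ i / fact i)) sums (s powr (- \<nu> - 1) * exp (- q / s))"
      by (rule sums_mult)
  qed
qed

lemma bc_bc_sums:
  fixes \<alpha> X Z :: real
  defines "w \<equiv> (\<lambda>(k, l). bc_coeff \<alpha> k * X ^ k * (bc_coeff \<alpha> l * Z ^ l))"
  shows "(\<lambda>n. w (prod_decode n)) sums (bc \<alpha> X * bc \<alpha> Z)"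
    and "summable (\<lambda>n. \<bar>w (prod_decode n)\<bar>)"
proof -
  have *: "((\<lambda>m. bc_coeff \<alpha> m * z ^ m) has_sum bc \<alpha> z) UNIV" for z
    using summable_bc_abs[of \<alpha> z] bc_sums by (intro norm_summable_imp_has_sum) auto
  have "(w has_sum (bc \<alpha> X * bc \<alpha> Z)) UNIV"
    using has_sum_mult_real[OF *[of X] *[of Z]] by (simp add: w_def)
  then show "(\<lambda>n. w (prod_decode n)) sums (bc \<alpha> X * bc \<alpha> Z)" "summable (\<lambda>n. \<bar>w (prod_decode n)\<bar>)"
    by (rule has_sum_prod_decode)+
qed

text \<open>Weber's second exponential integral. Gaussian moments turn the product of the two series
  into the double series of \<open>exp_bc_double_series\<close> at X = - s x^2 and Z = - s z^2. The
  signs cancel in X Z, which is why the value contains a modified Bessel function. The same series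
  at s x^2 and s z^2 dominates.\<close>

lemma weber_bc_bc:
  assumes \<alpha>: "\<alpha> > -1" and s: "s > 0"
  shows "has_bochner_integral lborel (\<lambda>y. indicator {0<..} y *
      (exp (- (y\<^sup>2) / (4 * s)) * (bc \<alpha> (- ((x * y)\<^sup>2) / 4) * bc \<alpha> (- ((z * y)\<^sup>2) / 4) * y powr (2 * \<alpha> + 1))))
     ((4 * s) powr (\<alpha> + 1) / 2 * (exp (- s * (x\<^sup>2 + z\<^sup>2)) * bc \<alpha> ((s * x * z)\<^sup>2)))"
proof -
  define m where "m = (\<lambda>i y. indicator {0<..} y * (y powr (2 * (\<alpha> + 1 + real i) - 1) * exp (- (1 / (4 * s)) * y\<^sup>2)))"
  define \<kappa> where "\<kappa> = (4 * s) powr (\<alpha> + 1) / 2"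
  define w where "w = (\<lambda>X Z (k, l). bc_coeff \<alpha> k * bc_coeff \<alpha> l * Gamma (\<alpha> + 1 + real k + real l) * X ^ k * Z ^ l)"
  define c where "c = (\<lambda>X Z (k, l). bc_coeff \<alpha> k * bc_coeff \<alpha> l * X ^ k * Z ^ l)"
  \<comment> \<open>Total degree of the n-th pair: the Gaussian moment depends on (k, l) only
    through k + l.\<close>
  define d where "d = (\<lambda>n. case prod_decode n of (k, l) \<Rightarrow> k + l)"
  have m: "has_bochner_integral lborel (m i) (Gamma (\<alpha> + 1 + real i) / (2 * (1 / (4 * s)) powr (\<alpha> + 1 + real i)))" for i
    unfolding m_def using \<alpha> s by (intro has_bochner_integral_of_nonneg gaussian_moment) auto
  have m0: "m i y \<ge> 0" for i y by (simp add: m_def)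
  have coeff: "c (X / 4) (Z / 4) (prod_decode n) * (Gamma (\<alpha> + 1 + real (d n)) / (2 * (1 / (4 * s)) powr (\<alpha> + 1 + real (d n))))
     = \<kappa> * w (s * X) (s * Z) (prod_decode n)" for n X Z
  proof -
    obtain k l where kl: "prod_decode n = (k, l)" by (cases "prod_decode n")
    have p: "(1 / (4 * s)) powr (\<alpha> + 1 + real (k + l)) = 1 / ((4 * s) powr (\<alpha> + 1) * (4 ^ k * s ^ k * (4 ^ l * s ^ l)))"
      using s by (simp add: powr_divide powr_add powr_realpow power_mult_distrib)
    show ?thesis
      unfolding d_def kl c_def w_def \<kappa>_def case_prod_conv p
      by (simp add: power_mult_distrib power_divide add_ac)
  qed
  have cabs: "\<bar>c X Z (prod_decode n)\<bar> = c \<bar>X\<bar> \<bar>Z\<bar> (prod_decode n)" for X Z n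
    using bc_coeff_pos[OF \<alpha>] by (simp add: c_def case_prod_unfold abs_mult power_abs less_imp_le)
  have ex: "- s * (x\<^sup>2 + z\<^sup>2) = s * (- (x\<^sup>2)) + s * (- (z\<^sup>2))" "(s * x * z)\<^sup>2 = s * (- (x\<^sup>2)) * (s * (- (z\<^sup>2)))"
    by (simp_all add: algebra_simps power2_eq_square)
  show ?thesis unfolding \<kappa>_def[symmetric] ex
  proof (rule has_bochner_integral_sums)
    fix n
    from has_bochner_integral_mult_right[OF m, of "c (- (x\<^sup>2) / 4) (- (z\<^sup>2) / 4) (prod_decode n)" "d n"]
    show "has_bochner_integral lborel (\<lambda>y. c (- (x\<^sup>2) / 4) (- (z\<^sup>2) / 4) (prod_decode n) * m (d n) y)
        (\<kappa> * w (s * (- (x\<^sup>2))) (s * (- (z\<^sup>2))) (prod_decode n))"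
      unfolding coeff by simp
    have "\<bar>c (- (x\<^sup>2) / 4) (- (z\<^sup>2) / 4) (prod_decode n) * m (d n) y\<bar> = c (x\<^sup>2 / 4) (z\<^sup>2 / 4) (prod_decode n) * m (d n) y" for y
      using m0[of "d n" y] by (simp add: abs_mult cabs)
    then have "(\<integral>y. \<bar>c (- (x\<^sup>2) / 4) (- (z\<^sup>2) / 4) (prod_decode n) * m (d n) y\<bar> \<partial>lborel)
        = c (x\<^sup>2 / 4) (z\<^sup>2 / 4) (prod_decode n) * (Gamma (\<alpha> + 1 + real (d n)) / (2 * (1 / (4 * s)) powr (\<alpha> + 1 + real (d n))))"
      using m[of "d n"] by (simp add: has_bochner_integral_iff)
    then show "(\<integral>y. \<bar>c (- (x\<^sup>2) / 4) (- (z\<^sup>2) / 4) (prod_decode n) * m (d n) y\<bar> \<partial>lborel) \<le> \<kappa> * w (s * x\<^sup>2) (s * z\<^sup>2) (prod_decode n)"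
      unfolding coeff by simp
  next
    show "summable (\<lambda>n. \<kappa> * w (s * x\<^sup>2) (s * z\<^sup>2) (prod_decode n))"
      using has_sum_prod_decode(1)[OF exp_bc_double_series[OF \<alpha>, of "s * x\<^sup>2" "s * z\<^sup>2"]] unfolding w_def
      by (intro summable_mult) (rule sums_summable)
  next
    define v where "v = (\<lambda>X Z (k, l). bc_coeff \<alpha> k * X ^ k * (bc_coeff \<alpha> l * Z ^ l))"
    have eq: "c (- (x\<^sup>2) / 4) (- (z\<^sup>2) / 4) (prod_decode n) * m (d n) y
       = indicator {0<..} y * exp (- (y\<^sup>2) / (4 * s)) * y powr (2 * \<alpha> + 1) * v (- ((x * y)\<^sup>2) / 4) (- ((z * y)\<^sup>2) / 4) (prod_decode n)" for n y
    proof (cases "y > 0")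
      case True
      obtain k l where kl: "prod_decode n = (k, l)" by (cases "prod_decode n")
      have "2 * (\<alpha> + 1 + real (k + l)) - 1 = (2 * \<alpha> + 1) + real (2 * k + 2 * l)" by simp
      then have "y powr (2 * (\<alpha> + 1 + real (k + l)) - 1) = y powr (2 * \<alpha> + 1) * ((y\<^sup>2) ^ k * (y\<^sup>2) ^ l)"
        using True by (simp only: powr_add powr_realpow) (simp add: power_add power_mult)
      moreover have "- ((r * y)\<^sup>2) / 4 = - (r\<^sup>2) / 4 * y\<^sup>2" for r by (simp add: power_mult_distrib)
      ultimately show ?thesis using True
        by (simp only: m_def d_def kl c_def v_def case_prod_conv power_mult_distrib) (simp add: mult_ac)
    qed (simp add: m_def)
    fix y
    show "summable (\<lambda>n. \<bar>c (- (x\<^sup>2) / 4) (- (z\<^sup>2) / 4) (prod_decode n) * m (d n) y\<bar>)"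
      unfolding eq abs_mult[of "indicator {0<..} y * exp (- (y\<^sup>2) / (4 * s)) * y powr (2 * \<alpha> + 1)"] v_def
      by (intro summable_mult bc_bc_sums)
    have "(\<lambda>n. c (- (x\<^sup>2) / 4) (- (z\<^sup>2) / 4) (prod_decode n) * m (d n) y) sums
       (indicator {0<..} y * exp (- (y\<^sup>2) / (4 * s)) * y powr (2 * \<alpha> + 1) * (bc \<alpha> (- ((x * y)\<^sup>2) / 4) * bc \<alpha> (- ((z * y)\<^sup>2) / 4)))"
      unfolding eq v_def by (intro sums_mult bc_bc_sums)
    then show "(\<lambda>n. c (- (x\<^sup>2) / 4) (- (z\<^sup>2) / 4) (prod_decode n) * m (d n) y) sums (indicator {0<..} y *
      (exp (- (y\<^sup>2) / (4 * s)) * (bc \<alpha> (- ((x * y)\<^sup>2) / 4) * bc \<alpha> (- ((z * y)\<^sup>2) / 4) * y powr (2 * \<alpha> + 1))))"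
      by (simp add: mult_ac)
  next
    show "(\<lambda>n. \<kappa> * w (s * (- (x\<^sup>2))) (s * (- (z\<^sup>2))) (prod_decode n)) sums
       (\<kappa> * (exp (s * (- (x\<^sup>2)) + s * (- (z\<^sup>2))) * bc \<alpha> (s * (- (x\<^sup>2)) * (s * (- (z\<^sup>2))))))"
      unfolding w_def by (intro sums_mult has_sum_prod_decode(1) exp_bc_double_series \<alpha>)
  qed
qed

section \<open>Laplace transforms and Poisson's integral\<close>

text \<open>With u = exp(-T) the hypotheses say that the weighted function annihilates all powers of
  u, hence by Weierstrass all continuous functions of u. A tent function concentrated where h is
  positive would give a positive integral. Integer values of the transform variable suffice.\<close>

lemma laplace_unique_pos:
  fixes h :: "real \<Rightarrow> real"
  assumes int: "integrable lborel (\<lambda>T. indicator {0<..} T * (exp (- T) * h T))"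
    and zero: "\<And>n::nat. (\<integral>T. indicator {0<..} T * (exp (- (real n + 1) * T) * h T) \<partial>lborel) = 0"
    and S: "open S" "T0 \<in> S" "T0 > 0" "continuous_on S h"
  shows "\<not> h T0 > 0"
proof
  assume pos: "h T0 > 0"
  \<comment> \<open>One factor exp(-T) stays in the weight to make it integrable; the remaining
    exp(-nT) are the powers u^n.\<close>
  define m where "m = (\<lambda>T. indicator {0<..} T * (exp (- T) * h T))"
  have im: "integrable lborel m" using int by (simp add: m_def)
  have img: "integrable lborel (\<lambda>T. m T * g (exp (- T)))" if g: "continuous_on UNIV g" "\<And>u. 0 \<le> u \<Longrightarrow> u \<le> 1 \<Longrightarrow> \<bar>g u\<bar> \<le> B"
    for g :: "real \<Rightarrow> real" and B
  proof (rule Bochner_Integration.integrable_bound)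
    show "integrable lborel (\<lambda>T. B * m T)" using im by simp
    have "g \<in> borel_measurable borel" using g(1) by (rule borel_measurable_continuous_onI)
    then show "(\<lambda>T. m T * g (exp (- T))) \<in> borel_measurable lborel"
      using borel_measurable_integrable[OF im] by simp
    have "0 \<le> B" using g(2)[of 0] by simp
    show "AE T in lborel. norm (m T * g (exp (- T))) \<le> norm (B * m T)"
    proof (rule AE_I2)
      fix T :: real
      show "norm (m T * g (exp (- T))) \<le> norm (B * m T)"
      proof (cases "T > 0")
        case True
        then have "\<bar>m T\<bar> * \<bar>g (exp (- T))\<bar> \<le> \<bar>m T\<bar> * B" by (intro mult_left_mono g(2)) auto
        then show ?thesis using \<open>0 \<le> B\<close> by (simp add: abs_mult mult.commute)
      qed (simp add: m_def)
    qed
  qed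
  have pow: "(\<integral>T. m T * exp (- T) ^ n \<partial>lborel) = 0" for n
  proof -
    have "m T * exp (- T) ^ n = indicator {0<..} T * (exp (- (real n + 1) * T) * h T)" for T
      by (simp add: m_def exp_of_nat_mult[symmetric] exp_add[symmetric] algebra_simps flip: exp_add)
    then show ?thesis using zero[of n] by simp
  qed
  have zg: "(\<integral>T. m T * g (exp (- T)) \<partial>lborel) = 0" if g: "continuous_on UNIV g" for g :: "real \<Rightarrow> real"
  proof -
    have "compact (g ` {0..1})"
      using g by (intro compact_continuous_image) (auto intro: continuous_on_subset)
    then obtain B where "\<forall>y\<in>g ` {0..1}. norm y \<le> B" using compact_imp_bounded bounded_iff by blast
    then have B: "\<bar>g u\<bar> \<le> B" if "0 \<le> u" "u \<le> 1" for u using that by auto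
    define M where "M = (\<integral>T. \<bar>m T\<bar> \<partial>lborel)"
    have "\<bar>\<integral>T. m T * g (exp (- T)) \<partial>lborel\<bar> \<le> e * M" if e: "e > 0" for e
    proof -
      obtain p where p: "real_polynomial_function p" "\<And>u. u \<in> {0..1} \<Longrightarrow> \<bar>g u - p u\<bar> < e"
        using Stone_Weierstrass_real_polynomial_function[of "{0..1}" g e] g e
        by (auto intro: continuous_on_subset)
      obtain a n where pa: "p = (\<lambda>x. \<Sum>i\<le>n. a i * x ^ i)"
        using p(1) unfolding real_polynomial_function_iff_sum by blast
      have ipow: "integrable lborel (\<lambda>T. m T * exp (- T) ^ i)" for i
        by (rule img[where B = 1 and g = "\<lambda>u. u ^ i"]) (auto intro!: continuous_intros simp: power_le_one power_abs)
      have mp: "(\<lambda>T. m T * p (exp (- T))) = (\<lambda>T. \<Sum>i\<le>n. a i * (m T * exp (- T) ^ i))"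
        by (simp add: pa sum_distrib_left mult_ac)
      have ip: "integrable lborel (\<lambda>T. m T * p (exp (- T)))"
        unfolding mp using ipow by simp
      have "(\<integral>T. m T * p (exp (- T)) \<partial>lborel) = (\<Sum>i\<le>n. a i * (\<integral>T. m T * exp (- T) ^ i \<partial>lborel))"
        unfolding mp using ipow by (simp add: Bochner_Integration.integral_sum)
      also have "\<dots> = 0" by (simp add: pow)
      finally have z: "(\<integral>T. m T * p (exp (- T)) \<partial>lborel) = 0" .
      have ig: "integrable lborel (\<lambda>T. m T * g (exp (- T)))" by (rule img[OF g B])
      have "(\<integral>T. m T * g (exp (- T)) \<partial>lborel) = (\<integral>T. m T * g (exp (- T)) - m T * p (exp (- T)) \<partial>lborel)"
        using z ig ip by (simp add: Bochner_Integration.integral_diff)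
      also have "norm \<dots> \<le> (\<integral>T. norm (m T * g (exp (- T)) - m T * p (exp (- T))) \<partial>lborel)"
        by (rule integral_norm_bound)
      also have "\<dots> \<le> (\<integral>T. e * \<bar>m T\<bar> \<partial>lborel)"
      proof (rule integral_mono)
        show "integrable lborel (\<lambda>T. norm (m T * g (exp (- T)) - m T * p (exp (- T))))"
          using ig ip by (intro integrable_norm Bochner_Integration.integrable_diff)
        show "integrable lborel (\<lambda>T. e * \<bar>m T\<bar>)" using im by simp
        fix T :: real
        show "norm (m T * g (exp (- T)) - m T * p (exp (- T))) \<le> e * \<bar>m T\<bar>"
        proof (cases "T > 0")
          case True
          then have "\<bar>m T\<bar> * \<bar>g (exp (- T)) - p (exp (- T))\<bar> \<le> \<bar>m T\<bar> * e"
            using p(2)[of "exp (- T)"] by (intro mult_left_mono) auto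
          then show ?thesis by (simp add: abs_mult mult.commute flip: right_diff_distrib)
        qed (simp add: m_def)
      qed
      finally show ?thesis by (simp add: M_def)
    qed
    moreover have "M \<ge> 0" unfolding M_def by simp
    ultimately have "\<bar>\<integral>T. m T * g (exp (- T)) \<partial>lborel\<bar> \<le> 0 + e" if "e > 0" for e
    proof -
      have "e / (M + 1) > 0" using that \<open>M \<ge> 0\<close> by simp
      from \<open>\<And>e. e > 0 \<Longrightarrow> _ \<le> e * M\<close>[OF this]
      have "\<bar>\<integral>T. m T * g (exp (- T)) \<partial>lborel\<bar> \<le> e * (M / (M + 1))" by simp
      also have "\<dots> \<le> e * 1" using that \<open>M \<ge> 0\<close> by (intro mult_left_mono) auto
      finally show ?thesis by simp
    qed
    then have "\<bar>\<integral>T. m T * g (exp (- T)) \<partial>lborel\<bar> \<le> 0" by (rule field_le_epsilon)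
    then show ?thesis by simp
  qed
  have "isCont h T0" using S by (simp add: continuous_on_eq_continuous_at)
  then have "eventually (\<lambda>T. h T > 0) (at T0)"
    using pos by (intro order_tendstoD(1)[of h "h T0"]) (auto simp: isCont_def)
  then obtain d where d: "d > 0" "\<And>T. T \<noteq> T0 \<Longrightarrow> dist T T0 < d \<Longrightarrow> h T > 0"
    unfolding eventually_at by auto
  define \<delta> where "\<delta> = min d T0"
  have \<delta>: "\<delta> > 0" using d S by (simp add: \<delta>_def)
  have hpos: "T > 0 \<and> h T > 0" if "T0 - \<delta> < T" "T < T0 + \<delta>" for T
  proof -
    have "dist T T0 < d" "T > 0" using that unfolding \<delta>_def dist_real_def by linarith+
    then show ?thesis using d(2)[of T] pos by (cases "T = T0") auto
  qed
  \<comment> \<open>A tent in the variable u, with zeros at the images of T0 - \<delta> and T0 +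
    \<delta>; \<delta> <= T0 keeps its support within T >= 0.\<close>
  define g where "g = (\<lambda>u. max 0 (min (u - exp (- (T0 + \<delta>))) (exp (- (T0 - \<delta>)) - u)))"
  have cg: "continuous_on UNIV g" unfolding g_def by (intro continuous_intros)
  have g0: "g (exp (- T)) = 0" if "\<not> (T0 - \<delta> < T \<and> T < T0 + \<delta>)" for T
  proof -
    have "max 0 (min (e - a) (b - e)) = 0" if "b \<le> e \<or> e \<le> a" for e a b :: real
      using that by auto
    then show ?thesis unfolding g_def by this (use that in auto)
  qed
  have gp: "g (exp (- T)) > 0" if "T0 - \<delta> < T" "T < T0 + \<delta>" for T
    using that by (auto simp: g_def max_def min_def)
  have nn: "0 \<le> m T * g (exp (- T))" for T
  proof (cases "T0 - \<delta> < T \<and> T < T0 + \<delta>")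
    case True
    then show ?thesis using hpos[of T] gp[of T] by (auto simp: m_def)
  qed (use g0 in auto)
  obtain B where B: "\<And>u. 0 \<le> u \<Longrightarrow> u \<le> 1 \<Longrightarrow> \<bar>g u\<bar> \<le> B"
  proof
    fix u :: real assume "0 \<le> u" "u \<le> 1"
    then show "\<bar>g u\<bar> \<le> 1 + exp (- (T0 - \<delta>))"
      by (auto simp: g_def max_def min_def)
  qed
  have "AE T in lborel. m T * g (exp (- T)) = 0"
    using zg[OF cg] nn img[OF cg B] by (simp add: integral_nonneg_eq_0_iff_AE)
  then have "AE T in lborel. T \<notin> {T0 - \<delta><..<T0 + \<delta>}"
  proof eventually_elim
    case (elim T)
    show ?case
    proof
      assume "T \<in> {T0 - \<delta><..<T0 + \<delta>}"
      then have "m T * g (exp (- T)) > 0"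
        using hpos[of T] gp[of T] by (auto simp: m_def)
      then show False by (simp only: elim less_irrefl)
    qed
  qed
  then have "emeasure lborel {T0 - \<delta><..<T0 + \<delta>} = 0"
    by (subst (asm) AE_iff_measurable[of "{T0 - \<delta><..<T0 + \<delta>}"]) auto
  then show False using \<delta> by simp
qed

text \<open>Both signs of the difference are excluded in turn. Continuity is asked only near T0, so
  that pointwise equality can be drawn away from the singular values of T.\<close>

lemma laplace_unique:
  fixes f g :: "real \<Rightarrow> real"
  assumes f: "\<And>s. s > 0 \<Longrightarrow> has_bochner_integral lborel (\<lambda>T. indicator {0<..} T * (exp (- s * T) * f T)) (L s)"
    and g: "\<And>s. s > 0 \<Longrightarrow> has_bochner_integral lborel (\<lambda>T. indicator {0<..} T * (exp (- s * T) * g T)) (L s)"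
    and S: "open S" "T0 \<in> S" "T0 > 0" "continuous_on S f" "continuous_on S g"
  shows "f T0 = g T0"
proof -
  have *: "has_bochner_integral lborel (\<lambda>T. indicator {0<..} T * (exp (- s * T) * (f1 T - f2 T))) 0"
    if "s > 0" and "\<And>s. s > 0 \<Longrightarrow> has_bochner_integral lborel (\<lambda>T. indicator {0<..} T * (exp (- s * T) * f1 T)) (L s)"
     "\<And>s. s > 0 \<Longrightarrow> has_bochner_integral lborel (\<lambda>T. indicator {0<..} T * (exp (- s * T) * f2 T)) (L s)" for s f1 f2
    using has_bochner_integral_diff[OF that(2)[OF that(1)] that(3)[OF that(1)]] by (simp add: algebra_simps)
  have "\<not> f1 T0 - f2 T0 > 0"
    if "\<And>s. s > 0 \<Longrightarrow> has_bochner_integral lborel (\<lambda>T. indicator {0<..} T * (exp (- s * T) * f1 T)) (L s)"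
     "\<And>s. s > 0 \<Longrightarrow> has_bochner_integral lborel (\<lambda>T. indicator {0<..} T * (exp (- s * T) * f2 T)) (L s)"
     "continuous_on S f1" "continuous_on S f2" for f1 f2
  proof (rule laplace_unique_pos[OF _ _ S(1-3)])
    show "integrable lborel (\<lambda>T. indicator {0<..} T * (exp (- T) * (f1 T - f2 T)))"
      using *[of 1, OF _ that(1,2)] by (simp add: has_bochner_integral_iff)
    show "(\<integral>T. indicator {0<..} T * (exp (- (real n + 1) * T) * (f1 T - f2 T)) \<partial>lborel) = 0" for n
      using *[of "real n + 1", OF _ that(1,2)] by (simp add: has_bochner_integral_iff)
    show "continuous_on S (\<lambda>T. f1 T - f2 T)" using that(3,4) by (rule continuous_on_diff)
  qed
  from this[OF f g S(4,5)] this[OF g f S(5,4)] show ?thesis by simp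
qed

text \<open>With 1 - 2u = cos \<theta> these are, up to a constant factor, the integrals of cos^n
  \<theta> sin^(2p-1) \<theta> over (0, pi) from the usual form of Poisson's integral.\<close>

definition beta_moment :: "real \<Rightarrow> nat \<Rightarrow> real" where
  "beta_moment p n = integral {0..1} (\<lambda>u. (1 - 2 * u) ^ n * (u powr (p - 1) * (1 - u) powr (p - 1)))"

text \<open>The function (1 - 2u)^(n+1) (u(1 - u))^p vanishes at 0 and 1, so its derivative
  integrates to 0, which is the two-step recursion. Without the power of 1 - 2u the same argument
  gives the vanishing first moment.\<close>

lemma
  fixes p :: real
  assumes p: "p > 0"
  shows has_integral_beta_moment:
      "((\<lambda>u. (1 - 2 * u) ^ n * (u powr (p - 1) * (1 - u) powr (p - 1))) has_integral beta_moment p n) {0..1}"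
    and beta_moment_0: "beta_moment p 0 = Beta p p" and beta_moment_1: "beta_moment p 1 = 0"
    and beta_moment_Suc_Suc: "beta_moment p (n + 2) * (real n + 1 + 2 * p) = (real n + 1) * beta_moment p n"
proof -
  define N where "N = beta_moment p"
  define \<rho> where "\<rho> = (\<lambda>u::real. u powr (p - 1) * (1 - u) powr (p - 1))"
  have \<rho>0: "\<rho> u \<ge> 0" for u by (simp add: \<rho>_def)
  have B: "(\<rho> has_integral Beta p p) {0..1}"
    unfolding \<rho>_def using has_integral_Beta_real[OF p p] .
  have N: "((\<lambda>u. (1 - 2 * u) ^ n * \<rho> u) has_integral N n) {0..1}" for n
  proof -
    have "(\<lambda>u. (1 - 2 * u) ^ n * \<rho> u) absolutely_integrable_on {0..1}"
    proof (rule measurable_bounded_by_integrable_imp_absolutely_integrable)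
      show "(\<lambda>u. (1 - 2 * u) ^ n * \<rho> u) \<in> borel_measurable (lebesgue_on {0..1})"
        unfolding \<rho>_def by (intro measurable_restrict_space1 measurable_completion) measurable
      show "\<rho> integrable_on {0..1}" using B by auto
      fix u :: real assume "u \<in> {0..1}"
      then have "\<bar>1 - 2 * u\<bar> ^ n \<le> 1" by (intro power_le_one) auto
      then have "\<bar>1 - 2 * u\<bar> ^ n * \<rho> u \<le> 1 * \<rho> u" using \<rho>0 by (intro mult_right_mono)
      then show "norm ((1 - 2 * u) ^ n * \<rho> u) \<le> \<rho> u" using \<rho>0[of u] by (simp add: abs_mult power_abs)
    qed auto
    then have "(\<lambda>u. (1 - 2 * u) ^ n * \<rho> u) integrable_on {0..1}"
      by (rule set_lebesgue_integral_eq_integral(1))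
    then show ?thesis unfolding N_def beta_moment_def \<rho>_def by (rule integrable_integral)
  qed
  then show "((\<lambda>u. (1 - 2 * u) ^ n * (u powr (p - 1) * (1 - u) powr (p - 1))) has_integral beta_moment p n) {0..1}"
    by (simp add: \<rho>_def N_def)
  show "beta_moment p 0 = Beta p p" unfolding N_def[symmetric] using has_integral_unique[OF N[of 0]] B by simp
  define g where "g = (\<lambda>u::real. u powr p * (1 - u) powr p)"
  have g\<rho>: "g u = u * (1 - u) * \<rho> u" if "0 < u" "u < 1" for u
  proof -
    have "u powr p = u * u powr (p - 1)" "(1 - u) powr p = (1 - u) * (1 - u) powr (p - 1)"
      using that powr_mult_base[of u "p - 1"] powr_mult_base[of "1 - u" "p - 1"] by auto
    then show ?thesis by (simp only: g_def \<rho>_def mult_ac)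
  qed
  have g': "(g has_real_derivative p * ((1 - 2 * u) * \<rho> u)) (at u)" if u: "0 < u" "u < 1" for u
  proof -
    have 1: "((\<lambda>u. u powr p) has_real_derivative p * u powr (p - 1)) (at u)"
      using u by (intro has_real_derivative_powr)
    have 2: "((\<lambda>u. (1 - u) powr p) has_real_derivative p * (1 - u) powr (p - 1) * (- 1)) (at u)"
      by (rule DERIV_chain2[OF has_real_derivative_powr]) (use u in \<open>auto intro!: derivative_eq_intros\<close>)
    have e: "u powr p = u * u powr (p - 1)" "(1 - u) powr p = (1 - u) * (1 - u) powr (p - 1)"
      using u powr_mult_base[of u "p - 1"] powr_mult_base[of "1 - u" "p - 1"] by auto
    show ?thesis unfolding g_def
      by (rule DERIV_cong[OF DERIV_mult[OF 1 2]]) (simp add: e \<rho>_def algebra_simps)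
  qed
  have cg: "continuous_on {0..1} g" unfolding g_def
    by (intro continuous_on_mult continuous_on_powr' continuous_on_diff continuous_on_id continuous_on_const) (use p in auto)
  have g01: "g 0 = 0" "g 1 = 0" using p by (auto simp: g_def)
  have i1: "((\<lambda>u. p * ((1 - 2 * u) * \<rho> u)) has_integral (g 1 - g 0)) {0..1}"
    by (rule fundamental_theorem_of_calculus_interior)
       (use cg g' in \<open>auto simp flip: has_real_derivative_iff_has_vector_derivative\<close>)
  have i2: "((\<lambda>u. p * ((1 - 2 * u) * \<rho> u)) has_integral (p * N 1)) {0..1}"
    using has_integral_mult_right[OF N[of 1], of p] by simp
  have "p * N 1 = 0" using has_integral_unique[OF i1 i2] g01 by simp
  then show "beta_moment p 1 = 0" using p by (simp add: N_def)
  define k where "k = (\<lambda>u. (1 - 2 * u) ^ (n + 1) * g u)"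
  \<comment> \<open>The derivative of \<open>k\<close>, rewritten with 4u(1 - u) = 1 - (1 - 2u)^2 so
    that only moments of orders n and n + 2 occur.\<close>
  define k' where "k' = (\<lambda>u. p * ((1 - 2 * u) ^ (n + 2) * \<rho> u) - (real n + 1) / 2 * ((1 - 2 * u) ^ n * \<rho> u - (1 - 2 * u) ^ (n + 2) * \<rho> u))"
  have kder: "(k has_real_derivative k' u) (at u)" if u: "0 < u" "u < 1" for u
  proof -
    have 1: "((\<lambda>u. (1 - 2 * u) ^ (n + 1)) has_real_derivative (real n + 1) * (1 - 2 * u) ^ n * (- 2)) (at u)"
      by (rule DERIV_cong[OF DERIV_power[where n = "n + 1" and D = "- 2"]]) (auto intro!: derivative_eq_intros)
    show ?thesis unfolding k_def
      by (rule DERIV_cong[OF DERIV_mult[OF 1 g'[OF u]]])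
         (simp add: g\<rho>[OF u] k'_def field_simps power2_eq_square power_add)
  qed
  have ck: "continuous_on {0..1} k" unfolding k_def by (intro continuous_intros cg)
  have j1: "(k' has_integral (k 1 - k 0)) {0..1}"
    by (rule fundamental_theorem_of_calculus_interior)
       (use ck kder in \<open>auto simp flip: has_real_derivative_iff_has_vector_derivative\<close>)
  have j2: "(k' has_integral (p * N (n + 2) - (real n + 1) / 2 * (N n - N (n + 2)))) {0..1}"
    unfolding k'_def by (intro has_integral_diff has_integral_mult_right N)
  have "k 1 - k 0 = 0" using g01 by (simp add: k_def)
  then have "p * N (n + 2) - (real n + 1) / 2 * (N n - N (n + 2)) = 0"
    using has_integral_unique[OF j1 j2] by simp
  then show "beta_moment p (n + 2) * (real n + 1 + 2 * p) = (real n + 1) * beta_moment p n"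
    unfolding N_def by (simp add: field_simps)
qed

text \<open>Expand the exponential. Odd moments vanish, and the even ones divided by (2m)! obey the
  recursion of \<open>bc_coeff_Suc\<close> for order p - 1/2, up to a factor 4 per step; the case m
  = 0 fixes the constant.\<close>

lemma poisson_bc:
  assumes p: "p > 0"
  shows "has_bochner_integral lborel (\<lambda>u. indicator {0..1} u * (exp (q * (1 - 2 * u)) * (u powr (p - 1) * (1 - u) powr (p - 1))))
    (Beta p p * Gamma (p + 1/2) * bc (p - 1/2) (q\<^sup>2 / 4))"
proof -
  define \<rho> where "\<rho> = (\<lambda>u::real. u powr (p - 1) * (1 - u) powr (p - 1))"
  have \<rho>0: "\<rho> u \<ge> 0" for u by (simp add: \<rho>_def)
  define N where "N = beta_moment p"
  note Nfacts = has_integral_beta_moment[OF p, folded N_def] beta_moment_0[OF p, folded N_def]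
    beta_moment_1[OF p, folded N_def] beta_moment_Suc_Suc[OF p, folded N_def]
  have Nodd: "N (2 * m + 1) = 0" for m
  proof (induction m)
    case 0
    then show ?case using Nfacts(3) by simp
  next
    case (Suc m)
    then show ?case using Nfacts(4)[of "2 * m + 1"] p by (simp add: add_pos_pos)
  qed
  have Neven: "N (2 * m) / fact (2 * m) = Beta p p * Gamma (p + 1/2) * (bc_coeff (p - 1/2) m / 4 ^ m)" for m
  proof (induction m)
    case 0
    have "Gamma (p + 1/2) > 0" using p by (intro Gamma_real_pos) simp
    then show ?case using Nfacts(2) by (simp add: bc_coeff_def rGamma_inverse_Gamma add.commute)
  next
    case (Suc m)
    define r where "r = (real m + 1) * (real m + 1/2 + p)"
    have r: "r > 0" using p by (auto simp: r_def intro!: mult_pos_pos)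
    have "bc_coeff (p - 1/2) (Suc m) * r = bc_coeff (p - 1/2) m"
      using bc_coeff_Suc[of m "p - 1/2"] by (simp add: r_def algebra_simps)
    moreover have "N (2 * Suc m) / fact (2 * Suc m) * (4 * r) = N (2 * m) / fact (2 * m)"
    proof -
      have rec: "N (2 * Suc m) * (2 * real m + 1 + 2 * p) = (2 * real m + 1) * N (2 * m)"
        using Nfacts(4)[of "2 * m"] by simp
      have fac: "fact (2 * Suc m) = (2 * real m + 2) * ((2 * real m + 1) * fact (2 * m))"
        by (simp add: algebra_simps)
      have r4: "4 * r = (2 * real m + 2) * (2 * real m + 1 + 2 * p)"
        by (simp add: r_def algebra_simps)
      have "N (2 * Suc m) / fact (2 * Suc m) * (4 * r) = (N (2 * Suc m) * (2 * real m + 1 + 2 * p)) / ((2 * real m + 1) * fact (2 * m))"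
        unfolding fac r4 by simp
      then show ?thesis unfolding rec by simp
    qed
    ultimately have "N (2 * Suc m) / fact (2 * Suc m) * (4 * r)
      = Beta p p * Gamma (p + 1/2) * (bc_coeff (p - 1/2) (Suc m) * r / 4 ^ m)"
      using Suc by (simp only:)
    also have "\<dots> = Beta p p * Gamma (p + 1/2) * (bc_coeff (p - 1/2) (Suc m) / 4 ^ Suc m) * (4 * r)"
      by simp
    finally show ?case using r by (simp only: mult_cancel_right) simp
  qed
  show ?thesis
  proof (rule has_bochner_integral_sums)
    have absint: "integrable lborel (\<lambda>u. indicator {0..1} u * ((1 - 2 * u) ^ n * \<rho> u))" for n
    proof (rule Bochner_Integration.integrable_bound)
      show "integrable lborel (\<lambda>u. indicator {0..1} u * \<rho> u)"
        using has_bochner_integral_of_nonneg[of "{0..1}" \<rho> "Beta p p"] has_integral_Beta_real[OF p p] \<rho>0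
        by (auto simp: \<rho>_def has_bochner_integral_iff)
      show "AE u in lborel. norm (indicator {0..1} u * ((1 - 2 * u) ^ n * \<rho> u)) \<le> norm (indicator {0..1} u * \<rho> u)"
      proof (rule AE_I2)
        fix u :: real
        have "\<bar>1 - 2 * u\<bar> ^ n * \<rho> u \<le> 1 * \<rho> u" if "u \<in> {0..1}"
          using \<rho>0 that by (intro mult_right_mono power_le_one) auto
        then show "norm (indicator {0..1} u * ((1 - 2 * u) ^ n * \<rho> u)) \<le> norm (indicator {0..1} u * \<rho> u)"
          using \<rho>0[of u] by (auto simp: abs_mult power_abs indicator_def)
      qed
    qed (simp add: \<rho>_def)
    have hb: "has_bochner_integral lborel (\<lambda>u. indicator {0..1} u * ((1 - 2 * u) ^ n * \<rho> u)) (N n)" for n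
    proof -
      have si: "set_integrable lborel {0..1} (\<lambda>u. (1 - 2 * u) ^ n * \<rho> u)"
        using absint by (simp add: set_integrable_def)
      have "(LINT u:{0..1}|lborel. (1 - 2 * u) ^ n * \<rho> u) = N n"
        using set_borel_integral_eq_integral(2)[OF si] by (simp add: N_def beta_moment_def \<rho>_def)
      then show ?thesis using absint by (simp add: has_bochner_integral_iff set_lebesgue_integral_def)
    qed
    fix n
    show "has_bochner_integral lborel (\<lambda>u. q ^ n / fact n * (indicator {0..1} u * ((1 - 2 * u) ^ n * \<rho> u))) (q ^ n / fact n * N n)"
      by (intro has_bochner_integral_mult_right hb)
    \<comment> \<open>As |1 - 2u| <= 1, all absolute moments are at most the zeroth one, and the
      exponential series of |q| dominates.\<close>
    have "(\<integral>u. \<bar>q ^ n / fact n * (indicator {0..1} u * ((1 - 2 * u) ^ n * \<rho> u))\<bar> \<partial>lborel)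
       \<le> (\<integral>u. \<bar>q\<bar> ^ n / fact n * (indicator {0..1} u * ((1 - 2 * u) ^ 0 * \<rho> u)) \<partial>lborel)"
    proof (rule integral_mono)
      show "integrable lborel (\<lambda>u. \<bar>q ^ n / fact n * (indicator {0..1} u * ((1 - 2 * u) ^ n * \<rho> u))\<bar>)"
        by (intro integrable_abs integrable_mult_right absint)
      show "integrable lborel (\<lambda>u. \<bar>q\<bar> ^ n / fact n * (indicator {0..1} u * ((1 - 2 * u) ^ 0 * \<rho> u)))"
        by (intro integrable_mult_right absint)
      fix u :: real
      show "\<bar>q ^ n / fact n * (indicator {0..1} u * ((1 - 2 * u) ^ n * \<rho> u))\<bar> \<le> \<bar>q\<bar> ^ n / fact n * (indicator {0..1} u * ((1 - 2 * u) ^ 0 * \<rho> u))"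
      proof (cases "u \<in> {0..1}")
        case True
        then have "\<bar>1 - 2 * u\<bar> ^ n * \<rho> u \<le> 1 * \<rho> u"
          using \<rho>0 by (intro mult_right_mono power_le_one) auto
        then have "\<bar>q\<bar> ^ n / fact n * (\<bar>1 - 2 * u\<bar> ^ n * \<rho> u) \<le> \<bar>q\<bar> ^ n / fact n * (1 * \<rho> u)"
          by (rule mult_left_mono) simp
        moreover have "\<bar>q ^ n / fact n * (indicator {0..1} u * ((1 - 2 * u) ^ n * \<rho> u))\<bar> = \<bar>q\<bar> ^ n / fact n * (\<bar>1 - 2 * u\<bar> ^ n * \<rho> u)"
          using True \<rho>0[of u] by (simp add: abs_mult power_abs)
        moreover have "\<bar>q\<bar> ^ n / fact n * (indicator {0..1} u * ((1 - 2 * u) ^ 0 * \<rho> u)) = \<bar>q\<bar> ^ n / fact n * (1 * \<rho> u)"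
          using True by simp
        ultimately show ?thesis by linarith
      qed simp
    qed
    also have "\<dots> = \<bar>q\<bar> ^ n / fact n * N 0"
      using has_bochner_integral_mult_right[OF hb[of 0], of "\<bar>q\<bar> ^ n / fact n"] by (simp only: has_bochner_integral_iff)
    finally show "(\<integral>u. \<bar>q ^ n / fact n * (indicator {0..1} u * ((1 - 2 * u) ^ n * \<rho> u))\<bar> \<partial>lborel) \<le> \<bar>q\<bar> ^ n / fact n * N 0" .
  next
    show "summable (\<lambda>n. \<bar>q\<bar> ^ n / fact n * N 0)"
      using summable_norm_exp[of q] by (intro summable_mult2) (simp add: divide_inverse mult_ac power_abs abs_mult)
  next
    have eq: "q ^ n / fact n * (indicator {0..1} u * ((1 - 2 * u) ^ n * \<rho> u)) = (indicator {0..1} u * \<rho> u) * ((q * (1 - 2 * u)) ^ n / fact n)" for n u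
      by (simp add: power_mult_distrib)
    have ex: "(\<lambda>n. x ^ n / fact n) sums exp x" for x :: real
      using exp_converges[of x] by (simp add: divide_inverse mult_ac)
    fix u
    show "summable (\<lambda>n. \<bar>q ^ n / fact n * (indicator {0..1} u * ((1 - 2 * u) ^ n * \<rho> u))\<bar>)"
      unfolding eq abs_mult[of "indicator {0..1} u * \<rho> u"]
      using summable_norm_exp[of "q * (1 - 2 * u)"] by (intro summable_mult) (simp add: divide_inverse mult_ac)
    have "(\<lambda>n. q ^ n / fact n * (indicator {0..1} u * ((1 - 2 * u) ^ n * \<rho> u))) sums ((indicator {0..1} u * \<rho> u) * exp (q * (1 - 2 * u)))"
      unfolding eq by (intro sums_mult ex)
    then show "(\<lambda>n. q ^ n / fact n * (indicator {0..1} u * ((1 - 2 * u) ^ n * \<rho> u))) sums (indicator {0..1} u * (exp (q * (1 - 2 * u)) * (u powr (p - 1) * (1 - u) powr (p - 1))))"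
      by (simp add: mult_ac \<rho>_def)
  next
    have "(\<lambda>m. q ^ (2 * m) / fact (2 * m) * N (2 * m)) sums (Beta p p * Gamma (p + 1/2) * bc (p - 1/2) (q\<^sup>2 / 4))"
    proof -
      have "(\<lambda>m. q ^ (2 * m) / fact (2 * m) * N (2 * m)) = (\<lambda>m. q ^ (2 * m) * (N (2 * m) / fact (2 * m)))"
        by simp
      also have "\<dots> = (\<lambda>m. Beta p p * Gamma (p + 1/2) * (bc_coeff (p - 1/2) m * (q\<^sup>2 / 4) ^ m))"
        unfolding Neven power_mult power_divide by (simp only: mult_ac times_divide_eq_right times_divide_eq_left)
      finally have e: "(\<lambda>m. q ^ (2 * m) / fact (2 * m) * N (2 * m)) = (\<lambda>m. Beta p p * Gamma (p + 1/2) * (bc_coeff (p - 1/2) m * (q\<^sup>2 / 4) ^ m))" .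
      show ?thesis unfolding e by (intro sums_mult bc_sums)
    qed
    moreover have "strict_mono (\<lambda>m::nat. 2 * m)" by (simp add: strict_mono_def)
    moreover have "q ^ n / fact n * N n = 0" if "n \<notin> range (\<lambda>m. 2 * m)" for n
    proof -
      have "odd n" using that by (auto elim!: evenE)
      then obtain m where "n = 2 * m + 1" by (elim oddE)
      then show ?thesis using Nodd by simp
    qed
    ultimately show "(\<lambda>n. q ^ n / fact n * N n) sums (Beta p p * Gamma (p + 1/2) * bc (p - 1/2) (q\<^sup>2 / 4))"
      using sums_mono_reindex[of "\<lambda>m. 2 * m" "\<lambda>n. q ^ n / fact n * N n"] by blast
  qed
qed

section \<open>Euler integrals\<close>

text \<open>Its integral over (0, 1) is Euler's integral for Gauss's hypergeometric function: for p,
  q > 0 and 0 < b < 1 it equals \<open>Beta p q\<close> times F(r, p; p + q; b).\<close>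

definition euler_integrand :: "real \<Rightarrow> real \<Rightarrow> real \<Rightarrow> real \<Rightarrow> real \<Rightarrow> real" where
  "euler_integrand p q r b u = u powr (p - 1) * (1 - u) powr (q - 1) * (1 - b * u) powr (- r)"

definition euler_integral :: "real \<Rightarrow> real \<Rightarrow> real \<Rightarrow> real \<Rightarrow> real" where
  "euler_integral p q r b = integral {0<..<1} (euler_integrand p q r b)"

lemma euler_integrand_nonneg: "euler_integrand p q r b u \<ge> 0"
  by (simp add: euler_integrand_def)

lemma euler_integrand_measurable [measurable]: "euler_integrand p q r b \<in> borel_measurable borel"
  unfolding euler_integrand_def[abs_def] by measurable

lemma has_integral_Beta_open:
  assumes "p > 0" "q > (0::real)"
  shows "((\<lambda>u. u powr (p - 1) * (1 - u) powr (q - 1)) has_integral Beta p q) {0<..<1}"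
  using has_integral_Beta_real[OF assms] by (simp add: has_integral_Icc_iff_Ioo)

lemma one_minus_mult_bounds:
  fixes b u :: real
  assumes "0 < b" "b \<le> c" "c \<le> 1" "0 < u" "u < 1"
  shows "1 - u \<le> 1 - b * u" "1 - c \<le> 1 - b * u" "1 - b * u < 1" "0 < 1 - b * u"
proof -
  have "b * u \<le> 1 * u" by (rule mult_right_mono) (use assms in auto)
  moreover have "b * u \<le> c * 1" by (rule mult_mono) (use assms in auto)
  moreover have "b * u > 0" using assms by simp
  ultimately show "1 - u \<le> 1 - b * u" "1 - c \<le> 1 - b * u" "1 - b * u < 1" "0 < 1 - b * u"
    using assms by linarith+
qed

text \<open>An integrable majorant common to all b <= c. The maximum covers both signs of r, because
  1 - bu lies between 1 - c and 1.\<close>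

lemma euler_integrand_le:
  assumes "0 < b" "b \<le> c" "c < 1" "0 < u" "u < 1"
  shows "euler_integrand p q r b u \<le> max 1 ((1 - c) powr (- r)) * (u powr (p - 1) * (1 - u) powr (q - 1))"
proof -
  note bd = one_minus_mult_bounds[of b c u]
  have "(1 - b * u) powr (- r) \<le> max 1 ((1 - c) powr (- r))"
  proof (cases "r \<ge> 0")
    case True
    then have "(1 - b * u) powr (- r) \<le> (1 - c) powr (- r)"
      using bd assms by (intro powr_mono2') auto
    then show ?thesis by simp
  next
    case False
    then have "(1 - b * u) powr (- r) \<le> 1 powr (- r)"
      using bd assms by (intro powr_mono2) auto
    then show ?thesis by simp
  qed
  then have "u powr (p - 1) * (1 - u) powr (q - 1) * (1 - b * u) powr (- r)
    \<le> u powr (p - 1) * (1 - u) powr (q - 1) * max 1 ((1 - c) powr (- r))"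
    by (rule mult_left_mono) simp
  then show ?thesis by (simp add: euler_integrand_def mult_ac)
qed

lemma has_integral_euler:
  assumes p: "p > 0" and q: "q > 0" and b: "0 < b" "b < 1"
  shows "(euler_integrand p q r b has_integral euler_integral p q r b) {0<..<1}"
proof -
  have "euler_integrand p q r b absolutely_integrable_on {0<..<1}"
  proof (rule measurable_bounded_by_integrable_imp_absolutely_integrable)
    show "euler_integrand p q r b \<in> borel_measurable (lebesgue_on {0<..<1})"
      by (intro measurable_restrict_space1 measurable_completion) simp
    show "(\<lambda>u. max 1 ((1 - b) powr (- r)) * (u powr (p - 1) * (1 - u) powr (q - 1))) integrable_on {0<..<1}"
      using has_integral_mult_right[OF has_integral_Beta_open[OF p q]] by blast
    fix u :: real assume "u \<in> {0<..<1}"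
    then show "norm (euler_integrand p q r b u) \<le> max 1 ((1 - b) powr (- r)) * (u powr (p - 1) * (1 - u) powr (q - 1))"
      using euler_integrand_le[of b b u p q r] b euler_integrand_nonneg[of p q r b u] by simp
  qed auto
  then have "euler_integrand p q r b integrable_on {0<..<1}"
    by (rule set_lebesgue_integral_eq_integral(1))
  then show ?thesis unfolding euler_integral_def by (rule integrable_integral)
qed

text \<open>Dominated convergence on each (0, c) with c < 1; the majorant is lost as c tends to 1,
  but continuity is local.\<close>

lemma continuous_on_euler_integral:
  assumes p: "p > 0" and q: "q > 0"
  shows "continuous_on {0<..<1} (euler_integral p q r)"
proof -
  have c: "continuous_on {0<..<c} (euler_integral p q r)" if c: "c < 1" for c
    unfolding continuous_on_sequentially
  proof (intro allI ballI impI)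
    fix bs b assume b: "b \<in> {0<..<c}" and bs: "(\<forall>n. bs n \<in> {0<..<c}) \<and> bs \<longlonglongrightarrow> b"
    have hi: "(euler_integrand p q r b' has_integral euler_integral p q r b') {0<..<1}" if "b' \<in> {0<..<c}" for b'
      using that c by (intro has_integral_euler p q) auto
    have "(\<lambda>n. integral {0<..<1} (euler_integrand p q r (bs n))) \<longlonglongrightarrow> integral {0<..<1} (euler_integrand p q r b)"
    proof (rule dominated_convergence(2))
      show "euler_integrand p q r (bs n) integrable_on {0<..<1}" for n
        using hi bs by blast
      show "(\<lambda>u. max 1 ((1 - c) powr (- r)) * (u powr (p - 1) * (1 - u) powr (q - 1))) integrable_on {0<..<1}"
        using has_integral_mult_right[OF has_integral_Beta_open[OF p q]] by blast
      show "norm (euler_integrand p q r (bs n) u) \<le> max 1 ((1 - c) powr (- r)) * (u powr (p - 1) * (1 - u) powr (q - 1))"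
        if "u \<in> {0<..<1}" for n u
      proof -
        have "0 < bs n" "bs n \<le> c" using bs by (auto intro: less_imp_le)
        then show ?thesis
          using euler_integrand_le[of "bs n" c u p q r] c that euler_integrand_nonneg[of p q r "bs n" u] by simp
      qed
      show "(\<lambda>n. euler_integrand p q r (bs n) u) \<longlonglongrightarrow> euler_integrand p q r b u" if "u \<in> {0<..<1}" for u
      proof -
        have "1 - b * u \<noteq> 0" using one_minus_mult_bounds(4)[of b 1 u] b c that by simp
        then show ?thesis unfolding euler_integrand_def using bs
          by (intro tendsto_intros) auto
      qed
    qed
    then show "(euler_integral p q r \<circ> bs) \<longlonglongrightarrow> euler_integral p q r b"
      by (simp add: euler_integral_def[abs_def] o_def)
  qed
  have "isCont (euler_integral p q r) b" if "b \<in> {0<..<1}" for b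
  proof -
    have "\<exists>c. b < c \<and> c < 1" using that by (intro dense) simp
    then obtain c where "b < c" "c < 1" by blast
    then show ?thesis using c[of c] that by (simp add: continuous_on_eq_continuous_at)
  qed
  then show ?thesis by (intro continuous_at_imp_continuous_on) auto
qed

lemma Beta_real_pos: "p > 0 \<Longrightarrow> q > (0::real) \<Longrightarrow> Beta p q > 0"
  by (simp add: Beta_def Gamma_real_pos)

text \<open>From 1 - u <= 1 - bu <= 1 the last factor lies between 1 and (1 - u)^(-r). The two
  extremes integrate to the two Beta values, the second finite because r < q; the sign of r decides
  which is smaller.\<close>

lemma euler_integral_bounds_gt:
  assumes p: "p > 0" and q: "q > 0" and r: "r < q" and b: "0 < b" "b < 1"
  shows "min (Beta p q) (Beta p (q - r)) \<le> euler_integral p q r b"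
    and "euler_integral p q r b \<le> max (Beta p q) (Beta p (q - r))"
proof -
  note hi = has_integral_euler[OF p q b, of r]
  have B1: "((\<lambda>u. u powr (p - 1) * (1 - u) powr (q - 1)) has_integral Beta p q) {0<..<1}"
    by (rule has_integral_Beta_open[OF p q])
  have B2: "((\<lambda>u. u powr (p - 1) * (1 - u) powr (q - r - 1)) has_integral Beta p (q - r)) {0<..<1}"
    using r by (intro has_integral_Beta_open p) simp
  have c2: "u powr (p - 1) * (1 - u) powr (q - r - 1) = u powr (p - 1) * (1 - u) powr (q - 1) * (1 - u) powr (- r)"
    if "u \<in> {0<..<1}" for u
  proof -
    have "(1 - u) powr (q - r - 1) = (1 - u) powr (q - 1) * (1 - u) powr (- r)"
    proof -
      have "q - r - 1 = (q - 1) + (- r)" by simp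
      then show ?thesis by (simp only: powr_add)
    qed
    then show ?thesis by simp
  qed
  have pr: "(1 - u) \<le> (1 - b * u)" "0 < 1 - b * u" "1 - b * u \<le> 1" if "u \<in> {0<..<1}" for u
    using one_minus_mult_bounds[of b 1 u] that b by auto
  show "min (Beta p q) (Beta p (q - r)) \<le> euler_integral p q r b"
  proof (cases "r \<ge> 0")
    case True
    have "Beta p q \<le> euler_integral p q r b"
    proof (rule has_integral_le[OF B1 hi])
      fix u :: real assume u: "u \<in> {0<..<1}"
      have "(1 - b * u) powr 0 \<le> (1 - b * u) powr (- r)"
        using pr[OF u] True by (intro powr_mono') auto
      then have "1 \<le> (1 - b * u) powr (- r)" using pr[OF u] by simp
      then have "u powr (p - 1) * (1 - u) powr (q - 1) * 1 \<le> u powr (p - 1) * (1 - u) powr (q - 1) * (1 - b * u) powr (- r)"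
        by (rule mult_left_mono) simp
      then show "u powr (p - 1) * (1 - u) powr (q - 1) \<le> euler_integrand p q r b u" by (simp add: euler_integrand_def)
    qed
    then show ?thesis by simp
  next
    case False
    have "Beta p (q - r) \<le> euler_integral p q r b"
    proof (rule has_integral_le[OF B2 hi])
      fix u :: real assume u: "u \<in> {0<..<1}"
      have "(1 - u) powr (- r) \<le> (1 - b * u) powr (- r)"
        using pr[OF u] u False by (intro powr_mono2) auto
      then show "u powr (p - 1) * (1 - u) powr (q - r - 1) \<le> euler_integrand p q r b u"
        unfolding euler_integrand_def c2[OF u] by (rule mult_left_mono) simp
    qed
    then show ?thesis by simp
  qed
  show "euler_integral p q r b \<le> max (Beta p q) (Beta p (q - r))"
  proof (cases "r \<ge> 0")
    case False
    have "euler_integral p q r b \<le> Beta p q"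
    proof (rule has_integral_le[OF hi B1])
      fix u :: real assume u: "u \<in> {0<..<1}"
      have "(1 - b * u) powr (- r) \<le> 1 powr (- r)"
        using pr[OF u] False by (intro powr_mono2) auto
      then have "u powr (p - 1) * (1 - u) powr (q - 1) * (1 - b * u) powr (- r) \<le> u powr (p - 1) * (1 - u) powr (q - 1) * 1"
        by (intro mult_left_mono) simp_all
      then show "euler_integrand p q r b u \<le> u powr (p - 1) * (1 - u) powr (q - 1)" by (simp add: euler_integrand_def)
    qed
    then show ?thesis by simp
  next
    case True
    have "euler_integral p q r b \<le> Beta p (q - r)"
    proof (rule has_integral_le[OF hi B2])
      fix u :: real assume u: "u \<in> {0<..<1}"
      have "(1 - b * u) powr (- r) \<le> (1 - u) powr (- r)"
        using pr[OF u] u True by (intro powr_mono2') auto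
      then show "euler_integrand p q r b u \<le> u powr (p - 1) * (1 - u) powr (q - r - 1)"
        unfolding euler_integrand_def c2[OF u] by (rule mult_left_mono) simp
    qed
    then show ?thesis by simp
  qed
qed

text \<open>Euler's transformation of the hypergeometric function, by the involution w -> (1 - w)/(1
  - bw), which interchanges 0 and 1 and thereby p and q.\<close>

lemma euler_integral_transform:
  assumes p: "p > 0" and q: "q > 0" and b: "0 < b" "b < 1"
  shows "euler_integral p q r b = (1 - b) powr (q - r) * euler_integral q p (p + q - r) b"
proof -
  define g where "g = (\<lambda>w. (1 - w) / (1 - b * w))"
  have pr: "0 < 1 - b * w" "1 - w \<le> 1 - b * w" if "w \<in> {0<..<1}" for w
    using one_minus_mult_bounds[of b 1 w] that b by auto
  have comp: "1 - g w = w * (1 - b) / (1 - b * w)" "1 - b * g w = (1 - b) / (1 - b * w)" if "w \<in> {0<..<1}" for w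
    using pr[OF that] by (auto simp: g_def field_simps)
  have g01: "g w \<in> {0<..<1}" if w: "w \<in> {0<..<1}" for w
  proof -
    have "g w > 0" unfolding g_def by (rule divide_pos_pos) (use pr(1)[OF w] w in simp_all)
    moreover have "1 - g w > 0" unfolding comp[OF w]
      by (intro divide_pos_pos mult_pos_pos) (use pr(1)[OF w] w b in simp_all)
    ultimately show ?thesis by simp
  qed
  have gg: "g (g w) = w" if w: "w \<in> {0<..<1}" for w
  proof -
    have "g (g w) = (1 - g w) / (1 - b * g w)" by (simp add: g_def)
    also have "\<dots> = w" unfolding comp[OF w] using pr[OF w] b by simp
    finally show ?thesis .
  qed
  have im: "g ` {0<..<1} = {0<..<1}"
  proof (intro equalityI subsetI)
    fix w :: real assume "w \<in> {0<..<1}"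
    then show "w \<in> g ` {0<..<1}" using gg g01 by (intro image_eqI[of _ _ "g w"]) auto
  qed (use g01 in auto)
  have inj: "inj_on g {0<..<1}" by (rule inj_on_inverseI[where g = g]) (rule gg)
  have "((\<lambda>w. \<bar>- (1 - b) / (1 - b * w)\<^sup>2\<bar> * euler_integrand p q r b (g w)) has_integral euler_integral p q r b) {0<..<1}"
  proof (rule has_integral_change_of_variables_nonneg[OF _ _ inj])
    fix w :: real assume w: "w \<in> {0<..<1}"
    have "(g has_real_derivative ((- 1) * (1 - b * w) - (1 - w) * (- b)) / ((1 - b * w) * (1 - b * w))) (at w within {0<..<1})"
      unfolding g_def using pr[OF w] by (intro DERIV_divide) (auto intro!: derivative_eq_intros)
    then show "(g has_real_derivative - (1 - b) / (1 - b * w)\<^sup>2) (at w within {0<..<1})"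
      by (rule DERIV_cong) (simp add: power2_eq_square algebra_simps)
  qed (use has_integral_euler[OF p q b, of r] im euler_integrand_nonneg in auto)
  moreover have "\<bar>- (1 - b) / (1 - b * w)\<^sup>2\<bar> * euler_integrand p q r b (g w) = (1 - b) powr (q - r) * euler_integrand q p (p + q - r) b w"
    if w: "w \<in> {0<..<1}" for w
  proof -
    define D where "D = 1 - b * w"
    define d where "d = 1 - b"
    have D: "D > 0" "d > 0" using pr[OF w] b by (auto simp: D_def d_def)
    have w0: "w > 0" "1 - w > 0" using w by auto
    have gw: "g w = (1 - w) / D" "1 - g w = w * d / D" "1 - b * g w = d / D"
      using comp[OF w] by (auto simp: D_def d_def g_def)
    have dd: "d powr (q - r) = d * (d powr (q - 1) * d powr (- r))"
      using D by (simp add: powr_mult_base flip: powr_add)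
    have DD: "D powr (- (p + q - r)) = (1 / D\<^sup>2) * ((1 / D powr (p - 1)) * (1 / D powr (q - 1)) * (1 / D powr (- r)))"
    proof -
      have "D powr (- (p + q - r)) = D powr (-2) * (D powr (- (p - 1)) * D powr (- (q - 1)) * D powr r)"
      proof -
        have e: "- (p + q - r) = - 2 + (- (p - 1) + - (q - 1) + r)" by simp
        show ?thesis by (subst e) (simp only: powr_add)
      qed
      also have "D powr (-2) = 1 / D\<^sup>2" using D by (simp add: powr_minus_divide)
      also have "D powr (- (p - 1)) = 1 / D powr (p - 1)" by (rule powr_minus_divide)
      also have "D powr (- (q - 1)) = 1 / D powr (q - 1)" by (rule powr_minus_divide)
      also have "D powr r = 1 / D powr (- r)" using powr_minus_divide[of D "- r"] by (simp only: minus_minus)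
      finally show ?thesis .
    qed
    have "\<bar>- d / D\<^sup>2\<bar> * (((1 - w) / D) powr (p - 1) * (w * d / D) powr (q - 1) * (d / D) powr (- r))
      = d powr (q - r) * (w powr (q - 1) * (1 - w) powr (p - 1) * D powr (- (p + q - r)))"
      using D w0 unfolding dd DD by (simp add: powr_mult powr_divide)
    then show ?thesis unfolding euler_integrand_def gw(2,3) unfolding gw(1) D_def d_def .
  qed
  ultimately have 1: "((\<lambda>w. (1 - b) powr (q - r) * euler_integrand q p (p + q - r) b w) has_integral euler_integral p q r b) {0<..<1}"
    by (rule has_integral_eq[rotated])
  have 2: "((\<lambda>w. (1 - b) powr (q - r) * euler_integrand q p (p + q - r) b w) has_integral ((1 - b) powr (q - r) * euler_integral q p (p + q - r) b)) {0<..<1}"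
    by (rule has_integral_mult_right[OF has_integral_euler[OF q p b]])
  show ?thesis by (rule has_integral_unique[OF 1 2])
qed

lemma has_integral_inverse_one_minus:
  assumes "a \<le> b" "b < (1::real)"
  shows "((\<lambda>u. 1 / (1 - u)) has_integral (ln (1 - a) - ln (1 - b))) {a..b}"
proof -
  have "((\<lambda>u. - ln (1 - u)) has_real_derivative 1 / (1 - u)) (at u within {a..b})" if "u \<in> {a..b}" for u
    using that assms by (auto intro!: derivative_eq_intros)
  then have "((\<lambda>u. 1 / (1 - u)) has_integral (- ln (1 - b) - - ln (1 - a))) {a..b}"
    using assms by (intro fundamental_theorem_of_calculus) (auto simp flip: has_real_derivative_iff_has_vector_derivative)
  then show ?thesis by simp
qed

lemma has_integral_one_minus_powr:
  assumes "b \<le> 1" "q > (0::real)"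
  shows "((\<lambda>u. (1 - u) powr (q - 1)) has_integral ((1 - b) powr q / q)) {b..1}"
proof -
  have d: "((\<lambda>u. - ((1 - u) powr q / q)) has_real_derivative (1 - u) powr (q - 1)) (at u)" if "u < 1" for u
  proof -
    have "((\<lambda>u. (1 - u) powr q) has_real_derivative q * (1 - u) powr (q - 1) * (- 1)) (at u)"
      by (rule DERIV_chain2[OF has_real_derivative_powr]) (use that in \<open>auto intro!: derivative_eq_intros\<close>)
    from DERIV_minus[OF DERIV_cdivide[OF this, of q]] show ?thesis by (rule DERIV_cong) (use assms in simp)
  qed
  have "continuous_on {b..1} (\<lambda>u. - ((1 - u) powr q / q))"
    by (intro continuous_on_minus continuous_on_divide continuous_on_powr' continuous_on_diff continuous_on_id continuous_on_const)
       (use assms in auto)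
  then have "((\<lambda>u. (1 - u) powr (q - 1)) has_integral (- ((1 - 1) powr q / q) - - ((1 - b) powr q / q))) {b..1}"
    using assms d by (intro fundamental_theorem_of_calculus_interior) (auto simp flip: has_real_derivative_iff_has_vector_derivative)
  then show ?thesis using assms by simp
qed

lemma powr_mult_powr_minus:
  assumes "v > (0::real)"
  shows "v powr (q - 1) * v powr (- q) = 1 / v"
proof -
  have "v powr (q - 1) * v powr (- q) = v powr ((q - 1) + (- q))" by (rule powr_add[symmetric])
  also have "(q - 1) + (- q) = - 1" by simp
  finally show ?thesis using assms by (simp add: powr_minus_divide)
qed

text \<open>Majorants for the critical case r = q. The range u <= 1/2 is absorbed by the Beta
  weight; beyond it 1 - bu is bounded below by 1 - u or by (1 - b)/2. The first choice is to be used
  for u < b, as it is not integrable at 1, the second for u > b.\<close>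

lemma euler_integrand_upper_half:
  assumes p: "p > 0" and q: "q > 0" and b: "0 < b" "b < 1" and u: "0 < u" "u < 1"
  shows "euler_integrand p q q b u \<le> 2 powr q * (u powr (p - 1) * (1 - u) powr (q - 1)) + max 1 (2 powr (1 - p)) * (1 / (1 - u))"
    and "euler_integrand p q q b u \<le> 2 powr q * (u powr (p - 1) * (1 - u) powr (q - 1))
      + max 1 (2 powr (1 - p)) * (2 powr q * (1 - b) powr (- q) * (1 - u) powr (q - 1))"
proof -
  have pr: "(1 - u) \<le> (1 - b * u)" "0 < 1 - b * u"
    using one_minus_mult_bounds[of b 1 u] u b by auto
  have nn: "0 \<le> u powr (p - 1) * (1 - u) powr (q - 1)" by simp
  have small: "euler_integrand p q q b u \<le> 2 powr q * (u powr (p - 1) * (1 - u) powr (q - 1))" if "u \<le> 1/2"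
  proof -
    have "b * u \<le> 1 * (1/2)" by (rule mult_mono) (use that b u in auto)
    then have "(1 - b * u) powr (- q) \<le> (1/2) powr (- q)" using q by (intro powr_mono2') auto
    also have "(1/2) powr (- q) = 2 powr q" by (simp add: powr_divide powr_minus_divide)
    finally have "(u powr (p - 1) * (1 - u) powr (q - 1)) * (1 - b * u) powr (- q) \<le> (u powr (p - 1) * (1 - u) powr (q - 1)) * 2 powr q"
      by (rule mult_left_mono) simp
    then show ?thesis by (simp add: euler_integrand_def mult_ac)
  qed
  have up: "u powr (p - 1) \<le> max 1 (2 powr (1 - p))" if "1/2 \<le> u"
  proof (cases "p \<ge> 1")
    case True
    then have "u powr (p - 1) \<le> 1 powr (p - 1)" using u by (intro powr_mono2) auto
    then show ?thesis by simp
  next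
    case False
    then have "u powr (p - 1) \<le> (1/2) powr (p - 1)" using u that by (intro powr_mono2') auto
    also have "(1/2) powr (p - 1) = 2 powr (1 - p)" by (simp add: powr_divide powr_diff)
    finally show ?thesis by simp
  qed
  show "euler_integrand p q q b u \<le> 2 powr q * (u powr (p - 1) * (1 - u) powr (q - 1)) + max 1 (2 powr (1 - p)) * (1 / (1 - u))"
  proof (cases "u \<le> 1/2")
    case True
    moreover have "0 \<le> max 1 (2 powr (1 - p)) * (1 / (1 - u))" using u by (intro mult_nonneg_nonneg) auto
    ultimately show ?thesis using small by linarith
  next
    case False
    have "(1 - b * u) powr (- q) \<le> (1 - u) powr (- q)" using pr u q by (intro powr_mono2') auto
    then have "(1 - u) powr (q - 1) * (1 - b * u) powr (- q) \<le> (1 - u) powr (q - 1) * (1 - u) powr (- q)"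
      by (rule mult_left_mono) simp
    also have "\<dots> = 1 / (1 - u)" using u by (intro powr_mult_powr_minus) simp
    finally have "u powr (p - 1) * ((1 - u) powr (q - 1) * (1 - b * u) powr (- q)) \<le> max 1 (2 powr (1 - p)) * (1 / (1 - u))"
      using up False u by (intro mult_mono) auto
    moreover have "0 \<le> 2 powr q * (u powr (p - 1) * (1 - u) powr (q - 1))" by simp
    ultimately show ?thesis by (simp only: euler_integrand_def mult.assoc)
  qed
  show "euler_integrand p q q b u \<le> 2 powr q * (u powr (p - 1) * (1 - u) powr (q - 1))
      + max 1 (2 powr (1 - p)) * (2 powr q * (1 - b) powr (- q) * (1 - u) powr (q - 1))"
  proof (cases "u \<le> 1/2")
    case True
    moreover have "0 \<le> max 1 (2 powr (1 - p)) * (2 powr q * (1 - b) powr (- q) * (1 - u) powr (q - 1))"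
      by (intro mult_nonneg_nonneg) auto
    ultimately show ?thesis using small by linarith
  next
    case False
    have "1 - b * u = (1 - u) + (1 - b) * u" by (simp add: algebra_simps)
    moreover have "(1 - b) * (1/2) \<le> (1 - b) * u" by (rule mult_left_mono) (use False b in auto)
    ultimately have "(1 - b) / 2 \<le> 1 - b * u" using u by simp
    then have "(1 - b * u) powr (- q) \<le> ((1 - b) / 2) powr (- q)" using b q by (intro powr_mono2') auto
    also have "\<dots> = 2 powr q * (1 - b) powr (- q)" using b by (simp add: powr_divide powr_minus_divide)
    finally have "(1 - b * u) powr (- q) * (1 - u) powr (q - 1) \<le> 2 powr q * (1 - b) powr (- q) * (1 - u) powr (q - 1)"
      by (rule mult_right_mono) simp
    then have "u powr (p - 1) * ((1 - b * u) powr (- q) * (1 - u) powr (q - 1))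
       \<le> max 1 (2 powr (1 - p)) * (2 powr q * (1 - b) powr (- q) * (1 - u) powr (q - 1))"
      using up False u by (intro mult_mono) auto
    moreover have "0 \<le> 2 powr q * (u powr (p - 1) * (1 - u) powr (q - 1))" by simp
    ultimately show ?thesis
      by (simp only: euler_integrand_def mult.assoc mult.commute[of "(1 - u) powr (q - 1)" "(1 - b * u) powr (- q)"])
  qed
qed

text \<open>Splitting at u = b: the integral of 1/(1 - u) up to b is the logarithm, and beyond b the
  powers of 1 - b cancel to a constant.\<close>

lemma euler_integral_upper_eq:
  assumes p: "p > 0" and q: "q > 0" and b: "0 < b" "b < 1"
  shows "euler_integral p q q b \<le> 2 powr q * Beta p q + max 1 (2 powr (1 - p)) * (2 powr q / q + ln (1 / (1 - b)))"
proof -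
  define m where "m = (\<lambda>u. 2 powr q * (u powr (p - 1) * (1 - u) powr (q - 1)))"
  define k where "k = max 1 (2 powr (1 - p))"
  have H: "(euler_integrand p q q b has_integral euler_integral p q q b) {0..1}"
    using has_integral_euler[OF p q b] by (simp add: has_integral_Icc_iff_Ioo)
  have mi: "(m has_integral (2 powr q * Beta p q)) {0..1}"
    unfolding m_def by (intro has_integral_mult_right has_integral_Beta_real p q)
  have sub: "euler_integrand p q q b integrable_on {0..b}" "euler_integrand p q q b integrable_on {b..1}"
     "m integrable_on {0..b}" "m integrable_on {b..1}"
    using H mi b by (auto intro: integrable_subinterval_real[of _ 0 1])
  have split: "euler_integral p q q b = integral {0..b} (euler_integrand p q q b) + integral {b..1} (euler_integrand p q q b)"
    using Henstock_Kurzweil_Integration.integral_combine[of 0 b 1 "euler_integrand p q q b"] H b by (auto simp: integral_unique)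
  have msplit: "2 powr q * Beta p q = integral {0..b} m + integral {b..1} m"
    using Henstock_Kurzweil_Integration.integral_combine[of 0 b 1 m] mi b by (auto simp: integral_unique)
  have i1: "((\<lambda>u. m u + k * (1 / (1 - u))) has_integral (integral {0..b} m + k * (ln (1 - 0) - ln (1 - b)))) {0<..<b}"
    using has_integral_add[OF integrable_integral[OF sub(3)] has_integral_mult_right[OF has_integral_inverse_one_minus[of 0 b]], of k] b
    by (simp add: has_integral_Icc_iff_Ioo)
  have i2: "((\<lambda>u. m u + k * (2 powr q * (1 - b) powr (- q) * (1 - u) powr (q - 1))) has_integral
      (integral {b..1} m + k * (2 powr q * (1 - b) powr (- q) * ((1 - b) powr q / q)))) {b<..<1}"
    using has_integral_add[OF integrable_integral[OF sub(4)] has_integral_mult_right[OF has_integral_mult_right[OF has_integral_one_minus_powr[of b q]]],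
       of k "2 powr q * (1 - b) powr (- q)"] b q
    by (simp add: has_integral_Icc_iff_Ioo)
  have A: "integral {0..b} (euler_integrand p q q b) \<le> integral {0..b} m + k * (ln (1 - 0) - ln (1 - b))"
  proof (rule has_integral_le[OF _ i1])
    show "(euler_integrand p q q b has_integral integral {0..b} (euler_integrand p q q b)) {0<..<b}"
      using integrable_integral[OF sub(1)] by (simp add: has_integral_Icc_iff_Ioo)
    show "euler_integrand p q q b u \<le> m u + k * (1 / (1 - u))" if "u \<in> {0<..<b}" for u
      unfolding m_def k_def using that b by (intro euler_integrand_upper_half p q) auto
  qed
  have B: "integral {b..1} (euler_integrand p q q b) \<le> integral {b..1} m + k * (2 powr q * (1 - b) powr (- q) * ((1 - b) powr q / q))"
  proof (rule has_integral_le[OF _ i2])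
    show "(euler_integrand p q q b has_integral integral {b..1} (euler_integrand p q q b)) {b<..<1}"
      using integrable_integral[OF sub(2)] by (simp add: has_integral_Icc_iff_Ioo)
    show "euler_integrand p q q b u \<le> m u + k * (2 powr q * (1 - b) powr (- q) * (1 - u) powr (q - 1))" if "u \<in> {b<..<1}" for u
      unfolding m_def k_def using that b by (intro euler_integrand_upper_half p q) auto
  qed
  have e1: "2 powr q * (1 - b) powr (- q) * ((1 - b) powr q / q) = 2 powr q / q"
    using b by (simp add: powr_minus_divide)
  have e2: "ln (1 - 0) - ln (1 - b) = ln (1 / (1 - b))" using b by (simp add: ln_div)
  show ?thesis
    unfolding split msplit k_def[symmetric] distrib_left using A[unfolded e2] B[unfolded e1] by linarith
qed

text \<open>For 1/2 <= u <= b one has 1 - bu <= (1 - b) + (1 - u) <= 2(1 - u), so the integrand is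
  at least a constant times 1/(1 - u). Starting at 1/2 costs the term ln 2.\<close>

lemma euler_integral_lower_eq:
  assumes p: "p > 0" and q: "q > 0" and b: "1/2 \<le> b" "b < 1"
  shows "min 1 (2 powr (1 - p)) * 2 powr (- q) * (ln (1 / (1 - b)) - ln 2) \<le> euler_integral p q q b"
proof -
  define k where "k = min 1 (2 powr (1 - p))"
  have b0: "0 < b" using b by simp
  have H: "(euler_integrand p q q b has_integral euler_integral p q q b) {0..1}"
    using has_integral_euler[OF p q b0 b(2)] by (simp add: has_integral_Icc_iff_Ioo)
  have sub: "euler_integrand p q q b integrable_on {1/2..b}"
    by (rule integrable_subinterval_real[of _ 0 1]) (use H b in auto)
  have i: "((\<lambda>u. k * 2 powr (- q) * (1 / (1 - u))) has_integral (k * 2 powr (- q) * (ln (1 - 1/2) - ln (1 - b)))) {1/2..b}"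
    using b by (intro has_integral_mult_right has_integral_inverse_one_minus)
  have "k * 2 powr (- q) * (ln (1 - 1/2) - ln (1 - b)) \<le> integral {1/2..b} (euler_integrand p q q b)"
  proof (rule has_integral_le[OF i])
    show "(euler_integrand p q q b has_integral integral {1/2..b} (euler_integrand p q q b)) {1/2..b}"
      by (rule integrable_integral[OF sub])
    fix u assume u: "u \<in> {1/2..b}"
    then have u0: "0 < u" "u < 1" using b by auto
    have pr: "0 < 1 - b * u" using one_minus_mult_bounds[of b 1 u] u0 b b0 by auto
    have "b * (1 - u) \<le> 1 * (1 - u)" using b u0 by (intro mult_right_mono) auto
    then have "1 - b * u \<le> (1 - b) + (1 - u)" by (simp add: algebra_simps)
    also have "\<dots> \<le> 2 * (1 - u)" using u by simp
    finally have "(2 * (1 - u)) powr (- q) \<le> (1 - b * u) powr (- q)" using pr q by (intro powr_mono2') auto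
    then have "(1 - u) powr (q - 1) * (2 * (1 - u)) powr (- q) \<le> (1 - u) powr (q - 1) * (1 - b * u) powr (- q)"
      by (rule mult_left_mono) simp
    moreover have "(1 - u) powr (q - 1) * (2 * (1 - u)) powr (- q) = 2 powr (- q) * ((1 - u) powr (q - 1) * (1 - u) powr (- q))"
      using u0 by (subst powr_mult) (simp_all only: mult_ac)
    moreover have "(1 - u) powr (q - 1) * (1 - u) powr (- q) = 1 / (1 - u)" using u0 by (intro powr_mult_powr_minus) simp
    ultimately have 1: "2 powr (- q) * (1 / (1 - u)) \<le> (1 - u) powr (q - 1) * (1 - b * u) powr (- q)" by simp
    have kk: "k \<le> u powr (p - 1)"
    proof (cases "p \<ge> 1")
      case False
      then have "1 powr (p - 1) \<le> u powr (p - 1)" using u0 by (intro powr_mono2') auto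
      then show ?thesis by (simp add: k_def)
    next
      case True
      then have "(1/2) powr (p - 1) \<le> u powr (p - 1)" using u by (intro powr_mono2) auto
      moreover have "(1/2) powr (p - 1) = 2 powr (1 - p)" by (simp add: powr_divide powr_diff)
      ultimately show ?thesis by (simp add: k_def)
    qed
    have "k * (2 powr (- q) * (1 / (1 - u))) \<le> u powr (p - 1) * ((1 - u) powr (q - 1) * (1 - b * u) powr (- q))"
      by (rule mult_mono[OF kk 1]) (use u0 in auto)
    then show "k * 2 powr (- q) * (1 / (1 - u)) \<le> euler_integrand p q q b u" by (simp add: euler_integrand_def mult.assoc)
  qed
  also have "\<dots> \<le> integral {0..1} (euler_integrand p q q b)"
    using H b sub by (intro integral_subset_le) (auto simp: euler_integrand_nonneg)
  also have "\<dots> = euler_integral p q q b" using H by (rule integral_unique)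
  also have "ln (1 - 1/2) - ln (1 - b) = ln (1 / (1 - b)) - ln (2::real)" using b by (simp add: ln_div)
  finally show ?thesis by (simp add: k_def)
qed

text \<open>The common source of the three cases in both estimates. Near b = 0 all forms of
  \<open>h\<close> are close to 1, so one pair of constants serves the whole of (0, 1).\<close>

lemma euler_integral_asymp:
  fixes p q r :: real
  assumes p: "p > 0" and q: "q > 0"
  defines "h \<equiv> (\<lambda>b. if q < r then (1 - b) powr (q - r) else if q = r then 1 + ln (1 / (1 - b)) else 1)"
  shows "\<exists>c C. 0 < c \<and> 0 < C \<and> (\<forall>b. 0 < b \<longrightarrow> b < 1 \<longrightarrow> c * h b \<le> euler_integral p q r b \<and> euler_integral p q r b \<le> C * h b)"
proof -
  consider "q < r" | "q = r" | "r < q" by linarith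
  then show ?thesis
  proof cases
    case 1
    \<comment> \<open>Euler's transformation replaces (q, r) by (p, p + q - r) with p + q - r < p,
      the bounded case; its prefactor is the claimed power of 1 - b.\<close>
    define c C where "c = min (Beta q p) (Beta q (p - (p + q - r)))" and "C = max (Beta q p) (Beta q (p - (p + q - r)))"
    have "c > 0" "C > 0" using p q 1 by (auto simp: c_def C_def Beta_real_pos less_max_iff_disj)
    moreover have "c * h b \<le> euler_integral p q r b \<and> euler_integral p q r b \<le> C * h b" if b: "0 < b" "b < 1" for b
    proof -
      have "p + q - r < p" using 1 by simp
      note bd = euler_integral_bounds_gt[OF q p this b, folded c_def C_def]
      have "(1 - b) powr (q - r) * c \<le> (1 - b) powr (q - r) * euler_integral q p (p + q - r) b"
        "(1 - b) powr (q - r) * euler_integral q p (p + q - r) b \<le> (1 - b) powr (q - r) * C"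
        using bd by (auto intro!: mult_left_mono)
      then show ?thesis using 1 by (simp add: h_def euler_integral_transform[OF p q b] mult.commute)
    qed
    ultimately show ?thesis by blast
  next
    case 3
    define c C where "c = min (Beta p q) (Beta p (q - r))" and "C = max (Beta p q) (Beta p (q - r))"
    have "c > 0" "C > 0" using p q 3 by (auto simp: c_def C_def Beta_real_pos less_max_iff_disj)
    moreover have "c * h b \<le> euler_integral p q r b \<and> euler_integral p q r b \<le> C * h b" if b: "0 < b" "b < 1" for b
      using euler_integral_bounds_gt[OF p q 3 b, folded c_def C_def] 3 by (simp add: h_def)
    ultimately show ?thesis by blast
  next
    case 2
    define C1 where "C1 = 2 powr q * Beta p q + max 1 (2 powr (1 - p)) * (2 powr q / q)"
    define C2 where "C2 = max 1 (2 powr (1 - p))"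
    define k where "k = min 1 (2 powr (1 - p)) * 2 powr (- q)"
    have B: "Beta p q > 0" using p q by (rule Beta_real_pos)
    have k: "k > 0" by (simp add: k_def)
    have C12: "C1 > 0" "C2 > 0" using B q by (auto simp: C1_def C2_def less_max_iff_disj intro!: add_pos_pos mult_pos_pos)
    \<comment> \<open>Write 1 + L = (1 + ln 2) + (L - ln 2): the first part is controlled by E >=
      \<open>Beta p q\<close>, which matters for small b, the second by the logarithmic lower bound
      with constant k.\<close>
    define D where "D = (1 + ln 2) / Beta p q + 1 / k"
    have D: "D > 0" using B k ln_ge_zero[of 2] by (auto simp: D_def intro!: add_pos_pos divide_pos_pos add_pos_nonneg)
    have "1 / D * h b \<le> euler_integral p q r b \<and> euler_integral p q r b \<le> (C1 + C2) * h b" if b: "0 < b" "b < 1" for b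
    proof
      define L where "L = ln (1 / (1 - b))"
      have L: "L \<ge> 0" unfolding L_def using b by (intro ln_ge_zero) simp
      have h: "h b = 1 + L" using 2 by (simp add: h_def L_def)
      define E where "E = euler_integral p q r b"
      have "E \<le> C1 + C2 * L"
        using euler_integral_upper_eq[OF p q b] 2 by (simp add: C1_def C2_def L_def E_def algebra_simps)
      also have "\<dots> \<le> (C1 + C2) * (1 + L)" using C12 L by (simp add: algebra_simps)
      finally show "euler_integral p q r b \<le> (C1 + C2) * h b" by (simp add: h E_def)
      have E1: "Beta p q \<le> E"
        unfolding E_def
      proof (rule has_integral_le[OF has_integral_Beta_open[OF p q] has_integral_euler[OF p q b]])
        fix u :: real assume u: "u \<in> {0<..<1}"
        have pr: "0 < 1 - b * u" "1 - b * u \<le> 1" using one_minus_mult_bounds[of b 1 u] u b by auto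
        have "(1 - b * u) powr 0 \<le> (1 - b * u) powr (- r)"
          using pr 2 q by (intro powr_mono') auto
        then have "1 \<le> (1 - b * u) powr (- r)" using pr by simp
        then have "u powr (p - 1) * (1 - u) powr (q - 1) * 1 \<le> u powr (p - 1) * (1 - u) powr (q - 1) * (1 - b * u) powr (- r)"
          by (rule mult_left_mono) simp
        then show "u powr (p - 1) * (1 - u) powr (q - 1) \<le> euler_integrand p q r b u" by (simp add: euler_integrand_def)
      qed
      have E2: "L - ln 2 \<le> E / k"
      proof (cases "1/2 \<le> b")
        case True
        then have "k * (L - ln 2) \<le> E"
          using euler_integral_lower_eq[OF p q True b(2)] 2 by (simp add: k_def L_def E_def)
        then show ?thesis using k by (simp add: field_simps)
      next
        case False
        then have "L \<le> ln 2" unfolding L_def using b by (intro ln_mono) (auto simp: field_simps)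
        moreover have "0 \<le> E / k" using E1 B k by simp
        ultimately show ?thesis by linarith
      qed
      have "1 + ln 2 \<le> (1 + ln 2) * (E / Beta p q)"
      proof -
        have "1 \<le> E / Beta p q" using E1 B by simp
        then have "(1 + ln 2) * 1 \<le> (1 + ln 2) * (E / Beta p q)" by (intro mult_left_mono) auto
        then show ?thesis by simp
      qed
      then have "1 + L \<le> (1 + ln 2) * (E / Beta p q) + E / k" using E2 by linarith
      also have "\<dots> = D * E" by (simp add: D_def distrib_right)
      finally show "1 / D * h b \<le> euler_integral p q r b" using D by (simp add: h E_def field_simps)
    qed
    moreover have "1 / D > 0" "C1 + C2 > 0" using D C12 by auto
    ultimately show ?thesis by blast
  qed
qed

section \<open>Fractional integrals\<close>

lemma tonelli_has_bochner_integral_pair: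
  fixes f :: "real \<Rightarrow> real \<Rightarrow> real"
  assumes [measurable]: "case_prod f \<in> borel_measurable (lborel \<Otimes>\<^sub>M lborel)" and f0: "\<And>x y. 0 \<le> f x y"
    and g: "\<And>y. has_bochner_integral lborel (\<lambda>x. f x y) (g y)" and I: "has_bochner_integral lborel g I"
  shows "has_bochner_integral (lborel \<Otimes>\<^sub>M lborel) (case_prod f) I"
proof -
  have g0: "g y \<ge> 0" for y
    unfolding has_bochner_integral_integral_eq[OF g, symmetric] by (rule Bochner_Integration.integral_nonneg) (rule f0)
  have "(\<integral>\<^sup>+p. ennreal (case_prod f p) \<partial>(lborel \<Otimes>\<^sub>M lborel)) = (\<integral>\<^sup>+y. (\<integral>\<^sup>+x. ennreal (f x y) \<partial>lborel) \<partial>lborel)"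
    using lborel_pair.nn_integral_snd[of "\<lambda>p. ennreal (case_prod f p)"] by simp
  also have "\<dots> = (\<integral>\<^sup>+y. ennreal (g y) \<partial>lborel)"
    using g f0 by (intro nn_integral_cong) (auto simp: has_bochner_integral_iff nn_integral_eq_integral)
  also have "\<dots> = ennreal I"
    using I g0 by (auto simp: has_bochner_integral_iff nn_integral_eq_integral)
  finally have nn: "(\<integral>\<^sup>+p. ennreal (case_prod f p) \<partial>(lborel \<Otimes>\<^sub>M lborel)) = ennreal I" .
  have "I \<ge> 0"
    unfolding has_bochner_integral_integral_eq[OF I, symmetric] by (rule Bochner_Integration.integral_nonneg) (rule g0)
  then show ?thesis
    using nn f0 by (intro has_bochner_integral_nn_integral) auto
qed

text \<open>The order of integration that can be evaluated explicitly is x before y; nonnegativity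
  alone transfers its value to the other order.\<close>

lemma tonelli_has_bochner_integral:
  fixes f :: "real \<Rightarrow> real \<Rightarrow> real"
  assumes "case_prod f \<in> borel_measurable (lborel \<Otimes>\<^sub>M lborel)" and "\<And>x y. 0 \<le> f x y"
    and "\<And>y. has_bochner_integral lborel (\<lambda>x. f x y) (g y)" and "has_bochner_integral lborel g I"
  shows "has_bochner_integral lborel (\<lambda>x. \<integral>y. f x y \<partial>lborel) I"
  using tonelli_has_bochner_integral_pair[OF assms] lborel_pair.integrable_fst[of f] lborel_pair.integral_fst[of f]
  by (simp add: has_bochner_integral_iff)

text \<open>Since \<open>0 powr c = 0\<close> even for \<open>c \<le> 0\<close>, the integrand vanishes for \<open>u \<ge> a\<close>.\<close>
definition frac_integrand :: "real \<Rightarrow> real \<Rightarrow> real \<Rightarrow> real \<Rightarrow> real" where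
  "frac_integrand p c a u = max 0 (a - u) powr c * (u powr (p - 1) * (1 - u) powr (p - 1))"

definition frac_integral :: "real \<Rightarrow> real \<Rightarrow> real \<Rightarrow> real" where
  "frac_integral p c a = integral {0<..<1} (frac_integrand p c a)"

lemma frac_integrand_nonneg: "frac_integrand p c a u \<ge> 0"
  by (simp add: frac_integrand_def)

lemma frac_integrand_measurable [measurable]: "frac_integrand p c a \<in> borel_measurable borel"
  unfolding frac_integrand_def[abs_def] by measurable

text \<open>For a < 1 the integrand vanishes beyond u = a. Scaling u = a v makes (a - u)^c a power
  of 1 - v and leaves (1 - a v)^(p-1), so q = c + 1 and r = 1 - p.\<close>

lemma has_integral_frac_inside:
  assumes p: "p > 0" and c: "c > -1" and a: "0 < a" "a < 1"
  shows "(frac_integrand p c a has_integral (a powr (p + c) * euler_integral p (c + 1) (1 - p) a)) {0<..<1}"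
proof -
  have im: "(\<lambda>u. u / a) ` {0<..<a} = {0<..<1}"
  proof (intro equalityI subsetI)
    fix v :: real assume "v \<in> {0<..<1}"
    then show "v \<in> (\<lambda>u. u / a) ` {0<..<a}" using a by (intro image_eqI[of _ _ "a * v"]) auto
  qed (use a in auto)
  have "((\<lambda>u. \<bar>1 / a\<bar> * euler_integrand p (c + 1) (1 - p) a (u / a)) has_integral euler_integral p (c + 1) (1 - p) a) {0<..<a}"
  proof (rule has_integral_change_of_variables_nonneg[where g = "\<lambda>u. u / a" and g' = "\<lambda>_. 1 / a"])
    show "((\<lambda>u. u / a) has_real_derivative 1 / a) (at u within {0<..<a})" for u
      by (rule DERIV_cdivide[OF DERIV_ident])
    show "inj_on (\<lambda>u. u / a) {0<..<a}" using a by (auto intro!: inj_onI)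
    show "(euler_integrand p (c + 1) (1 - p) a has_integral euler_integral p (c + 1) (1 - p) a) ((\<lambda>u. u / a) ` {0<..<a})"
      unfolding im by (rule has_integral_euler) (use p c a in auto)
  qed (auto simp: euler_integrand_nonneg)
  then have "((\<lambda>u. a powr (p + c) * (\<bar>1 / a\<bar> * euler_integrand p (c + 1) (1 - p) a (u / a))) has_integral
     (a powr (p + c) * euler_integral p (c + 1) (1 - p) a)) {0<..<a}"
    by (rule has_integral_mult_right)
  then have "(frac_integrand p c a has_integral (a powr (p + c) * euler_integral p (c + 1) (1 - p) a)) {0<..<a}"
  proof (rule has_integral_eq[rotated])
    fix u assume u: "u \<in> {0<..<a}"
    have u0: "u > 0" "a - u > 0" using u by auto
    have e: "1 - u / a = (a - u) / a" "1 - a * (u / a) = 1 - u" "- (1 - p) = p - 1" using a by (auto simp: field_simps)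
    have "p + c = 1 + (p - 1) + c" by simp
    then have pc: "a powr (p + c) = a * a powr (p - 1) * a powr c" using a by (simp only: powr_add) simp
    show "a powr (p + c) * (\<bar>1 / a\<bar> * euler_integrand p (c + 1) (1 - p) a (u / a)) = frac_integrand p c a u"
      unfolding euler_integrand_def frac_integrand_def e pc using u0 a by (simp add: powr_divide)
  qed
  then show ?thesis
  proof -
    assume "(frac_integrand p c a has_integral (a powr (p + c) * euler_integral p (c + 1) (1 - p) a)) {0<..<a}"
    then have *: "((\<lambda>u. if u \<in> {0<..<a} then frac_integrand p c a u else 0) has_integral (a powr (p + c) * euler_integral p (c + 1) (1 - p) a)) UNIV"
      by (simp only: has_integral_restrict_UNIV)
    moreover have "(\<lambda>u. if u \<in> {0<..<a} then frac_integrand p c a u else 0) = (\<lambda>u. if u \<in> {0<..<1} then frac_integrand p c a u else 0)"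
      using a by (auto simp: frac_integrand_def max_def)
    ultimately show ?thesis by (simp only: has_integral_restrict_UNIV)
  qed
qed

text \<open>For a > 1 the truncation is inactive, and pulling a^c out of (a - u)^c leaves (1 -
  u/a)^c, so b = 1/a and r = -c.\<close>

lemma has_integral_frac_outside:
  assumes p: "p > 0" and a: "1 < a"
  shows "(frac_integrand p c a has_integral (a powr c * euler_integral p p (- c) (1 / a))) {0<..<1}"
proof (rule has_integral_eq[OF _ has_integral_mult_right[OF has_integral_euler[OF p p]]])
  fix u :: real assume u: "u \<in> {0<..<1}"
  have "1 - 1 / a * u = (a - u) / a" using a by (simp add: field_simps)
  then show "a powr c * euler_integrand p p (- c) (1 / a) u = frac_integrand p c a u"
    using u a by (simp add: euler_integrand_def frac_integrand_def powr_divide)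
qed (use a in auto)

lemma frac_integral_inside:
  assumes "p > 0" "c > -1" "0 < a" "a < 1"
  shows "frac_integral p c a = a powr (p + c) * euler_integral p (c + 1) (1 - p) a"
  unfolding frac_integral_def using has_integral_frac_inside[OF assms] by (rule integral_unique)

lemma frac_integral_outside:
  assumes "p > 0" "1 < a"
  shows "frac_integral p c a = a powr c * euler_integral p p (- c) (1 / a)"
  unfolding frac_integral_def using has_integral_frac_outside[OF assms] by (rule integral_unique)

text \<open>A positive exponent c keeps the first factor bounded, so the integral exists for every
  a, including the critical a = 1.\<close>

lemma has_integral_frac_nonneg:
  assumes p: "p > 0" and c: "c > 0"
  shows "(frac_integrand p c a has_integral frac_integral p c a) {0<..<1}"
proof -
  have "frac_integrand p c a absolutely_integrable_on {0<..<1}"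
  proof (rule measurable_bounded_by_integrable_imp_absolutely_integrable)
    show "frac_integrand p c a \<in> borel_measurable (lebesgue_on {0<..<1})"
      by (intro measurable_restrict_space1 measurable_completion) simp
    show "(\<lambda>u. max 0 a powr c * (u powr (p - 1) * (1 - u) powr (p - 1))) integrable_on {0<..<1}"
      using has_integral_mult_right[OF has_integral_Beta_open[OF p p]] by blast
    fix u :: real assume u: "u \<in> {0<..<1}"
    have "max 0 (a - u) powr c \<le> max 0 a powr c" using u c by (intro powr_mono2) auto
    then have "max 0 (a - u) powr c * (u powr (p - 1) * (1 - u) powr (p - 1)) \<le> max 0 a powr c * (u powr (p - 1) * (1 - u) powr (p - 1))"
      by (rule mult_right_mono) simp
    then show "norm (frac_integrand p c a u) \<le> max 0 a powr c * (u powr (p - 1) * (1 - u) powr (p - 1))"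
      by (simp add: frac_integrand_def)
  qed auto
  then have "frac_integrand p c a integrable_on {0<..<1}"
    by (rule set_lebesgue_integral_eq_integral(1))
  then show ?thesis unfolding frac_integral_def by (rule integrable_integral)
qed

lemma continuous_on_frac_integral_inside:
  assumes p: "p > 0" and c: "c > -1"
  shows "continuous_on {0<..<1} (frac_integral p c)"
proof -
  have "continuous_on {0<..<1} (\<lambda>a. a powr (p + c) * euler_integral p (c + 1) (1 - p) a)"
    by (intro continuous_on_mult continuous_on_powr continuous_on_id continuous_on_const continuous_on_euler_integral) (use p c in auto)
  then show ?thesis by (rule continuous_on_cong[THEN iffD1, rotated -1]) (simp_all add: frac_integral_inside p c)
qed

lemma continuous_on_frac_integral_outside:
  assumes p: "p > 0"
  shows "continuous_on {1<..} (frac_integral p c)"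
proof -
  have "continuous_on {1<..} (\<lambda>a. euler_integral p p (- c) (1 / a))"
    by (rule continuous_on_compose2[OF continuous_on_euler_integral[OF p p]])
       (auto intro!: continuous_on_divide continuous_on_const continuous_on_id)
  then have "continuous_on {1<..} (\<lambda>a. a powr c * euler_integral p p (- c) (1 / a))"
    by (intro continuous_on_mult continuous_on_powr continuous_on_id continuous_on_const) auto
  then show ?thesis by (rule continuous_on_cong[THEN iffD1, rotated -1]) (simp_all add: frac_integral_outside p)
qed

text \<open>For \<beta> < 1 the integrand is singular at b = u, but the antiderivative stays
  continuous there; the fundamental theorem applies with u as exceptional point.\<close>

lemma has_integral_max_powr:
  fixes u :: real
  assumes \<beta>: "\<beta> > 0" and a: "a1 \<le> a2"
  shows "((\<lambda>b. max 0 (b - u) powr (\<beta> - 1)) has_integral ((max 0 (a2 - u) powr \<beta> - max 0 (a1 - u) powr \<beta>) / \<beta>)) {a1..a2}"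
proof -
  define f where "f = (\<lambda>b. max 0 (b - u) powr \<beta> / \<beta>)"
  have "((\<lambda>b. max 0 (b - u) powr (\<beta> - 1)) has_integral (f a2 - f a1)) {a1..a2}"
  proof (rule fundamental_theorem_of_calculus_interior_strong[of "{u}"])
    show "continuous_on {a1..a2} f" unfolding f_def
      by (intro continuous_on_divide continuous_on_powr' continuous_on_max continuous_on_diff continuous_on_id continuous_on_const)
         (use \<beta> in auto)
    fix b assume "b \<in> {a1<..<a2} - {u}"
    then consider "b < u" | "u < b" by force
    then have "(f has_real_derivative max 0 (b - u) powr (\<beta> - 1)) (at b)"
    proof cases
      case 1
      have "((\<lambda>b. 0) has_real_derivative 0) (at b)" by simp
      then have "(f has_real_derivative 0) (at b)"
        by (rule has_field_derivative_transform_within_open[where S = "{..<u}"]) (use 1 in \<open>auto simp: f_def\<close>)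
      then show ?thesis using 1 by simp
    next
      case 2
      have "((\<lambda>b. (b - u) powr \<beta>) has_real_derivative \<beta> * (b - u) powr (\<beta> - 1) * 1) (at b)"
        by (rule DERIV_chain2[OF has_real_derivative_powr]) (use 2 in \<open>auto intro!: derivative_eq_intros\<close>)
      from DERIV_cdivide[OF this, of \<beta>]
      have "((\<lambda>b. (b - u) powr \<beta> / \<beta>) has_real_derivative (b - u) powr (\<beta> - 1)) (at b)"
        by (rule DERIV_cong) (use \<beta> in simp)
      then have "(f has_real_derivative (b - u) powr (\<beta> - 1)) (at b)"
        by (rule has_field_derivative_transform_within_open[where S = "{u<..}"]) (use 2 in \<open>auto simp: f_def\<close>)
      then show ?thesis using 2 by simp
    qed
    then show "(f has_vector_derivative max 0 (b - u) powr (\<beta> - 1)) (at b)"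
      by (simp add: has_real_derivative_iff_has_vector_derivative)
  qed (use a in auto)
  then show ?thesis by (simp add: f_def diff_divide_distrib)
qed

text \<open>The derivative formula in integrated form. Differentiating under the integral would meet
  the moving singularity at u = a when \<beta> < 1; integrating in b first and using Tonelli avoids
  it.\<close>

lemma frac_integral_diff:
  assumes p: "p > 0" and \<beta>: "\<beta> > 0" and a: "a1 \<le> a2"
    and int: "\<And>b. b \<in> {a1..a2} \<Longrightarrow> (frac_integrand p (\<beta> - 1) b has_integral frac_integral p (\<beta> - 1) b) {0<..<1}"
    and cont: "continuous_on {a1..a2} (frac_integral p (\<beta> - 1))"
  shows "frac_integral p \<beta> a2 - frac_integral p \<beta> a1 = \<beta> * integral {a1..a2} (frac_integral p (\<beta> - 1))"
proof -
  define f where "f = (\<lambda>b u. indicator {a1..a2} b * (indicator {0<..<1} u * frac_integrand p (\<beta> - 1) b u))"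
  define \<rho> where "\<rho> = (\<lambda>u. u powr (p - 1) * (1 - u) powr (p - 1))"
  define g where "g = (\<lambda>u. indicator {0<..<1} u * (\<rho> u * ((max 0 (a2 - u) powr \<beta> - max 0 (a1 - u) powr \<beta>) / \<beta>)))"
  have mono: "max 0 (a1 - u) powr \<beta> \<le> max 0 (a2 - u) powr \<beta>" for u
    using a \<beta> by (intro powr_mono2) auto
  have hb1: "has_bochner_integral lborel (\<lambda>b. f b u) (g u)" for u
  proof -
    have "has_bochner_integral lborel (\<lambda>b. indicator {a1..a2} b * max 0 (b - u) powr (\<beta> - 1))
       ((max 0 (a2 - u) powr \<beta> - max 0 (a1 - u) powr \<beta>) / \<beta>)"
      by (rule has_bochner_integral_of_nonneg[OF _ _ _ has_integral_max_powr[OF \<beta> a]]) auto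
    from has_bochner_integral_mult_right[OF this, of "indicator {0<..<1} u * \<rho> u"]
    show ?thesis by (simp add: f_def g_def frac_integrand_def \<rho>_def mult_ac)
  qed
  have hb2: "has_bochner_integral lborel g ((frac_integral p \<beta> a2 - frac_integral p \<beta> a1) / \<beta>)"
    unfolding g_def
  proof (rule has_bochner_integral_of_nonneg)
    show "0 \<le> \<rho> u * ((max 0 (a2 - u) powr \<beta> - max 0 (a1 - u) powr \<beta>) / \<beta>)" for u
      using mono[of u] \<beta> by (intro mult_nonneg_nonneg divide_nonneg_pos) (auto simp: \<rho>_def)
    have "((\<lambda>u. (frac_integrand p \<beta> a2 u - frac_integrand p \<beta> a1 u) / \<beta>) has_integral ((frac_integral p \<beta> a2 - frac_integral p \<beta> a1) / \<beta>)) {0<..<1}"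
      by (intro has_integral_divide has_integral_diff has_integral_frac_nonneg p \<beta>)
    then show "((\<lambda>u. \<rho> u * ((max 0 (a2 - u) powr \<beta> - max 0 (a1 - u) powr \<beta>) / \<beta>)) has_integral ((frac_integral p \<beta> a2 - frac_integral p \<beta> a1) / \<beta>)) {0<..<1}"
      by (simp add: frac_integrand_def \<rho>_def algebra_simps)
  qed (auto simp: \<rho>_def)
  have meas: "case_prod f \<in> borel_measurable (lborel \<Otimes>\<^sub>M lborel)"
    unfolding f_def frac_integrand_def case_prod_unfold by measurable
  have "has_bochner_integral lborel (\<lambda>b. \<integral>u. f b u \<partial>lborel) ((frac_integral p \<beta> a2 - frac_integral p \<beta> a1) / \<beta>)"
    using meas _ hb1 hb2 by (rule tonelli_has_bochner_integral) (auto simp: f_def frac_integrand_nonneg)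
  moreover have "(\<integral>u. f b u \<partial>lborel) = indicator {a1..a2} b * frac_integral p (\<beta> - 1) b" for b
  proof (cases "b \<in> {a1..a2}")
    case True
    have "has_bochner_integral lborel (\<lambda>u. indicator {0<..<1} u * frac_integrand p (\<beta> - 1) b u) (frac_integral p (\<beta> - 1) b)"
      by (rule has_bochner_integral_of_nonneg[OF _ _ _ int[OF True]]) (auto simp: frac_integrand_nonneg)
    then show ?thesis using True by (simp add: f_def has_bochner_integral_iff)
  qed (simp add: f_def)
  ultimately have "has_bochner_integral lborel (\<lambda>b. indicator {a1..a2} b * frac_integral p (\<beta> - 1) b) ((frac_integral p \<beta> a2 - frac_integral p \<beta> a1) / \<beta>)"
    by simp
  then have i: "(LINT b:{a1..a2}|lborel. frac_integral p (\<beta> - 1) b) = (frac_integral p \<beta> a2 - frac_integral p \<beta> a1) / \<beta>"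
    and si: "set_integrable lborel {a1..a2} (frac_integral p (\<beta> - 1))"
    by (simp_all add: has_bochner_integral_iff set_lebesgue_integral_def set_integrable_def)
  show ?thesis using set_borel_integral_eq_integral(2)[OF si] i \<beta> by (simp add: field_simps)
qed

lemma frac_integral_derivative:
  assumes p: "p > 0" and \<beta>: "\<beta> > 0" and a: "a > 0" "a \<noteq> 1"
  shows "(frac_integral p \<beta> has_real_derivative \<beta> * frac_integral p (\<beta> - 1) a) (at a)"
proof -
  \<comment> \<open>The window around a must stay on one side of 1, where
    \<open>frac_integral p (\<beta> - 1)\<close> is an Euler integral and therefore
    continuous.\<close>
  have "\<exists>a1 a2. a1 < a \<and> a < a2 \<and> (\<forall>b\<in>{a1..a2}. (frac_integrand p (\<beta> - 1) b has_integral frac_integral p (\<beta> - 1) b) {0<..<1})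
     \<and> continuous_on {a1..a2} (frac_integral p (\<beta> - 1))"
  proof (cases "a < 1")
    case True
    have "continuous_on {a / 2..(a + 1) / 2} (frac_integral p (\<beta> - 1))"
      by (rule continuous_on_subset[OF continuous_on_frac_integral_inside]) (use p \<beta> a True in auto)
    moreover have "\<forall>b\<in>{a / 2..(a + 1) / 2}. (frac_integrand p (\<beta> - 1) b has_integral frac_integral p (\<beta> - 1) b) {0<..<1}"
    proof
      fix b assume b: "b \<in> {a / 2..(a + 1) / 2}"
      have "0 < a / 2" "(a + 1) / 2 < 1" using a True by auto
      then have "0 < b" "b < 1" using b by auto
      then show "(frac_integrand p (\<beta> - 1) b has_integral frac_integral p (\<beta> - 1) b) {0<..<1}"
        using has_integral_frac_inside[OF p, of "\<beta> - 1" b] frac_integral_inside[OF p, of "\<beta> - 1" b] \<beta> by simp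
    qed
    ultimately show ?thesis using a True by (intro exI[of _ "a / 2"] exI[of _ "(a + 1) / 2"]) auto
  next
    case False
    then have a1: "a > 1" using a by simp
    have "continuous_on {(a + 1) / 2..a + 1} (frac_integral p (\<beta> - 1))"
      by (rule continuous_on_subset[OF continuous_on_frac_integral_outside]) (use p a1 in auto)
    moreover have "\<forall>b\<in>{(a + 1) / 2..a + 1}. (frac_integrand p (\<beta> - 1) b has_integral frac_integral p (\<beta> - 1) b) {0<..<1}"
    proof
      fix b assume b: "b \<in> {(a + 1) / 2..a + 1}"
      have "1 < (a + 1) / 2" using a1 by auto
      then have "1 < b" using b by auto
      then show "(frac_integrand p (\<beta> - 1) b has_integral frac_integral p (\<beta> - 1) b) {0<..<1}"
        using has_integral_frac_outside[OF p, of b "\<beta> - 1"] frac_integral_outside[OF p, of b "\<beta> - 1"] by simp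
    qed
    ultimately show ?thesis using a1 by (intro exI[of _ "(a + 1) / 2"] exI[of _ "a + 1"]) auto
  qed
  then obtain a1 a2 where a12: "a1 < a" "a < a2"
    and int: "\<And>b. b \<in> {a1..a2} \<Longrightarrow> (frac_integrand p (\<beta> - 1) b has_integral frac_integral p (\<beta> - 1) b) {0<..<1}"
    and cont: "continuous_on {a1..a2} (frac_integral p (\<beta> - 1))" by blast
  have eq: "frac_integral p \<beta> a1 + \<beta> * integral {a1..t} (frac_integral p (\<beta> - 1)) = frac_integral p \<beta> t" if "t \<in> {a1<..<a2}" for t
  proof -
    have "frac_integral p \<beta> t - frac_integral p \<beta> a1 = \<beta> * integral {a1..t} (frac_integral p (\<beta> - 1))"
      using that by (intro frac_integral_diff p \<beta> int continuous_on_subset[OF cont]) auto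
    then show ?thesis by simp
  qed
  have "((\<lambda>t. integral {a1..t} (frac_integral p (\<beta> - 1))) has_real_derivative frac_integral p (\<beta> - 1) a) (at a within {a1..a2})"
    using a12 by (intro integral_has_real_derivative cont) auto
  then have "((\<lambda>t. integral {a1..t} (frac_integral p (\<beta> - 1))) has_real_derivative frac_integral p (\<beta> - 1) a) (at a within {a1<..<a2})"
    by (rule DERIV_subset) auto
  then have "((\<lambda>t. integral {a1..t} (frac_integral p (\<beta> - 1))) has_real_derivative frac_integral p (\<beta> - 1) a) (at a)"
    using a12 by (subst (asm) at_within_open) auto
  then have "((\<lambda>t. frac_integral p \<beta> a1 + \<beta> * integral {a1..t} (frac_integral p (\<beta> - 1))) has_real_derivative \<beta> * frac_integral p (\<beta> - 1) a) (at a)"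
    using DERIV_add[OF DERIV_const DERIV_cmult] by fastforce
  then show ?thesis
    by (rule has_field_derivative_transform_within_open[where S = "{a1<..<a2}"]) (use a12 eq in auto)
qed

text \<open>The factor after \<open>exp (- s * T)\<close> is the integral of \<open>(T - w(u))\<^sub>+\<^bsup>\<beta>\<^esup> (u (1 - u))\<^bsup>p - 1\<^esup>\<close> with
  \<open>w(u) = (x - z)\<^sup>2 + 4 x z u\<close>.\<close>
lemma laplace_frac_integral:
  assumes p: "p > 0" and \<beta>: "\<beta> > 0" and s: "s > 0" and xz: "x > 0" "z > 0"
  shows "has_bochner_integral lborel
     (\<lambda>T. indicator {0<..} T * (exp (- s * T) * ((4 * x * z) powr \<beta> * frac_integral p \<beta> ((T - (x - z)\<^sup>2) / (4 * x * z)))))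
     (Gamma (\<beta> + 1) / s powr (\<beta> + 1) * (exp (- s * (x\<^sup>2 + z\<^sup>2)) * (Beta p p * Gamma (p + 1/2) * bc (p - 1/2) ((s * x * z)\<^sup>2))))"
proof -
  define w where "w = (\<lambda>u. (x - z)\<^sup>2 + 4 * x * z * u)"
  define \<rho> where "\<rho> = (\<lambda>u. u powr (p - 1) * (1 - u) powr (p - 1))"
  define f where "f = (\<lambda>T u. (indicator {0<..} T * exp (- s * T) * max 0 (T - w u) powr \<beta>) * (indicator {0<..<1} u * \<rho> u))"
  define g where "g = (\<lambda>u. Gamma (\<beta> + 1) / s powr (\<beta> + 1) * exp (- s * w u) * (indicator {0<..<1} u * \<rho> u))"
  have hb1: "has_bochner_integral lborel (\<lambda>T. f T u) (g u)" for u
  proof (cases "u \<in> {0<..<1}")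
    case True
    \<comment> \<open>Thus T > w u already forces T > 0, and the inner integral is a full Gamma
      integral shifted by w u.\<close>
    have w0: "w u \<ge> 0" using True xz by (simp add: w_def)
    have im: "(\<lambda>T. T - w u) ` {w u<..} = {0<..}"
    proof (intro equalityI subsetI)
      fix v :: real assume "v \<in> {0<..}"
      then show "v \<in> (\<lambda>T. T - w u) ` {w u<..}" by (intro image_eqI[of _ _ "v + w u"]) auto
    qed auto
    have "((\<lambda>T. \<bar>1\<bar> * ((T - w u) powr (\<beta> + 1 - 1) * exp (- s * (T - w u)))) has_integral (Gamma (\<beta> + 1) / s powr (\<beta> + 1))) {w u<..}"
    proof (rule has_integral_change_of_variables_nonneg[where g = "\<lambda>T. T - w u" and g' = "\<lambda>_. 1" and f = "\<lambda>t. t powr (\<beta> + 1 - 1) * exp (- s * t)"])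
      show "((\<lambda>T. T - w u) has_real_derivative 1) (at T within {w u<..})" for T by (auto intro!: derivative_eq_intros)
      show "((\<lambda>t. t powr (\<beta> + 1 - 1) * exp (- s * t)) has_integral (Gamma (\<beta> + 1) / s powr (\<beta> + 1))) ((\<lambda>T. T - w u) ` {w u<..})"
        unfolding im by (rule gamma_moment) (use \<beta> s in auto)
    qed auto
    then have "((\<lambda>T. (T - w u) powr \<beta> * exp (- s * (T - w u))) has_integral (Gamma (\<beta> + 1) / s powr (\<beta> + 1))) {w u<..}"
      by simp
    then have "has_bochner_integral lborel (\<lambda>T. indicator {w u<..} T * ((T - w u) powr \<beta> * exp (- s * (T - w u)))) (Gamma (\<beta> + 1) / s powr (\<beta> + 1))"
      by (intro has_bochner_integral_of_nonneg) auto
    from has_bochner_integral_mult_right[OF this, of "exp (- s * w u) * \<rho> u"]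
    have "has_bochner_integral lborel (\<lambda>T. exp (- s * w u) * \<rho> u * (indicator {w u<..} T * ((T - w u) powr \<beta> * exp (- s * (T - w u))))) (g u)"
      using True by (simp add: g_def mult_ac)
    moreover have "exp (- s * w u) * \<rho> u * (indicator {w u<..} T * ((T - w u) powr \<beta> * exp (- s * (T - w u)))) = f T u" for T
    proof (cases "w u < T")
      case T: True
      have "exp (- s * T) = exp (- s * w u) * exp (- s * (T - w u))"
        by (simp add: algebra_simps flip: exp_add)
      then show ?thesis using T w0 True by (simp add: f_def)
    qed (use True in \<open>simp add: f_def\<close>)
    ultimately show ?thesis by simp
  next
    case False
    then show ?thesis by (simp add: f_def g_def has_bochner_integral_zero)
  qed
  have hb2: "has_bochner_integral lborel g (Gamma (\<beta> + 1) / s powr (\<beta> + 1) * (exp (- s * (x\<^sup>2 + z\<^sup>2)) * (Beta p p * Gamma (p + 1/2) * bc (p - 1/2) ((s * x * z)\<^sup>2))))"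
  proof -
    have "(2 * s * x * z)\<^sup>2 / 4 = (s * x * z)\<^sup>2" by (simp add: power_mult_distrib)
    with has_bochner_integral_mult_right[OF poisson_bc[OF p, of "2 * s * x * z"], of "Gamma (\<beta> + 1) / s powr (\<beta> + 1) * exp (- s * (x\<^sup>2 + z\<^sup>2))"]
    have "has_bochner_integral lborel (\<lambda>u. Gamma (\<beta> + 1) / s powr (\<beta> + 1) * exp (- s * (x\<^sup>2 + z\<^sup>2)) * (indicator {0..1} u * (exp (2 * s * x * z * (1 - 2 * u)) * \<rho> u)))
      (Gamma (\<beta> + 1) / s powr (\<beta> + 1) * exp (- s * (x\<^sup>2 + z\<^sup>2)) * (Beta p p * Gamma (p + 1/2) * bc (p - 1/2) ((s * x * z)\<^sup>2)))"
      by (simp add: \<rho>_def)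
    moreover have "Gamma (\<beta> + 1) / s powr (\<beta> + 1) * exp (- s * (x\<^sup>2 + z\<^sup>2)) * (indicator {0..1} u * (exp (2 * s * x * z * (1 - 2 * u)) * \<rho> u)) = g u" for u
    proof -
      \<comment> \<open>This identity ties the kernel to Poisson's integral with parameter 2 s x
        z.\<close>
      have "- s * w u = - s * (x\<^sup>2 + z\<^sup>2) + 2 * s * x * z * (1 - 2 * u)"
        by (simp add: w_def power2_eq_square algebra_simps)
      then have "exp (- s * w u) = exp (- s * (x\<^sup>2 + z\<^sup>2)) * exp (2 * s * x * z * (1 - 2 * u))"
        by (simp only: exp_add)
      \<comment> \<open>\<open>0 powr c = 0\<close> makes the weight vanish at both endpoints, so
        closed and open intervals agree pointwise.\<close>
      moreover have "indicator {0..1} u * \<rho> u = indicator {0<..<1} u * \<rho> u"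
        by (auto simp: indicator_def \<rho>_def)
      ultimately show ?thesis by (auto simp: g_def mult_ac)
    qed
    ultimately show ?thesis by (simp add: mult.assoc)
  qed
  have meas: "case_prod f \<in> borel_measurable (lborel \<Otimes>\<^sub>M lborel)"
    unfolding f_def \<rho>_def w_def case_prod_unfold by measurable
  have "has_bochner_integral lborel (\<lambda>T. \<integral>u. f T u \<partial>lborel) (Gamma (\<beta> + 1) / s powr (\<beta> + 1) * (exp (- s * (x\<^sup>2 + z\<^sup>2)) * (Beta p p * Gamma (p + 1/2) * bc (p - 1/2) ((s * x * z)\<^sup>2))))"
    using meas _ hb1 hb2 by (rule tonelli_has_bochner_integral) (auto simp: f_def \<rho>_def)
  moreover have "(\<integral>u. f T u \<partial>lborel) = indicator {0<..} T * (exp (- s * T) * ((4 * x * z) powr \<beta> * frac_integral p \<beta> ((T - (x - z)\<^sup>2) / (4 * x * z))))" for T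
  proof -
    define a where "a = (T - (x - z)\<^sup>2) / (4 * x * z)"
    have hb: "has_bochner_integral lborel (\<lambda>u. indicator {0<..<1} u * frac_integrand p \<beta> a u) (frac_integral p \<beta> a)"
      by (rule has_bochner_integral_of_nonneg[OF _ _ _ has_integral_frac_nonneg[OF p \<beta>]]) (auto simp: frac_integrand_nonneg)
    have "max 0 (T - w u) powr \<beta> = (4 * x * z) powr \<beta> * max 0 (a - u) powr \<beta>" for u
    proof -
      have "T - w u = 4 * x * z * (a - u)" using xz by (simp add: w_def a_def field_simps)
      then have "max 0 (T - w u) = 4 * x * z * max 0 (a - u)"
        using xz by (simp add: max_def zero_le_mult_iff mult_le_0_iff)
      then show ?thesis using xz by (simp add: powr_mult)
    qed
    then have "f T u = (indicator {0<..} T * (exp (- s * T) * (4 * x * z) powr \<beta>)) * (indicator {0<..<1} u * frac_integrand p \<beta> a u)" for u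
      by (simp add: f_def frac_integrand_def \<rho>_def mult_ac)
    then have "(\<integral>u. f T u \<partial>lborel) = (indicator {0<..} T * (exp (- s * T) * (4 * x * z) powr \<beta>)) * (\<integral>u. indicator {0<..<1} u * frac_integrand p \<beta> a u \<partial>lborel)"
      by (simp only:) (rule integral_mult_right_zero)
    then show ?thesis using hb by (simp add: has_bochner_integral_iff a_def mult_ac)
  qed
  ultimately show ?thesis by simp
qed

section \<open>The kernel\<close>

lemma fubini_has_bochner_integral:
  fixes f F :: "real \<Rightarrow> real \<Rightarrow> real"
  assumes f[measurable]: "case_prod f \<in> borel_measurable (lborel \<Otimes>\<^sub>M lborel)"
    and F: "integrable (lborel \<Otimes>\<^sub>M lborel) (case_prod F)" "\<And>x y. \<bar>f x y\<bar> \<le> F x y"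
    and g: "\<And>y. has_bochner_integral lborel (\<lambda>x. f x y) (g y)" and I: "has_bochner_integral lborel g I"
  shows "has_bochner_integral lborel (\<lambda>x. \<integral>y. f x y \<partial>lborel) I"
proof -
  have int: "integrable (lborel \<Otimes>\<^sub>M lborel) (case_prod f)"
  proof (rule Bochner_Integration.integrable_bound[OF F(1) f], rule AE_I2)
    fix q show "norm (case_prod f q) \<le> norm (case_prod F q)"
      using F(2)[of "fst q" "snd q"] by (simp add: case_prod_unfold)
  qed
  have "(\<integral>x. (\<integral>y. f x y \<partial>lborel) \<partial>lborel) = (\<integral>y. (\<integral>x. f x y \<partial>lborel) \<partial>lborel)"
    using lborel_pair.Fubini_integral[OF int] by simp
  also have "\<dots> = I" using I by (simp add: has_bochner_integral_integral_eq[OF g] has_bochner_integral_iff)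
  finally show ?thesis
    using lborel_pair.integrable_fst[OF int] by (simp add: has_bochner_integral_iff)
qed

text \<open>Each summand is a power of T times a function of y, so integrability in the plane
  reduces to single integrals. For y <= 1 the Bessel factors are merely bounded; beyond 1 their
  decay is used, where the powers coming from order \<alpha> cancel y^(2\<alpha>+1).\<close>

definition Kint_majorant :: "real \<Rightarrow> real \<Rightarrow> real \<Rightarrow> real" where
  "Kint_majorant \<nu> T y = T powr \<nu> * indicator {0<..1} y + T powr (\<nu> / 2 - 1/4) * (indicator {1..} y * y powr (- \<nu> - 1/2))"

lemma Kint_bound:
  assumes \<nu>: "\<nu> > -1/2" and \<alpha>: "\<alpha> > -1/2" and xz: "x > 0" "z > 0"
  shows "\<exists>C>0. \<forall>T>0. \<forall>y>0. \<bar>Kint \<nu> \<alpha> x z T y\<bar> \<le>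
    C * Kint_majorant \<nu> T y"
proof -
  obtain C1 where C1: "C1 > 0" "\<And>s. s > 0 \<Longrightarrow> \<bar>bc \<nu> (- (s\<^sup>2) / 4)\<bar> \<le> C1"
     "\<And>s. s > 0 \<Longrightarrow> \<bar>bc \<nu> (- (s\<^sup>2) / 4)\<bar> \<le> C1 * s powr (- \<nu> - 1/2)"
    using bc_bounds[OF \<nu>] by blast
  obtain C2 where C2: "C2 > 0" "\<And>s. s > 0 \<Longrightarrow> \<bar>bc \<alpha> (- (s\<^sup>2) / 4)\<bar> \<le> C2"
     "\<And>s. s > 0 \<Longrightarrow> \<bar>bc \<alpha> (- (s\<^sup>2) / 4)\<bar> \<le> C2 * s powr (- \<alpha> - 1/2)"
    using bc_bounds[OF \<alpha>] by blast
  define k where "k = x powr (- \<alpha> - 1/2) * z powr (- \<alpha> - 1/2)"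
  have k0: "k > 0" using xz by (simp add: k_def)
  define C where "C = C1 * C2 * C2 * (1 + k)"
  have C0: "C > 0" using C1 C2 k0 by (simp add: C_def add_pos_pos)
  have "\<bar>Kint \<nu> \<alpha> x z T y\<bar> \<le>
    C * Kint_majorant \<nu> T y" if T: "T > 0" and y: "y > 0" for T y
  proof -
    define e where "e = - \<alpha> - 1/2"
    have abs: "\<bar>Kint \<nu> \<alpha> x z T y\<bar> = T powr \<nu> * \<bar>bc \<nu> (- ((sqrt T * y)\<^sup>2) / 4)\<bar> * \<bar>bc \<alpha> (- ((x * y)\<^sup>2) / 4)\<bar> * \<bar>bc \<alpha> (- ((z * y)\<^sup>2) / 4)\<bar> * y powr (2 * \<alpha> + 1)"
      using T by (simp add: Kint_def abs_mult power_mult_distrib)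
    have pos: "sqrt T * y > 0" "x * y > 0" "z * y > 0" using T y xz by auto
    show ?thesis
    proof (cases "y \<le> 1")
      case True
      have "y powr (2 * \<alpha> + 1) \<le> 1 powr (2 * \<alpha> + 1)" using True y \<alpha> by (intro powr_mono2) auto
      then have "\<bar>Kint \<nu> \<alpha> x z T y\<bar> \<le> T powr \<nu> * C1 * C2 * C2 * 1"
        unfolding abs using C1(2)[OF pos(1)] C2(2)[OF pos(2)] C2(2)[OF pos(3)] C1(1) C2(1)
        by (intro mult_mono mult_nonneg_nonneg) auto
      also have "\<dots> = (C1 * C2 * C2) * T powr \<nu>" by simp
      also have "\<dots> \<le> C * T powr \<nu>"
        using C1(1) C2(1) k0 by (intro mult_right_mono) (auto simp: C_def algebra_simps)
      also have "\<dots> \<le> C * Kint_majorant \<nu> T y"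
        using True y C0 by (intro mult_left_mono) (auto simp: Kint_majorant_def indicator_def)
      finally show ?thesis .
    next
      case False
      have "\<bar>Kint \<nu> \<alpha> x z T y\<bar> \<le> T powr \<nu> * (C1 * (sqrt T * y) powr (- \<nu> - 1/2)) * (C2 * (x * y) powr e) * (C2 * (z * y) powr e) * y powr (2 * \<alpha> + 1)"
        unfolding abs e_def using C1(3)[OF pos(1)] C2(3)[OF pos(2)] C2(3)[OF pos(3)] C1(1) C2(1)
        by (intro mult_mono mult_nonneg_nonneg) auto
      also have "\<dots> = (C1 * C2 * C2 * k) * (T powr \<nu> * sqrt T powr (- \<nu> - 1/2)) * (y powr (- \<nu> - 1/2) * (y powr e * y powr e * y powr (2 * \<alpha> + 1)))"
        using T y xz by (simp add: powr_mult k_def e_def)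
      also have "y powr e * y powr e * y powr (2 * \<alpha> + 1) = 1"
        using y by (simp add: e_def flip: powr_add)
      also have "T powr \<nu> * sqrt T powr (- \<nu> - 1/2) = T powr (\<nu> / 2 - 1/4)"
      proof -
        have "sqrt T powr (- \<nu> - 1/2) = T powr (1/2 * (- \<nu> - 1/2))"
          using T by (simp add: powr_half_sqrt[symmetric] powr_powr)
        also have "T powr \<nu> * \<dots> = T powr (\<nu> + 1/2 * (- \<nu> - 1/2))" by (rule powr_add[symmetric])
        also have "\<nu> + 1/2 * (- \<nu> - 1/2) = \<nu> / 2 - 1/4" by (simp add: field_simps)
        finally show ?thesis .
      qed
      also have "C1 * C2 * C2 * k * T powr (\<nu> / 2 - 1/4) * (y powr (- \<nu> - 1/2) * 1) \<le> C * T powr (\<nu> / 2 - 1/4) * (y powr (- \<nu> - 1/2) * 1)"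
        using C1(1) C2(1) k0 by (intro mult_right_mono) (auto simp: C_def)
      also have "\<dots> = C * Kint_majorant \<nu> T y"
        using False by (simp add: Kint_majorant_def)
      finally show ?thesis .
    qed
  qed
  with C0 show ?thesis by blast
qed

lemma integrable_powr_tail:
  fixes \<nu> :: real
  assumes "\<nu> > 1/2"
  shows "integrable lborel (\<lambda>y. indicator {1..} y * y powr (- \<nu> - 1/2))"
  using has_bochner_integral_of_nonneg[OF _ _ _ has_integral_powr_to_inf[of "- \<nu> - 1/2" 1]] assms
  by (auto simp: has_bochner_integral_iff)

lemma integrable_Kint:
  assumes \<nu>: "\<nu> > 1/2" and \<alpha>: "\<alpha> > -1/2" and xz: "x > 0" "z > 0" and T: "T > 0"
  shows "set_integrable lborel {0..} (Kint \<nu> \<alpha> x z T)"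
  unfolding set_integrable_def
proof -
  obtain C where C: "C > 0" "\<And>y. y > 0 \<Longrightarrow> \<bar>Kint \<nu> \<alpha> x z T y\<bar> \<le>
    C * Kint_majorant \<nu> T y"
    using Kint_bound[OF _ \<alpha> xz, of \<nu>] \<nu> T by auto
  show "integrable lborel (\<lambda>y. indicator {0..} y *\<^sub>R Kint \<nu> \<alpha> x z T y)"
  proof (rule Bochner_Integration.integrable_bound)
    show "integrable lborel (\<lambda>y. C * Kint_majorant \<nu> T y)"
      unfolding Kint_majorant_def
      by (intro integrable_mult_right Bochner_Integration.integrable_add integrable_powr_tail \<nu>) simp
    show "(\<lambda>y. indicator {0..} y *\<^sub>R Kint \<nu> \<alpha> x z T y) \<in> borel_measurable lborel"
      unfolding Kint_def by measurable
    show "AE y in lborel. norm (indicator {0..} y *\<^sub>R Kint \<nu> \<alpha> x z T y) \<le> norm (C * Kint_majorant \<nu> T y)"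
    proof (rule AE_I2)
      fix y :: real
      consider "y > 0" | "y = 0" | "y < 0" by linarith
      then show "norm (indicator {0..} y *\<^sub>R Kint \<nu> \<alpha> x z T y) \<le> norm (C * Kint_majorant \<nu> T y)"
      proof cases
        case 1
        then show ?thesis using C(2)[OF 1] by (simp add: order_trans[OF _ abs_ge_self])
      next
        case 2
        then show ?thesis by (simp add: Kint_def)
      qed simp
    qed
  qed
qed

lemma Kint_limit_integrable:
  assumes "\<nu> > 1/2" "\<alpha> > -1/2" "x > 0" "z > 0" "T > 0"
  shows "((\<lambda>R. integral {0..R} (Kint \<nu> \<alpha> x z T)) \<longlongrightarrow> (LBINT y:{0..}. Kint \<nu> \<alpha> x z T y)) at_top"
proof -
  note si = integrable_Kint[OF assms]
  have "((\<lambda>R. LBINT y:{0..R}. Kint \<nu> \<alpha> x z T y) \<longlongrightarrow> (LBINT y:{0..}. Kint \<nu> \<alpha> x z T y)) at_top"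
    by (rule tendsto_set_lebesgue_integral_at_top[OF _ si]) simp
  moreover have "(LBINT y:{0..R}. Kint \<nu> \<alpha> x z T y) = integral {0..R} (Kint \<nu> \<alpha> x z T)" for R
    by (intro set_borel_integral_eq_integral set_integrable_subset[OF si]) auto
  ultimately show ?thesis by simp
qed

text \<open>Integrating in T first turns the factor of order \<nu> into s^(-\<nu>-1) exp(-y^2/(4s)),
  the Gaussian of \<open>weber_bc_bc\<close>. Fubini rests on the separable majorant, whose tail
  y^(-\<nu>-1/2) is integrable because \<nu> > 1/2.\<close>

lemma laplace_Kint:
  assumes \<nu>: "\<nu> > 1/2" and \<alpha>: "\<alpha> > -1/2" and xz: "x > 0" "z > 0" and s: "s > 0"
  shows "has_bochner_integral lborel (\<lambda>T. indicator {0<..} T * (exp (- s * T) * (LBINT y:{0..}. Kint \<nu> \<alpha> x z T y)))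
    (s powr (- \<nu> - 1) * ((4 * s) powr (\<alpha> + 1) / 2 * (exp (- s * (x\<^sup>2 + z\<^sup>2)) * bc \<alpha> ((s * x * z)\<^sup>2))))"
proof -
  obtain C where C: "C > 0" "\<And>T y. T > 0 \<Longrightarrow> y > 0 \<Longrightarrow> \<bar>Kint \<nu> \<alpha> x z T y\<bar> \<le>
    C * Kint_majorant \<nu> T y"
    using Kint_bound[OF _ \<alpha> xz, of \<nu>] \<nu> by auto
  define f where "f = (\<lambda>T y. indicator {0<..} T * (exp (- s * T) * (indicator {0<..} y * Kint \<nu> \<alpha> x z T y)))"
  define m where "m = (\<lambda>a T. indicator {0<..} T * (T powr (a - 1) * exp (- s * T)))"
  define F1 where "F1 = (\<lambda>T y. m (\<nu> + 1) T * indicator {0<..1::real} y)"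
  define F2 where "F2 = (\<lambda>T y. m (\<nu> / 2 - 1/4 + 1) T * (indicator {1..} y * y powr (- \<nu> - 1/2)))"
  have m: "has_bochner_integral lborel (m a) (Gamma a / s powr a)" if "a > 0" for a
    unfolding m_def by (rule has_bochner_integral_of_nonneg[OF _ _ _ gamma_moment[OF that s]]) auto
  have m0: "m a T \<ge> 0" for a T by (simp add: m_def)
  have prod: "integrable (lborel \<Otimes>\<^sub>M lborel) (\<lambda>(T, y). m a T * v y)" if a: "a > 0" and v: "integrable lborel v" "\<And>y. v y \<ge> 0" for a and v :: "real \<Rightarrow> real"
  proof -
    have [measurable]: "v \<in> borel_measurable borel" using borel_measurable_integrable[OF v(1)] by simp
    have meas: "(\<lambda>(T, y). m a T * v y) \<in> borel_measurable (lborel \<Otimes>\<^sub>M lborel)"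
      unfolding m_def case_prod_unfold by measurable
    have "has_bochner_integral (lborel \<Otimes>\<^sub>M lborel) (\<lambda>(T, y). m a T * v y) (Gamma a / s powr a * integral\<^sup>L lborel v)"
    proof (rule tonelli_has_bochner_integral_pair[where f = "\<lambda>T y. m a T * v y", OF meas])
      show "has_bochner_integral lborel (\<lambda>T. m a T * v y) (Gamma a / s powr a * v y)" for y
        by (intro has_bochner_integral_mult_left m a)
      show "has_bochner_integral lborel (\<lambda>y. Gamma a / s powr a * v y) (Gamma a / s powr a * integral\<^sup>L lborel v)"
        using v by (intro has_bochner_integral_mult_right has_bochner_integral_integrable)
    qed (use m0 v in auto)
    then show ?thesis by (simp add: has_bochner_integral_iff)
  qed
  have "integrable (lborel \<Otimes>\<^sub>M lborel) (case_prod F1)"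
    unfolding F1_def by (rule prod) (use \<nu> in auto)
  moreover have "integrable (lborel \<Otimes>\<^sub>M lborel) (case_prod F2)"
    unfolding F2_def by (rule prod[OF _ integrable_powr_tail[OF \<nu>]]) (use \<nu> in auto)
  ultimately have "integrable (lborel \<Otimes>\<^sub>M lborel) (\<lambda>p. C * (case_prod F1 p + case_prod F2 p))" by simp
  then have F: "integrable (lborel \<Otimes>\<^sub>M lborel) (\<lambda>(T, y). C * (F1 T y + F2 T y))"
    by (simp add: case_prod_unfold)
  have meas: "case_prod f \<in> borel_measurable (lborel \<Otimes>\<^sub>M lborel)"
    unfolding f_def Kint_def case_prod_unfold by measurable
  define g where "g = (\<lambda>y. s powr (- \<nu> - 1) * (indicator {0<..} y *
      (exp (- (y\<^sup>2) / (4 * s)) * (bc \<alpha> (- ((x * y)\<^sup>2) / 4) * bc \<alpha> (- ((z * y)\<^sup>2) / 4) * y powr (2 * \<alpha> + 1)))))"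
  have "has_bochner_integral lborel (\<lambda>T. \<integral>y. f T y \<partial>lborel)
    (s powr (- \<nu> - 1) * ((4 * s) powr (\<alpha> + 1) / 2 * (exp (- s * (x\<^sup>2 + z\<^sup>2)) * bc \<alpha> ((s * x * z)\<^sup>2))))"
  proof (rule fubini_has_bochner_integral[OF meas F])
    fix T y :: real
    show "\<bar>f T y\<bar> \<le> C * (F1 T y + F2 T y)"
    proof (cases "T > 0 \<and> y > 0")
      case True
      have "exp (- s * T) * \<bar>Kint \<nu> \<alpha> x z T y\<bar> \<le> exp (- s * T) * (C * Kint_majorant \<nu> T y)"
        using C(2) True by (intro mult_left_mono) auto
      then show ?thesis using True by (simp add: f_def F1_def F2_def m_def Kint_majorant_def abs_mult algebra_simps)
    next
      case False
      have "F1 T y \<ge> 0" "F2 T y \<ge> 0" using m0 by (auto simp: F1_def F2_def)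
      then have "0 \<le> C * (F1 T y + F2 T y)" using C(1) by simp
      then show ?thesis using False by (auto simp: f_def)
    qed
  next
    fix y :: real
    have "has_bochner_integral lborel (\<lambda>T. (indicator {0<..} y * (bc \<alpha> (- ((x * y)\<^sup>2) / 4) * bc \<alpha> (- ((z * y)\<^sup>2) / 4) * y powr (2 * \<alpha> + 1)))
        * (indicator {0<..} T * (exp (- s * T) * (T powr \<nu> * bc \<nu> (- T * (y\<^sup>2 / 4))))))
       ((indicator {0<..} y * (bc \<alpha> (- ((x * y)\<^sup>2) / 4) * bc \<alpha> (- ((z * y)\<^sup>2) / 4) * y powr (2 * \<alpha> + 1)))
        * (s powr (- \<nu> - 1) * exp (- (y\<^sup>2 / 4) / s)))"
      by (rule has_bochner_integral_mult_right[OF laplace_bc]) (use \<nu> s in auto)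
    then show "has_bochner_integral lborel (\<lambda>T. f T y) (g y)"
      by (simp add: f_def g_def Kint_def mult_ac)
  next
    show "has_bochner_integral lborel g
      (s powr (- \<nu> - 1) * ((4 * s) powr (\<alpha> + 1) / 2 * (exp (- s * (x\<^sup>2 + z\<^sup>2)) * bc \<alpha> ((s * x * z)\<^sup>2))))"
      unfolding g_def by (rule has_bochner_integral_mult_right[OF weber_bc_bc]) (use \<alpha> s in auto)
  qed
  moreover have "(\<integral>y. f T y \<partial>lborel) = indicator {0<..} T * (exp (- s * T) * (LBINT y:{0..}. Kint \<nu> \<alpha> x z T y))" for T
  proof -
    have "f T y = (indicator {0<..} T * exp (- s * T)) * (indicator {0..} y *\<^sub>R Kint \<nu> \<alpha> x z T y)" for y
      by (auto simp: f_def indicator_def Kint_def)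
    then have "(\<integral>y. f T y \<partial>lborel) = (indicator {0<..} T * exp (- s * T)) * (\<integral>y. indicator {0..} y *\<^sub>R Kint \<nu> \<alpha> x z T y \<partial>lborel)"
      by (simp only:) (rule integral_mult_right_zero)
    then show ?thesis by (simp add: set_lebesgue_integral_def mult.assoc)
  qed
  ultimately show ?thesis by simp
qed

text \<open>The integral of order \<open>\<nu> = \<alpha> + \<beta>\<close> is the \<open>T\<close>-derivative of the absolutely convergent one of
  order \<open>\<nu> + 1\<close>, which is identified through its Laplace transform.\<close>
lemma Kint_limit:
  assumes \<alpha>: "\<alpha> > -1/2" and \<beta>: "\<beta> > 0" and xz: "x > 0" "z > 0" and T0: "T0 > (x - z)\<^sup>2" "T0 \<noteq> (x + z)\<^sup>2"
  defines "p \<equiv> \<alpha> + 1/2"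
  shows "((\<lambda>R. integral {0..R} (Kint (\<alpha> + \<beta>) \<alpha> x z T0)) \<longlongrightarrow>
    4 powr (\<alpha> + 1) / (2 * Beta p p * Gamma (\<alpha> + 1) * Gamma \<beta>) *
      ((4 * x * z) powr (\<beta> - 1) * frac_integral p (\<beta> - 1) ((T0 - (x - z)\<^sup>2) / (4 * x * z)))) at_top"
proof -
  define \<nu> where "\<nu> = \<alpha> + \<beta>"
  have \<nu>: "\<nu> > -1/2" using \<alpha> \<beta> by (simp add: \<nu>_def)
  have p: "p > 0" using \<alpha> by (simp add: p_def)
  define D where "D = 4 * x * z"
  have D: "D > 0" using xz by (simp add: D_def)
  define a where "a = (\<lambda>T. (T - (x - z)\<^sup>2) / D)"
  define B where "B = Beta p p * Gamma (\<alpha> + 1)"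
  have B: "B > 0" using Beta_real_pos[OF p p] \<alpha> by (simp add: B_def Gamma_real_pos)
  \<comment> \<open>The ratio of the two Laplace transforms: 4^(\<alpha>+1)/2 from Weber's integral
    over B Gamma(\<beta> + 1) from Poisson's and the Gamma integral.\<close>
  define c where "c = 4 powr (\<alpha> + 1) / (2 * B * Gamma (\<beta> + 1))"
  have G1: "Gamma (\<beta> + 1) = \<beta> * Gamma \<beta>" "Gamma \<beta> > 0" "Gamma (\<beta> + 1) > 0"
    using \<beta> by (auto intro: Gamma_plus1 Gamma_real_pos simp: Gamma_real_pos)
      (metis Gamma_plus1 less_irrefl nonpos_Ints_nonpos not_less)
  define G where "G = (\<lambda>T. LBINT y:{0..}. Kint (\<nu> + 1) \<alpha> x z T y)"
  define h where "h = (\<lambda>T. c * (D powr \<beta> * frac_integral p \<beta> (a T)))"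
  have DD: "D = (x + z)\<^sup>2 - (x - z)\<^sup>2" by (simp add: D_def power2_eq_square algebra_simps)
  have a01: "a T > 0" "a T \<noteq> 1" if "T > (x - z)\<^sup>2" "T \<noteq> (x + z)\<^sup>2" for T
    using that D by (auto simp: a_def DD divide_eq_eq)
  have T00: "T0 > 0" using T0 zero_le_power2[of "x - z"] by linarith
  have "T0 \<noteq> (x - z)\<^sup>2" using T0 by simp
  from improper_Kint_derivative[OF \<nu> \<alpha> xz T00 this T0(2)] obtain S g g' where S: "open S" "T0 \<in> S" "S \<subseteq> {0<..}"
    and all: "\<forall>T\<in>S. ((\<lambda>R. integral {0..R} (Kint (\<nu> + 1) \<alpha> x z T)) \<longlongrightarrow> g T) at_top \<and>
     ((\<lambda>R. integral {0..R} (Kint \<nu> \<alpha> x z T)) \<longlongrightarrow> g' T) at_top \<and> (g has_real_derivative g' T) (at T)"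
    by (elim exE conjE) assumption
  have g: "\<And>T. T \<in> S \<Longrightarrow> ((\<lambda>R. integral {0..R} (Kint (\<nu> + 1) \<alpha> x z T)) \<longlongrightarrow> g T) at_top"
    and g': "\<And>T. T \<in> S \<Longrightarrow> ((\<lambda>R. integral {0..R} (Kint \<nu> \<alpha> x z T)) \<longlongrightarrow> g' T) at_top"
    and der: "\<And>T. T \<in> S \<Longrightarrow> (g has_real_derivative g' T) (at T)"
    using all by blast+
  have gG: "g T = G T" if "T \<in> S" for T
    unfolding G_def using that S \<nu>
    by (intro tendsto_unique[OF _ g Kint_limit_integrable] \<alpha> xz) auto
  \<comment> \<open>Both sides are compared only above (x - z)^2 and off (x + z)^2, where a(T) > 0
    and a(T) differs from 1, so that \<open>frac_integral_derivative\<close> applies.\<close>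
  define S' where "S' = S \<inter> {(x - z)\<^sup>2<..} \<inter> (- {(x + z)\<^sup>2})"
  have S': "open S'" "T0 \<in> S'" "S' \<subseteq> S" using S T0 by (auto simp: S'_def intro!: open_Int)
  have hder: "(h has_real_derivative c * (D powr \<beta> * (\<beta> * frac_integral p (\<beta> - 1) (a T) * (1 / D)))) (at T)" if "T \<in> S'" for T
  proof -
    have "(a has_real_derivative 1 / D) (at T)" unfolding a_def using D by (auto intro!: derivative_eq_intros)
    from DERIV_chain2[OF frac_integral_derivative[OF p \<beta> a01] this]
    have "((\<lambda>T. frac_integral p \<beta> (a T)) has_real_derivative \<beta> * frac_integral p (\<beta> - 1) (a T) * (1 / D)) (at T)"
      using that by (auto simp: S'_def)
    then show ?thesis unfolding h_def by (intro DERIV_cmult)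
  qed
  have lapG: "has_bochner_integral lborel (\<lambda>T. indicator {0<..} T * (exp (- s * T) * G T))
     (s powr (- (\<nu> + 1) - 1) * ((4 * s) powr (\<alpha> + 1) / 2 * (exp (- s * (x\<^sup>2 + z\<^sup>2)) * bc \<alpha> ((s * x * z)\<^sup>2))))" if "s > 0" for s
    unfolding G_def using \<nu> by (intro laplace_Kint \<alpha> xz that) auto
  have laph: "has_bochner_integral lborel (\<lambda>T. indicator {0<..} T * (exp (- s * T) * h T))
     (s powr (- (\<nu> + 1) - 1) * ((4 * s) powr (\<alpha> + 1) / 2 * (exp (- s * (x\<^sup>2 + z\<^sup>2)) * bc \<alpha> ((s * x * z)\<^sup>2))))" if s: "s > 0" for s
  proof -
    have p1: "p + 1/2 = \<alpha> + 1" "p - 1/2 = \<alpha>" by (auto simp: p_def)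
    have hb: "has_bochner_integral lborel (\<lambda>T. c * (indicator {0<..} T * (exp (- s * T) * (D powr \<beta> * frac_integral p \<beta> (a T)))))
       (c * (Gamma (\<beta> + 1) / s powr (\<beta> + 1) * (exp (- s * (x\<^sup>2 + z\<^sup>2)) * (B * bc \<alpha> ((s * x * z)\<^sup>2)))))"
      using has_bochner_integral_mult_right[OF laplace_frac_integral[OF p \<beta> s xz], of c]
      by (simp only: D_def[symmetric] a_def B_def p1)
    have val: "c * (Gamma (\<beta> + 1) / s powr (\<beta> + 1) * (exp (- s * (x\<^sup>2 + z\<^sup>2)) * (B * bc \<alpha> ((s * x * z)\<^sup>2))))
       = s powr (- (\<nu> + 1) - 1) * ((4 * s) powr (\<alpha> + 1) / 2 * (exp (- s * (x\<^sup>2 + z\<^sup>2)) * bc \<alpha> ((s * x * z)\<^sup>2)))"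
    proof -
      have "- (\<nu> + 1) - 1 = - (\<beta> + 1) + - (\<alpha> + 1)" by (simp add: \<nu>_def)
      then have "s powr (- (\<nu> + 1) - 1) = s powr (- (\<beta> + 1)) * s powr (- (\<alpha> + 1))" by (simp only: powr_add)
      then have e1: "s powr (- (\<nu> + 1) - 1) * (4 * s) powr (\<alpha> + 1) = 4 powr (\<alpha> + 1) / s powr (\<beta> + 1)"
        using s by (simp only: powr_mult powr_minus_divide) simp
      have e2: "c * (Gamma (\<beta> + 1) * B) = 4 powr (\<alpha> + 1) / 2" using B G1(3) by (simp add: c_def)
      define X where "X = exp (- s * (x\<^sup>2 + z\<^sup>2)) * bc \<alpha> ((s * x * z)\<^sup>2)"
      have "c * (Gamma (\<beta> + 1) / s powr (\<beta> + 1) * (exp (- s * (x\<^sup>2 + z\<^sup>2)) * (B * bc \<alpha> ((s * x * z)\<^sup>2))))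
          = c * (Gamma (\<beta> + 1) * B) / s powr (\<beta> + 1) * X"
        by (simp add: X_def)
      also have "\<dots> = (4 powr (\<alpha> + 1) / s powr (\<beta> + 1)) / 2 * X" unfolding e2 by simp
      also have "\<dots> = s powr (- (\<nu> + 1) - 1) * ((4 * s) powr (\<alpha> + 1) / 2 * X)" unfolding e1[symmetric] by simp
      finally show ?thesis by (simp only: X_def)
    qed
    have "(\<lambda>T. c * (indicator {0<..} T * (exp (- s * T) * (D powr \<beta> * frac_integral p \<beta> (a T))))) = (\<lambda>T. indicator {0<..} T * (exp (- s * T) * h T))"
      by (simp add: h_def mult_ac)
    then show ?thesis using hb unfolding val by simp
  qed
  have contG: "continuous_on S' G"
  proof -
    have "continuous_on S' g"
      using S' der by (intro continuous_at_imp_continuous_on) (auto intro: DERIV_isCont)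
    then show ?thesis by (rule continuous_on_cong[THEN iffD1, rotated -1]) (use S' gG in auto)
  qed
  have conth: "continuous_on S' h"
    using hder by (intro continuous_at_imp_continuous_on) (auto intro: DERIV_isCont)
  have Gh: "g T = h T" if T: "T \<in> S'" for T
  proof -
    have "G T = h T"
      by (rule laplace_unique[OF lapG laph S'(1) T _ contG conth]) (use T S' S in auto)
    then show ?thesis using gG[of T] T S' by auto
  qed
  \<comment> \<open>As g and h agree near T0, their derivatives there agree: the limit of the
    integrals of order \<nu> equals the explicit derivative of h.\<close>
  have "(h has_real_derivative g' T0) (at T0)"
    by (rule has_field_derivative_transform_within_open[OF der[OF S(2)] S'(1,2)]) (rule Gh)
  then have "g' T0 = c * (D powr \<beta> * (\<beta> * frac_integral p (\<beta> - 1) (a T0) * (1 / D)))"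
    by (rule DERIV_unique) (rule hder[OF S'(2)])
  also have "\<dots> = 4 powr (\<alpha> + 1) / (2 * B * Gamma \<beta>) * (D powr (\<beta> - 1) * frac_integral p (\<beta> - 1) (a T0))"
  proof -
    have "D powr (\<beta> - 1) = D powr \<beta> / D" using D by (simp add: powr_diff)
    then show ?thesis using \<beta> G1(2) by (simp add: c_def G1(1))
  qed
  finally show ?thesis using g'[OF S(2)] by (simp add: B_def \<nu>_def a_def D_def mult.assoc)
qed

section \<open>From the Bessel integral to the two-sided estimates\<close>

lemma bessel_J_eq_bc:
  assumes "x > 0"
  shows "bessel_J \<nu> x / x powr \<nu> = 2 powr (- \<nu>) * bc \<nu> (- (x\<^sup>2) / 4)"
proof -
  have "(-1) ^ k * rGamma (\<nu> + real k + 1) / fact k * (x / 2) powr (2 * real k + \<nu>)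
     = (x / 2) powr \<nu> * (bc_coeff \<nu> k * (- (x\<^sup>2) / 4) ^ k)" for k
  proof -
    have "(x / 2) powr (2 * real k) = (x / 2) powr real (2 * k)" by simp
    also have "\<dots> = (x / 2) ^ (2 * k)" using assms by (intro powr_realpow) simp
    also have "\<dots> = (x\<^sup>2 / 4) ^ k" by (simp add: power_mult power_divide)
    finally have "(x / 2) powr (2 * real k) = (x\<^sup>2 / 4) ^ k" .
    moreover have "(- (x\<^sup>2) / 4) ^ k = (-1) ^ k * (x\<^sup>2 / 4) ^ k"
      by (simp flip: power_mult_distrib)
    ultimately show ?thesis by (simp add: powr_add bc_coeff_def)
  qed
  then have "bessel_J \<nu> x = (x / 2) powr \<nu> * bc \<nu> (- (x\<^sup>2) / 4)"
    unfolding bessel_J_def using sums_mult[OF bc_sums[of \<nu> "- (x\<^sup>2) / 4"], of "(x / 2) powr \<nu>"] by (simp add: sums_iff)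
  then show ?thesis using assms by (simp add: powr_divide powr_minus_divide)
qed

lemma K_integrand_eq_Kint:
  assumes "x > 0" "z > 0" "t > 0" "y > 0"
  shows "K_integrand \<alpha> \<beta> t x z y = 2 powr (- (\<alpha> + \<beta>) - 2 * \<alpha>) / t powr (2 * \<alpha> + 2 * \<beta>) * Kint (\<alpha> + \<beta>) \<alpha> x z (t\<^sup>2) y"
proof -
  have "t\<^sup>2 powr (\<alpha> + \<beta>) = (t powr 2) powr (\<alpha> + \<beta>)" using assms by simp
  also have "\<dots> = t powr (2 * \<alpha> + 2 * \<beta>)" by (simp add: powr_powr algebra_simps)
  finally have t: "t\<^sup>2 powr (\<alpha> + \<beta>) = t powr (2 * \<alpha> + 2 * \<beta>)" .
  have "- (\<alpha> + \<beta>) - 2 * \<alpha> = - (\<alpha> + \<beta>) + (- \<alpha> + - \<alpha>)" by simp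
  then have "2 powr (- (\<alpha> + \<beta>) - 2 * \<alpha>) = 2 powr (- (\<alpha> + \<beta>)) * (2 powr (- \<alpha>) * 2 powr (- \<alpha>))"
    by (simp only: powr_add)
  moreover have "- ((t * y)\<^sup>2) / 4 = - t\<^sup>2 * (y\<^sup>2 / 4)" by (simp add: power_mult_distrib)
  ultimately show ?thesis
    using assms by (simp add: K_integrand_def Kint_def bessel_J_eq_bc t)
qed

text \<open>Both readings of the integral in \<open>K\<close> lead to the limit of truncations found
  in \<open>Kint_limit\<close>: where the integral converges absolutely, its Lebesgue value is that
  same limit.\<close>

lemma K_eq:
  assumes \<alpha>: "\<alpha> > -1/2" and \<beta>: "\<beta> > 0" and xz: "x > 0" "z > 0" and t: "t > 0" "t > \<bar>x - z\<bar>" "t \<noteq> x + z"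
  defines "p \<equiv> \<alpha> + 1/2"
  defines "c \<equiv> 2 powr (- 2 * \<alpha>) * Gamma (\<alpha> + \<beta> + 1) * (4 powr (\<alpha> + 1) / (2 * Beta p p * Gamma (\<alpha> + 1) * Gamma \<beta>))"
  shows "K \<alpha> \<beta> t x z = c / t powr (2 * \<alpha> + 2 * \<beta>) *
      ((4 * x * z) powr (\<beta> - 1) * frac_integral p (\<beta> - 1) ((t\<^sup>2 - (x - z)\<^sup>2) / (4 * x * z)))"
proof -
  define \<nu> where "\<nu> = \<alpha> + \<beta>"
  define k where "k = 2 powr (- \<nu> - 2 * \<alpha>) / t powr (2 * \<alpha> + 2 * \<beta>)"
  define L where "L = 4 powr (\<alpha> + 1) / (2 * Beta p p * Gamma (\<alpha> + 1) * Gamma \<beta>) *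
      ((4 * x * z) powr (\<beta> - 1) * frac_integral p (\<beta> - 1) ((t\<^sup>2 - (x - z)\<^sup>2) / (4 * x * z)))"
  have T: "t\<^sup>2 > (x - z)\<^sup>2" "t\<^sup>2 \<noteq> (x + z)\<^sup>2" "t\<^sup>2 > 0"
    using t xz by (auto simp: abs_le_square_iff[symmetric] not_le[symmetric] power2_eq_iff)
  have lim: "((\<lambda>R. integral {0..R} (Kint \<nu> \<alpha> x z (t\<^sup>2))) \<longlongrightarrow> L) at_top"
    using Kint_limit[OF \<alpha> \<beta> xz T(1,2)] by (simp only: L_def \<nu>_def p_def)
  \<comment> \<open>Including y = 0 on the right is harmless, since
    \<open>0 powr (2 * \<alpha> + 1) = 0\<close> makes \<open>Kint\<close> vanish there.\<close>
  have Keq: "indicator {0<..R} y *\<^sub>R K_integrand \<alpha> \<beta> t x z y = k * (indicator {0..R} y *\<^sub>R Kint \<nu> \<alpha> x z (t\<^sup>2) y)" for R y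
    using K_integrand_eq_Kint[OF xz t(1), of y \<alpha> \<beta>] by (cases "y > 0") (auto simp: k_def \<nu>_def indicator_def Kint_def not_less le_less)
  have Keq': "indicator {0<..} y *\<^sub>R K_integrand \<alpha> \<beta> t x z y = k * (indicator {0..} y *\<^sub>R Kint \<nu> \<alpha> x z (t\<^sup>2) y)" for y
    using K_integrand_eq_Kint[OF xz t(1), of y \<alpha> \<beta>] by (cases "y > 0") (auto simp: k_def \<nu>_def indicator_def Kint_def not_less le_less)
  have fin: "(LBINT y:{0<..R}. K_integrand \<alpha> \<beta> t x z y) = k * integral {0..R} (Kint \<nu> \<alpha> x z (t\<^sup>2))" for R
  proof -
    have "(LBINT y:{0<..R}. K_integrand \<alpha> \<beta> t x z y) = k * (LBINT y:{0..R}. Kint \<nu> \<alpha> x z (t\<^sup>2) y)"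
      unfolding set_lebesgue_integral_def Keq by (rule integral_mult_right_zero)
    also have "(LBINT y:{0..R}. Kint \<nu> \<alpha> x z (t\<^sup>2) y) = integral {0..R} (Kint \<nu> \<alpha> x z (t\<^sup>2))"
      by (intro set_borel_integral_eq_integral borel_integrable_atLeastAtMost' continuous_on_Kint' \<alpha>)
    finally show ?thesis .
  qed
  have "(if \<alpha> + \<beta> > 1/2 then (LBINT y:{0<..}. K_integrand \<alpha> \<beta> t x z y)
      else Lim at_top (\<lambda>R. LBINT y:{0<..R}. K_integrand \<alpha> \<beta> t x z y)) = k * L"
  proof (cases "\<alpha> + \<beta> > 1/2")
    case True
    have "(LBINT y:{0<..}. K_integrand \<alpha> \<beta> t x z y) = k * (LBINT y:{0..}. Kint \<nu> \<alpha> x z (t\<^sup>2) y)"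
      unfolding set_lebesgue_integral_def Keq' by (rule integral_mult_right_zero)
    also have "(LBINT y:{0..}. Kint \<nu> \<alpha> x z (t\<^sup>2) y) = L"
      using True T by (intro tendsto_unique[OF _ Kint_limit_integrable lim] \<alpha> xz) (auto simp: \<nu>_def)
    finally show ?thesis using True by simp
  next
    case False
    have "((\<lambda>R. LBINT y:{0<..R}. K_integrand \<alpha> \<beta> t x z y) \<longlongrightarrow> k * L) at_top"
      unfolding fin by (intro tendsto_mult tendsto_const lim)
    then have "Lim at_top (\<lambda>R. LBINT y:{0<..R}. K_integrand \<alpha> \<beta> t x z y) = k * L"
      by (intro tendsto_Lim) auto
    then show ?thesis using False by simp
  qed
  then have "K \<alpha> \<beta> t x z = 2 powr \<nu> * Gamma (\<alpha> + \<beta> + 1) * (k * L)"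
    by (simp add: K_def \<nu>_def)
  also have "\<dots> = (2 powr \<nu> * 2 powr (- \<nu> - 2 * \<alpha>)) * Gamma (\<alpha> + \<beta> + 1) / t powr (2 * \<alpha> + 2 * \<beta>) * L"
    by (simp add: k_def)
  also have "2 powr \<nu> * 2 powr (- \<nu> - 2 * \<alpha>) = 2 powr (- 2 * \<alpha>)" by (simp flip: powr_add)
  finally show ?thesis by (simp add: L_def c_def mult_ac)
qed

text \<open>Separate lower and upper constants are merged into max C (1/c); nonnegativity of Y
  allows both to be weakened.\<close>

lemma simeq_onI:
  assumes "0 < c" "0 < C" and "\<And>t x z. D t x z \<Longrightarrow> 0 \<le> Y t x z \<and> c * Y t x z \<le> X t x z \<and> X t x z \<le> C * Y t x z"
  shows "simeq_on D X Y"
  unfolding simeq_on_def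
proof (intro exI conjI allI impI)
  let ?C = "max C (1 / c)"
  show "0 < ?C" using assms by (simp add: less_max_iff_disj)
  fix t x z assume D: "D t x z"
  have "inverse ?C \<le> inverse (1 / c)" using assms by (intro le_imp_inverse_le) auto
  then have "inverse ?C * Y t x z \<le> c * Y t x z" using assms(3)[OF D] by (intro mult_right_mono) auto
  then show "inverse ?C * Y t x z \<le> X t x z" using assms(3)[OF D] by linarith
  have "C * Y t x z \<le> ?C * Y t x z" using assms(3)[OF D] by (intro mult_right_mono) auto
  then show "X t x z \<le> ?C * Y t x z" using assms(3)[OF D] by linarith
qed

text \<open>Here 0 < a < 1, and the Euler parameters (\<beta>, 1 - p) have difference e = \<alpha> +
  \<beta> - 1/2. The powers of 4xz combine to (4xz)^(-p), and 1 - a = ((x + z)^2 - t^2)/(4xz) is the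
  quantity inside the cases.\<close>

lemma K_simeq_inside:
  assumes \<alpha>: "\<alpha> > -1/2" and \<beta>: "\<beta> > 0"
  shows "simeq_on (\<lambda>t x z. t > 0 \<and> x > 0 \<and> z > 0 \<and> \<bar>x - z\<bar> < t \<and> t < x + z)
       (K \<alpha> \<beta>)
       (\<lambda>t x z. (x * z) powr (- \<alpha> - 1/2) / t powr (2 * \<alpha> + 2 * \<beta>)
          * (t^2 - (x - z)^2) powr (\<alpha> + \<beta> - 1/2)
          * (if \<alpha> + \<beta> < 1/2 then (((x + z)^2 - t^2) / (x * z)) powr (\<alpha> + \<beta> - 1/2)
             else if \<alpha> + \<beta> = 1/2 then 1 + ln (4 * x * z / ((x + z)^2 - t^2))
             else 1))" (is "simeq_on _ _ ?Y")
proof -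
  define p where "p = \<alpha> + 1/2"
  define e where "e = \<alpha> + \<beta> - 1/2"
  define \<kappa> where "\<kappa> = 2 powr (- 2 * \<alpha>) * Gamma (\<alpha> + \<beta> + 1) * (4 powr (\<alpha> + 1) / (2 * Beta p p * Gamma (\<alpha> + 1) * Gamma \<beta>))"
  have p: "p > 0" using \<alpha> by (simp add: p_def)
  have \<kappa>: "\<kappa> > 0" using \<alpha> \<beta> p by (simp add: \<kappa>_def Gamma_real_pos Beta_real_pos)
  define h where "h = (\<lambda>b. if e < 0 then (1 - b) powr e else if e = 0 then 1 + ln (1 / (1 - b)) else 1)"
  \<comment> \<open>The power case is normalised by xz but the logarithmic one by 4xz;
    \<open>k\<close> restores the missing 4^e, and \<open>M\<close> compensates for it.\<close>
  define k where "k = (if e < 0 then 4 powr e else 1)"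
  have k: "k > 0" by (simp add: k_def)
  obtain c C where cC: "0 < c" "0 < C"
    and E: "\<And>b. 0 < b \<Longrightarrow> b < 1 \<Longrightarrow> c * h b \<le> euler_integral p \<beta> (1 - p) b \<and> euler_integral p \<beta> (1 - p) b \<le> C * h b"
  proof -
    have r: "(\<beta> < 1 - p) = (e < 0)" "(\<beta> = 1 - p) = (e = 0)" "\<beta> - (1 - p) = e" by (auto simp: p_def e_def)
    show ?thesis using that euler_integral_asymp[OF p \<beta>, of "1 - p"] unfolding r h_def by blast
  qed
  define M where "M = \<kappa> * 4 powr (- p) / k"
  have l: "M > 0" using \<kappa> k by (simp add: M_def)
  show ?thesis
  proof (rule simeq_onI[of "M * c" "M * C"])
    fix t x z :: real
    assume D: "t > 0 \<and> x > 0 \<and> z > 0 \<and> \<bar>x - z\<bar> < t \<and> t < x + z"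
    define A where "A = t\<^sup>2 - (x - z)\<^sup>2"
    define a where "a = A / (4 * x * z)"
    have xz: "x * z > 0" "4 * x * z > 0" using D by auto
    have A: "A > 0" using D by (simp add: A_def flip: abs_le_square_iff not_le)
    have t2: "t\<^sup>2 < (x + z)\<^sup>2" using D by (intro power_strict_mono) auto
    have a1: "1 - a = ((x + z)\<^sup>2 - t\<^sup>2) / (4 * x * z)"
    proof -
      have "1 - a = (4 * x * z - A) / (4 * x * z)" using D by (simp add: a_def diff_divide_distrib)
      moreover have "4 * x * z - A = (x + z)\<^sup>2 - t\<^sup>2" by (simp add: A_def power2_eq_square algebra_simps)
      ultimately show ?thesis by (simp only:)
    qed
    have a: "0 < a" "a < 1"
    proof -
      show "0 < a" using A xz by (simp add: a_def)
      have "0 < 1 - a" unfolding a1 using t2 xz by (intro divide_pos_pos) auto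
      then show "a < 1" by simp
    qed
    define W where "W = (x * z) powr (- p) / t powr (2 * \<alpha> + 2 * \<beta>) * A powr e"
    have W: "W \<ge> 0" by (simp add: W_def)
    define Y where "Y = W * (k * h a)"
    have "K \<alpha> \<beta> t x z = \<kappa> / t powr (2 * \<alpha> + 2 * \<beta>) * ((4 * x * z) powr (\<beta> - 1) * frac_integral p (\<beta> - 1) a)"
      using K_eq[OF \<alpha> \<beta>, of x z t] D by (simp add: \<kappa>_def p_def a_def A_def)
    also have "frac_integral p (\<beta> - 1) a = a powr (p + (\<beta> - 1)) * euler_integral p \<beta> (1 - p) a"
      using frac_integral_inside[OF p _ a, of "\<beta> - 1"] \<beta> by simp
    also have "p + (\<beta> - 1) = e" by (simp add: p_def e_def)
    also have "a powr e = A powr e / (4 * x * z) powr e" using A xz by (simp add: a_def powr_divide)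
    also have "(4 * x * z) powr (\<beta> - 1) * (A powr e / (4 * x * z) powr e * euler_integral p \<beta> (1 - p) a)
       = (4 * x * z) powr (\<beta> - 1) / (4 * x * z) powr e * A powr e * euler_integral p \<beta> (1 - p) a" by simp
    also have "(4 * x * z) powr (\<beta> - 1) / (4 * x * z) powr e = 4 powr (- p) * (x * z) powr (- p)"
    proof -
      have "(4 * x * z) powr (\<beta> - 1) / (4 * x * z) powr e = (4 * x * z) powr (\<beta> - 1 - e)" by (rule powr_diff[symmetric])
      also have "\<beta> - 1 - e = - p" by (simp add: p_def e_def)
      also have "(4 * x * z) powr (- p) = (4 * (x * z)) powr (- p)" by (simp add: mult.assoc)
      also have "\<dots> = 4 powr (- p) * (x * z) powr (- p)" using xz by (intro powr_mult)
      finally show ?thesis .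
    qed
    finally have K: "K \<alpha> \<beta> t x z = M * (W * k) * euler_integral p \<beta> (1 - p) a"
      using k by (simp add: M_def W_def)
    have "h a \<ge> 0" using a by (simp add: h_def)
    then have "Y \<ge> 0" using W k by (simp add: Y_def)
    moreover have "M * c * Y \<le> K \<alpha> \<beta> t x z"
    proof -
      have "(M * (W * k)) * (c * h a) \<le> (M * (W * k)) * euler_integral p \<beta> (1 - p) a"
        using E[OF a] l W k by (intro mult_left_mono) auto
      then show ?thesis by (simp add: K Y_def mult_ac)
    qed
    moreover have "K \<alpha> \<beta> t x z \<le> M * C * Y"
    proof -
      have "(M * (W * k)) * euler_integral p \<beta> (1 - p) a \<le> (M * (W * k)) * (C * h a)"
        using E[OF a] l W k by (intro mult_left_mono) auto
      then show ?thesis by (simp add: K Y_def mult_ac)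
    qed
    moreover have "Y = ?Y t x z"
    proof -
      have "k * h a = (if \<alpha> + \<beta> < 1/2 then (((x + z)^2 - t^2) / (x * z)) powr e
             else if \<alpha> + \<beta> = 1/2 then 1 + ln (4 * x * z / ((x + z)^2 - t^2)) else 1)"
      proof (cases "e < 0")
        case True
        have "((x + z)\<^sup>2 - t\<^sup>2) / (x * z) = 4 * (1 - a)" unfolding a1 using D by (simp add: field_simps)
        then have "(((x + z)^2 - t^2) / (x * z)) powr e = 4 powr e * (1 - a) powr e"
          by (simp only:) (rule powr_mult)
        then show ?thesis using True by (simp add: k_def h_def e_def)
      next
        case False
        have "1 / (1 - a) = 4 * x * z / ((x + z)^2 - t^2)" unfolding a1 by simp
        then show ?thesis using False by (auto simp: k_def h_def e_def)
      qed
      moreover have "- p = - \<alpha> - 1/2" by (simp add: p_def)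
      ultimately show ?thesis unfolding Y_def W_def A_def e_def by simp
    qed
    ultimately show "0 \<le> ?Y t x z \<and> M * c * ?Y t x z \<le> K \<alpha> \<beta> t x z \<and> K \<alpha> \<beta> t x z \<le> M * C * ?Y t x z"
      by (simp only:)
  qed (use l cC in auto)
qed

text \<open>Here a > 1, so the Euler variable is 1/a. The product (4xz)^(\<beta>-1) a^(\<beta>-1)
  collapses to [t^2 - (x - z)^2]^(\<beta>-1), so no separate power of xz survives, and 1 - 1/a is
  the quotient inside the cases.\<close>

lemma K_simeq_outside:
  assumes \<alpha>: "\<alpha> > -1/2" and \<beta>: "\<beta> > 0"
  shows "simeq_on (\<lambda>t x z. t > 0 \<and> x > 0 \<and> z > 0 \<and> t > x + z)
       (K \<alpha> \<beta>)
       (\<lambda>t x z. 1 / t powr (2 * \<alpha> + 2 * \<beta>)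
          * (t^2 - (x - z)^2) powr (\<beta> - 1)
          * (if \<alpha> + \<beta> < 1/2 then ((t^2 - (x + z)^2) / (t^2 - (x - z)^2)) powr (\<alpha> + \<beta> - 1/2)
             else if \<alpha> + \<beta> = 1/2 then 1 + ln ((t^2 - (x - z)^2) / (t^2 - (x + z)^2))
             else 1))" (is "simeq_on _ _ ?Y")
proof -
  define p where "p = \<alpha> + 1/2"
  define e where "e = \<alpha> + \<beta> - 1/2"
  define \<kappa> where "\<kappa> = 2 powr (- 2 * \<alpha>) * Gamma (\<alpha> + \<beta> + 1) * (4 powr (\<alpha> + 1) / (2 * Beta p p * Gamma (\<alpha> + 1) * Gamma \<beta>))"
  have p: "p > 0" using \<alpha> by (simp add: p_def)
  have \<kappa>: "\<kappa> > 0" using \<alpha> \<beta> p by (simp add: \<kappa>_def Gamma_real_pos Beta_real_pos)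
  define h where "h = (\<lambda>b. if e < 0 then (1 - b) powr e else if e = 0 then 1 + ln (1 / (1 - b)) else 1)"
  obtain c C where cC: "0 < c" "0 < C"
    and E: "\<And>b. 0 < b \<Longrightarrow> b < 1 \<Longrightarrow> c * h b \<le> euler_integral p p (1 - \<beta>) b \<and> euler_integral p p (1 - \<beta>) b \<le> C * h b"
  proof -
    have r: "(p < 1 - \<beta>) = (e < 0)" "(p = 1 - \<beta>) = (e = 0)" "p - (1 - \<beta>) = e" by (auto simp: p_def e_def)
    show ?thesis using that euler_integral_asymp[OF p p, of "1 - \<beta>"] unfolding r h_def by blast
  qed
  show ?thesis
  proof (rule simeq_onI[of "\<kappa> * c" "\<kappa> * C"])
    fix t x z :: real
    assume D: "t > 0 \<and> x > 0 \<and> z > 0 \<and> t > x + z"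
    define A where "A = t\<^sup>2 - (x - z)\<^sup>2"
    define a where "a = A / (4 * x * z)"
    have xz: "4 * x * z > 0" using D by auto
    have t1: "\<bar>x - z\<bar> < t" using D by linarith
    have t2: "(x + z)\<^sup>2 < t\<^sup>2" using D by (intro power_strict_mono) auto
    have A: "A > 0" "A > 4 * x * z"
    proof -
      have "A = t\<^sup>2 - (x + z)\<^sup>2 + 4 * x * z" by (simp add: A_def power2_eq_square algebra_simps)
      then show "A > 4 * x * z" using t2 by simp
      then show "A > 0" using xz by simp
    qed
    have a1: "1 - 1 / a = (t\<^sup>2 - (x + z)\<^sup>2) / A"
      using xz A by (simp add: a_def) (simp add: A_def field_simps power2_eq_square)
    have a: "1 < a" "0 < 1 / a" "1 / a < 1"
    proof -
      show "1 < a" using A xz by (simp add: a_def)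
      then show "0 < 1 / a" "1 / a < 1" by auto
    qed
    define W where "W = 1 / t powr (2 * \<alpha> + 2 * \<beta>) * A powr (\<beta> - 1)"
    have W: "W \<ge> 0" by (simp add: W_def)
    define Y where "Y = W * h (1 / a)"
    have "K \<alpha> \<beta> t x z = \<kappa> / t powr (2 * \<alpha> + 2 * \<beta>) * ((4 * x * z) powr (\<beta> - 1) * frac_integral p (\<beta> - 1) a)"
      using K_eq[OF \<alpha> \<beta>, of x z t] D t1 by (simp add: \<kappa>_def p_def a_def A_def)
    also have "frac_integral p (\<beta> - 1) a = a powr (\<beta> - 1) * euler_integral p p (1 - \<beta>) (1 / a)"
      using frac_integral_outside[OF p a(1), of "\<beta> - 1"] by simp
    also have "(4 * x * z) powr (\<beta> - 1) * (a powr (\<beta> - 1) * euler_integral p p (1 - \<beta>) (1 / a))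
       = ((4 * x * z) powr (\<beta> - 1) * a powr (\<beta> - 1)) * euler_integral p p (1 - \<beta>) (1 / a)" by simp
    also have "(4 * x * z) powr (\<beta> - 1) * a powr (\<beta> - 1) = A powr (\<beta> - 1)"
      using A xz D by (simp add: a_def powr_divide)
    finally have K: "K \<alpha> \<beta> t x z = \<kappa> * W * euler_integral p p (1 - \<beta>) (1 / a)"
      by (simp add: W_def)
    have "h (1 / a) \<ge> 0" using a by (simp add: h_def)
    then have "Y \<ge> 0" using W by (simp add: Y_def)
    moreover have "\<kappa> * c * Y \<le> K \<alpha> \<beta> t x z"
    proof -
      have "(\<kappa> * W) * (c * h (1 / a)) \<le> (\<kappa> * W) * euler_integral p p (1 - \<beta>) (1 / a)"
        using E[OF a(2,3)] \<kappa> W by (intro mult_left_mono) auto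
      then show ?thesis by (simp add: K Y_def mult_ac)
    qed
    moreover have "K \<alpha> \<beta> t x z \<le> \<kappa> * C * Y"
    proof -
      have "(\<kappa> * W) * euler_integral p p (1 - \<beta>) (1 / a) \<le> (\<kappa> * W) * (C * h (1 / a))"
        using E[OF a(2,3)] \<kappa> W by (intro mult_left_mono) auto
      then show ?thesis by (simp add: K Y_def mult_ac)
    qed
    moreover have "Y = ?Y t x z"
    proof -
      have "h (1 / a) = (if \<alpha> + \<beta> < 1/2 then ((t^2 - (x + z)^2) / A) powr (\<alpha> + \<beta> - 1/2)
             else if \<alpha> + \<beta> = 1/2 then 1 + ln (A / (t^2 - (x + z)^2)) else 1)"
        unfolding h_def a1 by (auto simp: e_def)
      then show ?thesis unfolding Y_def W_def by (simp only: A_def)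
    qed
    ultimately show "0 \<le> ?Y t x z \<and> \<kappa> * c * ?Y t x z \<le> K \<alpha> \<beta> t x z \<and> K \<alpha> \<beta> t x z \<le> \<kappa> * C * ?Y t x z"
      by (simp only:)
  qed (use \<kappa> cC in auto)
qed

theorem theorem2p3:
  fixes \<alpha> \<beta> :: real
  assumes "\<alpha> > -1/2" and "\<beta> > 0"
  shows
    "simeq_on (\<lambda>t x z. t > 0 \<and> x > 0 \<and> z > 0 \<and> \<bar>x - z\<bar> < t \<and> t < x + z)
       (K \<alpha> \<beta>)
       (\<lambda>t x z. (x * z) powr (- \<alpha> - 1/2) / t powr (2 * \<alpha> + 2 * \<beta>)
          * (t^2 - (x - z)^2) powr (\<alpha> + \<beta> - 1/2)
          * (if \<alpha> + \<beta> < 1/2 then (((x + z)^2 - t^2) / (x * z)) powr (\<alpha> + \<beta> - 1/2)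
             else if \<alpha> + \<beta> = 1/2 then 1 + ln (4 * x * z / ((x + z)^2 - t^2))
             else 1))
     \<and>
     simeq_on (\<lambda>t x z. t > 0 \<and> x > 0 \<and> z > 0 \<and> t > x + z)
       (K \<alpha> \<beta>)
       (\<lambda>t x z. 1 / t powr (2 * \<alpha> + 2 * \<beta>)
          * (t^2 - (x - z)^2) powr (\<beta> - 1)
          * (if \<alpha> + \<beta> < 1/2 then ((t^2 - (x + z)^2) / (t^2 - (x - z)^2)) powr (\<alpha> + \<beta> - 1/2)
             else if \<alpha> + \<beta> = 1/2 then 1 + ln ((t^2 - (x - z)^2) / (t^2 - (x + z)^2))
             else 1))"
  by (rule conjI[OF K_simeq_inside[OF assms] K_simeq_outside[OF assms]])

end
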